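(* (a) If $R$ is a Noetherian ring, then $\operatorname{trdeg}(R)=\dim(R)$. (b) If $R$ is a Noetherian Jacobson ring and $A$ is a subfinite $R$-algebra, then $\operatorname{trdeg}_{\mathrm{lex}}(A:R)=\dim(A)$. (c) If $R$ is a Noetherian Jacobson ring and $A$ is a subfinite $R$-algebra that is Noetherian, then $\operatorname{trdeg}(A:R)=\dim(A)$.
   Context: All rings are commutative with identity element $1$. An $R$-algebra is a ring $A$ together with a ring homomorphism $R\to A$; it is called subfinite if it is a subalgebra of a finitely generated $R$-algebra. $\dim$ denotes the Krull dimension, and the zero ring has dimension $-1$. A Jacobson ring is a ring in which every prime ideal is an intersection of maximal ideals. A monomial ordering is a total ordering $\preceq$ on the set of monomials in infinitely many indeterminates $x_1,x_2,\ldots$ such that $1\preceq s$, and $st_1\preceq st_2$ whenever $t_1\preceq t_2$, for all monomials $s,t_1,t_2$. The symbol $\mathrm{lex}$ denotes the lexicographic ordering with $x_i>x_{i+1}$ for all $i$. Let $R$ be a ring. A nonzero polynomial $f\in R[x_1,x_2,\ldots]$ is submonic with respect to $\preceq$ if its trailing coefficient (the coefficient of the $\preceq$-least monomial having nonzero coefficient) is $1$. (Over the zero ring, the polynomial $0$ is regarded as submonic with respect to every monomial ordering.) A polynomial is submonic if it is submonic with respect to some monomial ordering. Let $A$ be an $R$-algebra. Elements $a_1,\ldots,a_n\in A$ are algebraically dependent over $R$ if there is a submonic $f\in R[x_1,\ldots,x_n]$ with $f(a_1,\ldots,a_n)=0$ (the map $R\to A$ being applied to the coefficients of $f$); otherwise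 they are algebraically independent over $R$. If $f$ is required to be submonic with respect to a specified monomial ordering $\preceq$, one speaks of algebraic dependence or independence with respect to $\preceq$. The transcendence degree $\operatorname{trdeg}(A:R)$ is the supremum (possibly $\infty$) of all positive integers $n$ such that there exist $a_1,\ldots,a_n\in A$ that are algebraically independent over $R$; if every $a\in A$ is algebraically dependent over $R$, one sets $\operatorname{trdeg}(A:R):=0$ if $A\neq\{0\}$ and $\operatorname{trdeg}(A:R):=-1$ if $A=\{0\}$. One writes $\operatorname{trdeg}(R):=\operatorname{trdeg}(R:R)$. For a monomial ordering $\preceq$, $\operatorname{trdeg}_\preceq(A:R)$ is defined in the same way, using algebraic independence and dependence with respect to $\preceq$. *)

theory Defs
  imports "HOL-Algebra.Algebra" "HOL-Library.Extended_Real"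
begin

text \<open>
  Rings are HOL-Algebra structures satisfying \<^term>\<open>cring\<close>, so the zero ring is included.
  An \<open>R\<close>-algebra \<open>A\<close> comes with its structure map \<open>\<phi>\<close>, as in \<^term>\<open>ring_hom_cring R A \<phi>\<close>.
  Dimensions and transcendence degrees take their values \<open>-1, 0, 1, \<dots>, \<infinity>\<close> in \<^typ>\<open>ereal\<close>.
\<close>

definition krull_dim :: "('a, 'm) ring_scheme \<Rightarrow> ereal" where
  "krull_dim R =
     (if carrier R = {\<zero>\<^bsub>R\<^esub>} then -1
      else Sup {ereal (real n) | n. \<exists>P :: nat \<Rightarrow> 'a set.
                  (\<forall>i\<le>n. primeideal (P i) R) \<and> (\<forall>i<n. P i \<subset> P (Suc i))})"

definition jacobson_ring :: "('a, 'm) ring_scheme \<Rightarrow> bool" where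
  "jacobson_ring R \<longleftrightarrow>
     cring R \<and> (\<forall>P. primeideal P R \<longrightarrow> (\<exists>\<M> \<subseteq> {M. maximalideal M R}. P = \<Inter>\<M>))"

definition finitely_generated_algebra ::
    "('r, 'm) ring_scheme \<Rightarrow> ('b, 'n) ring_scheme \<Rightarrow> ('r \<Rightarrow> 'b) \<Rightarrow> bool" where
  "finitely_generated_algebra R B \<psi> \<longleftrightarrow>
     ring_hom_cring R B \<psi> \<and>
     (\<exists>S \<subseteq> carrier B. finite S \<and> generate_ring B (\<psi> ` carrier R \<union> S) = carrier B)"

text \<open>
  A formula cannot quantify over types, so the carrier type of the ambient finitely generated
  algebra \<open>B\<close> is a parameter. A theorem assuming \<open>subfinite_algebra TYPE('b) R A \<phi>\<close> with a type
  variable \<open>'b\<close> occurring nowhere else covers every possible \<open>B\<close>.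
  Being a subalgebra is expressed by an injective \<open>R\<close>-algebra homomorphism \<open>\<iota>\<close> from \<open>A\<close> to \<open>B\<close>.
\<close>

definition subfinite_algebra ::
    "'b itself \<Rightarrow> ('r, 'm) ring_scheme \<Rightarrow> ('a, 'n) ring_scheme \<Rightarrow> ('r \<Rightarrow> 'a) \<Rightarrow> bool" where
  "subfinite_algebra (_ :: 'b itself) R A \<phi> \<longleftrightarrow>
     ring_hom_cring R A \<phi> \<and>
     (\<exists>(B :: 'b ring) \<psi> \<iota>.
        finitely_generated_algebra R B \<psi> \<and>
        \<iota> \<in> ring_hom A B \<and> inj_on \<iota> (carrier A) \<and>
        (\<forall>r\<in>carrier R. \<iota> (\<phi> r) = \<psi> r))"

text \<open>
  As in \<^theory>\<open>HOL-Algebra.Indexed_Polynomials\<close>, a monomial is the multiset of its indeterminates,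
  with \<^term>\<open>{#}\<close> the monomial \<open>1\<close> and \<open>+\<close> as multiplication, and a polynomial is its coefficient
  function. Indices start at \<open>0\<close>: the index \<open>i\<close> stands for the indeterminate \<open>x\<^sub>i\<^sub>+\<^sub>1\<close>, so that
  \<open>R[x\<^sub>1, \<dots>, x\<^sub>n]\<close> is \<^term>\<open>ring.indexed_pset R {..<n} (carrier R)\<close>.
\<close>

type_synonym monomial = "nat multiset"

definition monomial_ordering :: "monomial rel \<Rightarrow> bool" where
  "monomial_ordering ord \<longleftrightarrow>
     linear_order ord \<and>
     (\<forall>s. ({#}, s) \<in> ord) \<and>
     (\<forall>s t\<^sub>1 t\<^sub>2. (t\<^sub>1, t\<^sub>2) \<in> ord \<longrightarrow> (s + t\<^sub>1, s + t\<^sub>2) \<in> ord)"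

definition lex_ordering :: "monomial rel" where
  "lex_ordering =
     {(s, t). s = t \<or> (\<exists>i. count s i < count t i \<and> (\<forall>j<i. count s j = count t j))}"

lemma monomial_ordering_lex_ordering: "monomial_ordering lex_ordering"
proof -
  have tr: "trans lex_ordering"
  proof (rule transI)
    fix s t u assume "(s, t) \<in> lex_ordering" "(t, u) \<in> lex_ordering"
    then consider "s = t" | "t = u"
      | i k where "count s i < count t i" "\<forall>j<i. count s j = count t j"
          "count t k < count u k" "\<forall>j<k. count t j = count u j"
      unfolding lex_ordering_def by auto
    then show "(s, u) \<in> lex_ordering"
    proof cases
      case 3
      then have "count s (min i k) < count u (min i k)"
        by (cases i k rule: linorder_cases) (auto simp: min_def)
      moreover have "\<forall>j<min i k. count s j = count u j" using 3 by auto
      ultimately show ?thesis unfolding lex_ordering_def by auto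
    qed (use \<open>(s, t) \<in> lex_ordering\<close> \<open>(t, u) \<in> lex_ordering\<close> in auto)
  qed
  have as: "antisym lex_ordering"
  proof (rule antisymI, rule ccontr)
    fix s t assume "(s, t) \<in> lex_ordering" "(t, s) \<in> lex_ordering" "s \<noteq> t"
    then obtain i k where "count s i < count t i" "\<forall>j<i. count s j = count t j"
        "count t k < count s k" "\<forall>j<k. count t j = count s j"
      unfolding lex_ordering_def by auto
    then show False by (cases i k rule: linorder_cases) auto
  qed
  have tot: "(s, t) \<in> lex_ordering \<or> (t, s) \<in> lex_ordering" for s t
  proof (cases "s = t")
    case False
    then have ex: "\<exists>i. count s i \<noteq> count t i" by (auto simp: multiset_eq_iff)
    define i where "i = (LEAST i. count s i \<noteq> count t i)"
    have "count s i \<noteq> count t i" unfolding i_def using ex by (rule LeastI_ex)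
    moreover have "\<forall>j<i. count s j = count t j" unfolding i_def using not_less_Least by blast
    ultimately show ?thesis unfolding lex_ordering_def by (auto simp: neq_iff)
  qed (simp add: lex_ordering_def)
  have "({#}, s) \<in> lex_ordering" for s
    using tot[of "{#}" s] by (auto simp: lex_ordering_def)
  moreover have "linear_order lex_ordering"
    using tr as tot
    by (auto simp: linear_order_on_def partial_order_on_def preorder_on_def total_on_def
        refl_on_def lex_ordering_def)
  ultimately show ?thesis
    unfolding monomial_ordering_def by (auto simp: lex_ordering_def)
qed

text \<open>
  Over the zero ring the only polynomial is \<open>0\<close>, and it counts as submonic; over a nonzero ring
  a submonic polynomial is nonzero because the monomial \<open>m\<close> below occurs in it.
\<close>

definition submonic_wrt :: "monomial rel \<Rightarrow> ('r, 'm) ring_scheme \<Rightarrow> (monomial \<Rightarrow> 'r) \<Rightarrow> bool" where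
  "submonic_wrt ord R f \<longleftrightarrow>
     f \<in> ring.indexed_pset R UNIV (carrier R) \<and>
     (carrier R = {\<zero>\<^bsub>R\<^esub>} \<or>
      (\<exists>m. f m \<noteq> \<zero>\<^bsub>R\<^esub> \<and> (\<forall>m'. f m' \<noteq> \<zero>\<^bsub>R\<^esub> \<longrightarrow> (m, m') \<in> ord) \<and> f m = \<one>\<^bsub>R\<^esub>))"

definition submonic :: "('r, 'm) ring_scheme \<Rightarrow> (monomial \<Rightarrow> 'r) \<Rightarrow> bool" where
  "submonic R f \<longleftrightarrow> (\<exists>ord. monomial_ordering ord \<and> submonic_wrt ord R f)"

text \<open>The value \<open>f(a\<^sub>1, \<dots>, a\<^sub>n)\<close> for \<open>as = [a\<^sub>1, \<dots>, a\<^sub>n]\<close> and \<open>f \<in> R[x\<^sub>1, \<dots>, x\<^sub>n]\<close>.\<close>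

definition poly_value ::
    "('r, 'm) ring_scheme \<Rightarrow> ('a, 'n) ring_scheme \<Rightarrow> ('r \<Rightarrow> 'a) \<Rightarrow> (monomial \<Rightarrow> 'r) \<Rightarrow> 'a list \<Rightarrow> 'a" where
  "poly_value R A \<phi> f as =
     (\<Oplus>\<^bsub>A\<^esub>m\<in>{m. f m \<noteq> \<zero>\<^bsub>R\<^esub>}.
        \<phi> (f m) \<otimes>\<^bsub>A\<^esub> (\<Otimes>\<^bsub>A\<^esub>i\<in>set_mset m. (as ! i) [^]\<^bsub>A\<^esub> count m i))"

definition algebraically_dependent ::
    "('r, 'm) ring_scheme \<Rightarrow> ('a, 'n) ring_scheme \<Rightarrow> ('r \<Rightarrow> 'a) \<Rightarrow> 'a list \<Rightarrow> bool" where
  "algebraically_dependent R A \<phi> as \<longleftrightarrow>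
     (\<exists>f \<in> ring.indexed_pset R {..<length as} (carrier R).
        submonic R f \<and> poly_value R A \<phi> f as = \<zero>\<^bsub>A\<^esub>)"

definition algebraically_dependent_wrt ::
    "monomial rel \<Rightarrow> ('r, 'm) ring_scheme \<Rightarrow> ('a, 'n) ring_scheme \<Rightarrow> ('r \<Rightarrow> 'a) \<Rightarrow> 'a list \<Rightarrow> bool" where
  "algebraically_dependent_wrt ord R A \<phi> as \<longleftrightarrow>
     (\<exists>f \<in> ring.indexed_pset R {..<length as} (carrier R).
        submonic_wrt ord R f \<and> poly_value R A \<phi> f as = \<zero>\<^bsub>A\<^esub>)"

text \<open>The common pattern of both transcendence degrees, for a dependence predicate \<open>dep\<close>.\<close>

definition trdeg_of_dependence :: "('a list \<Rightarrow> bool) \<Rightarrow> ('a, 'n) ring_scheme \<Rightarrow> ereal" where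
  "trdeg_of_dependence dep A =
     (if \<forall>a\<in>carrier A. dep [a] then (if carrier A = {\<zero>\<^bsub>A\<^esub>} then -1 else 0)
      else Sup {ereal (real n) | n. n > 0 \<and>
                  (\<exists>as. length as = n \<and> set as \<subseteq> carrier A \<and> \<not> dep as)})"

definition trdeg ::
    "('r, 'm) ring_scheme \<Rightarrow> ('a, 'n) ring_scheme \<Rightarrow> ('r \<Rightarrow> 'a) \<Rightarrow> ereal" where
  "trdeg R A \<phi> = trdeg_of_dependence (algebraically_dependent R A \<phi>) A"

definition trdeg_wrt ::
    "monomial rel \<Rightarrow> ('r, 'm) ring_scheme \<Rightarrow> ('a, 'n) ring_scheme \<Rightarrow> ('r \<Rightarrow> 'a) \<Rightarrow> ereal" where
  "trdeg_wrt ord R A \<phi> = trdeg_of_dependence (algebraically_dependent_wrt ord R A \<phi>) A"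

definition trdeg_ring :: "('r, 'm) ring_scheme \<Rightarrow> ereal" where
  "trdeg_ring R = trdeg R R (\<lambda>r. r)"

end

theory Submission
  imports Defs
begin

text \<open>
  Independent elements and chains of primes of the same length are turned into each other.

  From independence to dimension: put \<open>U\<^sub>n\<^sub>+\<^sub>1 = {1}\<close>, and let \<open>U\<^sub>i\<close> be the monoid of the elements
  \<open>a\<^sub>i\<^sup>k (u + a\<^sub>i c)\<close> with \<open>u \<in> U\<^sub>i\<^sub>+\<^sub>1\<close>. If \<open>a\<^sub>1, \<dots>, a\<^sub>n\<close> generate a Noetherian algebra, then
  \<open>0 \<in> U\<^sub>1\<close> would be a lexicographically submonic relation between them; if \<open>0 \<notin> U\<^sub>1\<close>, primes avoiding
  the \<open>U\<^sub>i\<close> form a chain. A subalgebra \<open>A\<close> of a finitely generated algebra \<open>B\<close> need not be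
  Noetherian, but the subring \<open>C\<close> generated by the elements is, and a chain of primes of \<open>C\<close> can be
  moved into the part of the spectrum over which primes lift to \<open>B\<close>; contracting the lifts to \<open>A\<close>
  gives the chain. Moving the top prime needs the Jacobson property.

  From chains to independence: choosing \<open>a\<^sub>i\<close> in the \<open>(i+1)\<close>-st prime but not in the \<open>i\<close>-th gives
  lexicographically independent elements in any ring. For arbitrary monomial orderings one takes a
  system of parameters of a prime of height \<open>n\<close> in a Noetherian ring. The trailing monomial of a
  relation can be made the unique one of least weight for suitable positive integral weights, and
  then the prime would be minimal over \<open>n - 1\<close> elements, against Krull's height theorem.
\<close>

section \<open>Ideals and primes of Noetherian rings\<close>

text \<open>One upper bound serves all three statements: independence with respect to every monomial
  ordering implies lexicographic independence, and the latter already yields a chain. The lower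
  bound is proved twice, because an arbitrary ordering offers no first indeterminate to factor out.

  The monoids U_i are iterated Krull boundaries. For one element a, a prime avoids all a^k (1 + a c)
  exactly if it excludes a and lies below a prime through a, so each monoid forces one strict
  inclusion.

  The obstacle in the subfinite case is that a prime of C may have no prime of B above it. Lifting
  works off the zero set of a single element d of C. An interior prime of a chain can be moved off d
  by Krull's principal ideal theorem, which leaves only the top one. Strictness of the contracted
  chain in A is inherited from C, since C lies in A.

  Local arguments are carried out without localizing: ideals of the localization at P are replaced
  by P-saturated ideals of R, so that Artinian descent and Nakayama's lemma become statements about
  ideals of R itself.\<close>

locale noetherian_cring = noetherian_ring + cring

section \<open>Saturated ideals as substitutes for ideals of a localization\<close>

context ring
begin

definition adjoin_element :: "'a set \<Rightarrow> 'a \<Rightarrow> 'a set" where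
  "adjoin_element I a = {i \<oplus> r \<otimes> a | i r. i \<in> I \<and> r \<in> carrier R}"

text \<open>For a prime \<open>P\<close>, this is the contraction to \<open>R\<close> of the ideal
  that \<open>I\<close> generates in the localization at \<open>P\<close>.\<close>

definition localization_closure :: "'a set \<Rightarrow> 'a set \<Rightarrow> 'a set" where
  "localization_closure P I = {x \<in> carrier R. \<exists>s\<in>carrier R - P. s \<otimes> x \<in> I}"

text \<open>For a prime \<open>P\<close>, these are exactly the ideals of \<open>R\<close>
  contracted from the localization at \<open>P\<close>, and inclusions between them mirror those
  upstairs.\<close>

definition saturated :: "'a set \<Rightarrow> 'a set \<Rightarrow> bool" where
  "saturated P I \<longleftrightarrow> ideal I R \<and> (\<forall>s\<in>carrier R - P. \<forall>x\<in>carrier R. s \<otimes> x \<in> I \<longrightarrow> x \<in> I)"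

lemma saturated_ideal: "saturated P I \<Longrightarrow> ideal I R"
  by (simp add: saturated_def)

lemma saturatedD: "\<lbrakk>saturated P I; s \<otimes> x \<in> I; s \<in> carrier R; s \<notin> P; x \<in> carrier R\<rbrakk> \<Longrightarrow> x \<in> I"
  by (auto simp: saturated_def)

lemma saturated_mono: "\<lbrakk>saturated Q I; Q \<subseteq> P\<rbrakk> \<Longrightarrow> saturated P I"
  by (auto simp: saturated_def)

end

context cring
begin

lemma idealI':
  assumes "I \<subseteq> carrier R" "\<zero> \<in> I"
    and "\<And>x y. \<lbrakk>x \<in> I; y \<in> I\<rbrakk> \<Longrightarrow> x \<oplus> y \<in> I"
    and "\<And>x r. \<lbrakk>x \<in> I; r \<in> carrier R\<rbrakk> \<Longrightarrow> r \<otimes> x \<in> I"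
  shows "ideal I R"
proof (rule idealI)
  have neg: "\<ominus> x \<in> I" if "x \<in> I" for x
  proof -
    have "\<ominus> \<one> \<otimes> x \<in> I" using assms(4)[OF that] by simp
    then show ?thesis using that assms(1) by (simp add: l_minus subset_iff)
  qed
  show "subgroup I (add_monoid R)"
    using assms neg by (intro add.subgroupI) (auto simp: a_inv_def)
  show "x \<otimes> a \<in> I" "a \<otimes> x \<in> I" if "a \<in> I" "x \<in> carrier R" for a x
    using assms(4)[OF that] that assms(1) by (auto simp: m_comm subset_iff)
qed (rule ring_axioms)

lemma ideal_subset: "ideal I R \<Longrightarrow> I \<subseteq> carrier R"
  using ideal.Icarr[of I R] by auto

lemma ideal_zero: "ideal I R \<Longrightarrow> \<zero> \<in> I"
  by (simp add: additive_subgroup.zero_closed ideal.axioms(1))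

lemma ideal_add: "\<lbrakk>ideal I R; x \<in> I; y \<in> I\<rbrakk> \<Longrightarrow> x \<oplus> y \<in> I"
  by (simp add: additive_subgroup.a_closed ideal.axioms(1))

lemma ideal_uminus: "\<lbrakk>ideal I R; x \<in> I\<rbrakk> \<Longrightarrow> \<ominus> x \<in> I"
  by (simp add: additive_subgroup.a_inv_closed ideal.axioms(1))

lemma ideal_minus: "\<lbrakk>ideal I R; x \<in> I; y \<in> I\<rbrakk> \<Longrightarrow> x \<ominus> y \<in> I"
  by (simp add: minus_eq ideal_add ideal_uminus)

lemma ideal_mult: "\<lbrakk>ideal I R; x \<in> I; r \<in> carrier R\<rbrakk> \<Longrightarrow> r \<otimes> x \<in> I"
  by (rule ideal.I_l_closed)

lemma ideal_mult': "\<lbrakk>ideal I R; x \<in> I; r \<in> carrier R\<rbrakk> \<Longrightarrow> x \<otimes> r \<in> I"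
  by (rule ideal.I_r_closed)

lemma ideal_one: "\<lbrakk>ideal I R; \<one> \<in> I\<rbrakk> \<Longrightarrow> I = carrier R"
  by (rule ideal.one_imp_carrier)

lemma ideal_add_cancel:
  assumes "ideal I R" "x \<oplus> y \<in> I" "x \<in> I" "y \<in> carrier R"
  shows "y \<in> I"
proof -
  have x: "x \<in> carrier R" using assms ideal_subset by blast
  have "y = (x \<oplus> y) \<ominus> x" using x assms(4)
    by (simp add: minus_eq a_comm r_neg1)
  then show ?thesis using ideal_minus[OF assms(1,2,3)] by simp
qed

lemma prime_ideal: "primeideal P R \<Longrightarrow> ideal P R"
  by (simp add: primeideal.axioms(1))

lemma prime_mult: "\<lbrakk>primeideal P R; x \<otimes> y \<in> P; x \<in> carrier R; y \<in> carrier R\<rbrakk> \<Longrightarrow> x \<in> P \<or> y \<in> P"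
  by (rule primeideal.I_prime)

lemma prime_one: "primeideal P R \<Longrightarrow> \<one> \<notin> P"
  by (metis ideal_one prime_ideal primeideal.I_notcarr)

lemma prime_pow: "\<lbrakk>primeideal P R; x [^] (n::nat) \<in> P; x \<in> carrier R\<rbrakk> \<Longrightarrow> x \<in> P"
  by (induction n) (auto simp: prime_one dest: prime_mult)

lemma prime_saturated: "primeideal P R \<Longrightarrow> saturated P P"
  unfolding saturated_def using prime_ideal prime_mult by blast

lemma adjoin_element_ideal:
  assumes "ideal I R" "a \<in> carrier R"
  shows "ideal (adjoin_element I a) R"
proof (rule idealI')
  note I = ideal_subset[OF assms(1)]
  show "adjoin_element I a \<subseteq> carrier R" using I assms(2) by (auto simp: adjoin_element_def)
  show "\<zero> \<in> adjoin_element I a"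
    using ideal_zero[OF assms(1)] assms(2)
    by (auto simp: adjoin_element_def intro!: exI[of _ \<zero>])
  show "x \<oplus> y \<in> adjoin_element I a" if xy: "x \<in> adjoin_element I a" "y \<in> adjoin_element I a" for x y
  proof -
    obtain i r j s where *: "x = i \<oplus> r \<otimes> a" "y = j \<oplus> s \<otimes> a"
        "i \<in> I" "j \<in> I" "r \<in> carrier R" "s \<in> carrier R"
      using xy unfolding adjoin_element_def by blast
    moreover have "i \<in> carrier R" "j \<in> carrier R" using * I by auto
    ultimately have "x \<oplus> y = (i \<oplus> j) \<oplus> (r \<oplus> s) \<otimes> a"
      using assms(2) by (simp add: l_distr a_ac)
    then show ?thesis using * ideal_add[OF assms(1)] by (auto simp: adjoin_element_def)
  qed
  show "r \<otimes> x \<in> adjoin_element I a" if xr: "x \<in> adjoin_element I a" "r \<in> carrier R" for x r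
  proof -
    obtain i s where *: "x = i \<oplus> s \<otimes> a" "i \<in> I" "s \<in> carrier R"
      using xr by (auto simp: adjoin_element_def)
    moreover have "i \<in> carrier R" using * I by auto
    ultimately have "r \<otimes> x = r \<otimes> i \<oplus> (r \<otimes> s) \<otimes> a"
      using assms(2) that by (simp add: r_distr m_assoc)
    then show ?thesis using * that ideal_mult[OF assms(1)] by (auto simp: adjoin_element_def)
  qed
qed

lemma subset_adjoin_element: "\<lbrakk>ideal I R; a \<in> carrier R\<rbrakk> \<Longrightarrow> I \<subseteq> adjoin_element I a"
proof
  fix x assume "ideal I R" "a \<in> carrier R" "x \<in> I"
  then have "x = x \<oplus> \<zero> \<otimes> a" using ideal_subset[of I] by auto
  then show "x \<in> adjoin_element I a" using \<open>x \<in> I\<close> unfolding adjoin_element_def by blast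
qed

lemma mem_adjoin_element: "\<lbrakk>ideal I R; a \<in> carrier R\<rbrakk> \<Longrightarrow> a \<in> adjoin_element I a"
proof -
  assume "ideal I R" "a \<in> carrier R"
  then have "a = \<zero> \<oplus> \<one> \<otimes> a" "\<zero> \<in> I" using ideal_zero[of I] by auto
  then show "a \<in> adjoin_element I a" unfolding adjoin_element_def by blast
qed

lemma adjoin_element_least: "\<lbrakk>ideal J R; I \<subseteq> J; a \<in> J\<rbrakk> \<Longrightarrow> adjoin_element I a \<subseteq> J"
  by (auto simp: adjoin_element_def intro!: ideal_add ideal_mult)

lemma localization_closure_saturated:
  assumes P: "primeideal P R" and I: "ideal I R"
  shows "saturated P (localization_closure P I)"
proof -
  have mc: "s \<otimes> t \<in> carrier R - P" if "s \<in> carrier R - P" "t \<in> carrier R - P" for s t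
    using that prime_mult[OF P] by auto
  have "ideal (localization_closure P I) R"
  proof (rule idealI')
    show "\<zero> \<in> localization_closure P I"
      using ideal_zero[OF I] prime_one[OF P] by (auto simp: localization_closure_def intro!: bexI[of _ \<one>])
    show "x \<oplus> y \<in> localization_closure P I"
      if xy: "x \<in> localization_closure P I" "y \<in> localization_closure P I" for x y
    proof -
      obtain s t where *: "s \<in> carrier R - P" "s \<otimes> x \<in> I" "t \<in> carrier R - P" "t \<otimes> y \<in> I"
        "x \<in> carrier R" "y \<in> carrier R"
        using xy by (auto simp: localization_closure_def)
      have "(s \<otimes> t) \<otimes> (x \<oplus> y) = t \<otimes> (s \<otimes> x) \<oplus> s \<otimes> (t \<otimes> y)"
        using * by (simp add: r_distr m_ac)
      then have "(s \<otimes> t) \<otimes> (x \<oplus> y) \<in> I" using * I ideal_add ideal_mult by simp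
      then show ?thesis using * mc by (auto simp: localization_closure_def)
    qed
    show "r \<otimes> x \<in> localization_closure P I"
      if xy: "x \<in> localization_closure P I" "r \<in> carrier R" for x r
    proof -
      obtain s where *: "s \<in> carrier R - P" "s \<otimes> x \<in> I" "x \<in> carrier R"
        using xy by (auto simp: localization_closure_def)
      have "s \<otimes> (r \<otimes> x) = r \<otimes> (s \<otimes> x)" using * that by (simp add: m_ac)
      then show ?thesis using * that ideal_mult[OF I]
        by (auto simp: localization_closure_def intro!: bexI[of _ s])
    qed
  qed (auto simp: localization_closure_def)
  moreover have "x \<in> localization_closure P I"
    if s: "s \<in> carrier R - P" "x \<in> carrier R" "s \<otimes> x \<in> localization_closure P I" for s x
  proof -
    obtain t where "t \<in> carrier R - P" "t \<otimes> (s \<otimes> x) \<in> I"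
      using s by (auto simp: localization_closure_def)
    then show ?thesis using s mc[of t s] by (auto simp: localization_closure_def m_assoc[symmetric])
  qed
  ultimately show ?thesis by (auto simp: saturated_def)
qed

lemma subset_localization_closure:
  "\<lbrakk>primeideal P R; ideal I R\<rbrakk> \<Longrightarrow> I \<subseteq> localization_closure P I"
  using prime_one[of P] ideal_subset[of I]
  by (auto simp: localization_closure_def intro!: bexI[of _ \<one>])

lemma localization_closure_least:
  "\<lbrakk>saturated P J; I \<subseteq> J\<rbrakk> \<Longrightarrow> localization_closure P I \<subseteq> J"
  by (auto simp: localization_closure_def saturated_def)

lemma saturated_inter: "\<lbrakk>saturated P I; saturated P J\<rbrakk> \<Longrightarrow> saturated P (I \<inter> J)"
  by (auto simp: saturated_def i_intersect)

end

section \<open>Existence of primes in Noetherian rings\<close>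

context noetherian_cring
begin

lemma ideal_family_has_maximal:
  assumes "F \<noteq> {}" "\<And>I. I \<in> F \<Longrightarrow> ideal I R"
  obtains M where "M \<in> F" "\<And>I. \<lbrakk>I \<in> F; M \<subseteq> I\<rbrakk> \<Longrightarrow> I = M"
proof -
  have "\<exists>M\<in>F. \<forall>Y\<in>F. M \<subseteq> Y \<longrightarrow> Y = M"
  proof (rule subset_Zorn)
    fix C assume C: "subset.chain F C"
    show "\<exists>U\<in>F. \<forall>Y\<in>C. Y \<subseteq> U"
    proof (cases "C = {}")
      case False
      have "subset.chain {I. ideal I R} C"
        using C assms(2) by (auto simp: pred_on.chain_def)
      then have "\<Union>C \<in> C" using ideal_chain_is_trivial False by blast
      then show ?thesis using C by (auto simp: pred_on.chain_def)
    qed (use assms(1) in auto)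
  qed
  then show ?thesis using that by blast
qed

lemma noetherian_induct [consumes 1, case_names step]:
  assumes "ideal I R"
    and "\<And>I. \<lbrakk>ideal I R; (\<And>J. \<lbrakk>ideal J R; I \<subset> J\<rbrakk> \<Longrightarrow> Q J)\<rbrakk> \<Longrightarrow> Q I"
  shows "Q I"
proof (rule ccontr)
  assume "\<not> Q I"
  then have "{I. ideal I R \<and> \<not> Q I} \<noteq> {}" using assms(1) by auto
  then obtain M where M: "M \<in> {I. ideal I R \<and> \<not> Q I}"
      "\<And>I. \<lbrakk>I \<in> {I. ideal I R \<and> \<not> Q I}; M \<subseteq> I\<rbrakk> \<Longrightarrow> I = M"
    by (rule ideal_family_has_maximal) auto
  then show False using assms(2)[of M] by blast
qed

text \<open>An ideal over \<open>I\<close> that is maximal among those missing \<open>S\<close> is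
  prime: if it contained neither factor of a product in it, both enlarged ideals would meet
  \<open>S\<close>, and multiplying the two elements of \<open>S\<close> would give one inside the
  ideal.\<close>

lemma exists_prime_disjoint:
  assumes I: "ideal I R" and S: "S \<subseteq> carrier R" "\<one> \<in> S"
    and mult: "\<And>x y. \<lbrakk>x \<in> S; y \<in> S\<rbrakk> \<Longrightarrow> x \<otimes> y \<in> S" and disj: "I \<inter> S = {}"
  obtains Q where "primeideal Q R" "I \<subseteq> Q" "Q \<inter> S = {}"
proof -
  let ?F = "{J. ideal J R \<and> I \<subseteq> J \<and> J \<inter> S = {}}"
  have "?F \<noteq> {}" using I disj by auto
  then obtain M where M: "M \<in> ?F" "\<And>J. \<lbrakk>J \<in> ?F; M \<subseteq> J\<rbrakk> \<Longrightarrow> J = M"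
    by (rule ideal_family_has_maximal) auto
  have meets: "\<exists>m\<in>M. \<exists>r\<in>carrier R. m \<oplus> r \<otimes> a \<in> S" if "a \<in> carrier R" "a \<notin> M" for a
  proof -
    have "adjoin_element M a \<notin> ?F"
      using M that mem_adjoin_element[of M a] subset_adjoin_element[of M a] by blast
    then have "adjoin_element M a \<inter> S \<noteq> {}"
      using M that adjoin_element_ideal[of M a] subset_adjoin_element[of M a] by auto
    then show ?thesis by (auto simp: adjoin_element_def)
  qed
  have idM: "ideal M R" using M by auto
  have "primeideal M R"
  proof (rule primeidealI)
    show "carrier R \<noteq> M" using M S by auto
    fix a b assume ab: "a \<in> carrier R" "b \<in> carrier R" "a \<otimes> b \<in> M"
    show "a \<in> M \<or> b \<in> M"
    proof (rule ccontr)
      assume "\<not> ?thesis"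
      then obtain m r n t where *: "m \<in> M" "r \<in> carrier R" "m \<oplus> r \<otimes> a \<in> S"
          "n \<in> M" "t \<in> carrier R" "n \<oplus> t \<otimes> b \<in> S"
        using meets ab by metis
      have c: "m \<in> carrier R" "n \<in> carrier R" using * ideal_subset[OF idM] by auto
      have "(m \<oplus> r \<otimes> a) \<otimes> (n \<oplus> t \<otimes> b) = (n \<oplus> t \<otimes> b) \<otimes> m \<oplus> (r \<otimes> a \<otimes> n \<oplus> r \<otimes> t \<otimes> (a \<otimes> b))"
        using c *(2,5) ab(1,2) by algebra
      moreover have "\<dots> \<in> M"
        using c * ab by (intro ideal_add[OF idM]) (auto intro: ideal_mult[OF idM])
      ultimately show False using mult[OF *(3,6)] M(1) by auto
    qed
  qed (use M is_cring in auto)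
  then show ?thesis using that M by auto
qed

lemma exists_prime_over:
  assumes I: "ideal I R" "I \<noteq> carrier R"
  obtains Q where "primeideal Q R" "I \<subseteq> Q"
proof -
  have "\<one> \<notin> I" using ideal_one[OF I(1)] I(2) by metis
  then have "I \<inter> {\<one>} = {}" by simp
  then obtain Q where "primeideal Q R" "I \<subseteq> Q" "Q \<inter> {\<one>} = {}"
    by (rule exists_prime_disjoint[OF I(1), of "{\<one>}", rotated 3]) simp_all
  then show ?thesis using that by simp
qed

lemma exists_maximal_over:
  assumes I: "ideal I R" "\<one> \<notin> I"
  obtains M where "maximalideal M R" "I \<subseteq> M"
proof -
  let ?F = "{J. ideal J R \<and> I \<subseteq> J \<and> \<one> \<notin> J}"
  have "?F \<noteq> {}" using I by auto
  then obtain M where M: "M \<in> ?F" "\<And>J. \<lbrakk>J \<in> ?F; M \<subseteq> J\<rbrakk> \<Longrightarrow> J = M"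
    by (rule ideal_family_has_maximal) auto
  have "maximalideal M R"
  proof (rule maximalidealI)
    fix J assume J: "ideal J R" "M \<subseteq> J" "J \<subseteq> carrier R"
    show "J = M \<or> J = carrier R"
    proof (cases "\<one> \<in> J")
      case True
      then show ?thesis using ideal_one[OF J(1)] by simp
    next
      case False
      then show ?thesis using M(1) M(2)[of J] J by auto
    qed
  qed (use M in auto)
  then show ?thesis using that M by auto
qed

text \<open>\<open>\<P>\<close> need not consist of minimal primes; it only has to contain a prime
  below each prime over \<open>I\<close>. If \<open>a \<otimes> b\<close> is in \<open>I\<close>, a
  prime over \<open>I\<close> contains \<open>a\<close> or \<open>b\<close>, so the sets found for
  the two larger ideals can be united.\<close>

lemma finitely_many_minimal_primes:
  assumes "ideal I R"
  shows "\<exists>\<P>. finite \<P> \<and> (\<forall>p\<in>\<P>. primeideal p R \<and> I \<subseteq> p) \<and>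
           (\<forall>Q. primeideal Q R \<and> I \<subseteq> Q \<longrightarrow> (\<exists>p\<in>\<P>. p \<subseteq> Q))"
  using assms
proof (induction I rule: noetherian_induct)
  case (step I)
  consider "I = carrier R" | "primeideal I R"
    | "I \<noteq> carrier R" "\<not> primeideal I R" by blast
  then show ?case
  proof cases
    case 1
    then show ?thesis
    proof (intro exI[of _ "{}"] conjI allI impI)
      fix Q assume "primeideal Q R \<and> I \<subseteq> Q"
      then show "\<exists>p\<in>{}. p \<subseteq> Q"
        using 1 primeideal.I_notcarr[of Q R] ideal_subset[OF prime_ideal, of Q] by auto
    qed auto
  next
    case 2
    then show ?thesis by (intro exI[of _ "{I}"]) auto
  next
    case 3
    then obtain a b where ab: "a \<in> carrier R" "b \<in> carrier R" "a \<otimes> b \<in> I" "a \<notin> I" "b \<notin> I"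
      using primeidealI[OF step(1) is_cring] by blast
    have *: "I \<subset> adjoin_element I c" if "c \<in> carrier R" "c \<notin> I" for c
      using that subset_adjoin_element[OF step(1)] mem_adjoin_element[OF step(1)] by blast
    obtain \<P> where P: "finite \<P>" "\<forall>p\<in>\<P>. primeideal p R \<and> adjoin_element I a \<subseteq> p"
      "\<forall>Q. primeideal Q R \<and> adjoin_element I a \<subseteq> Q \<longrightarrow> (\<exists>p\<in>\<P>. p \<subseteq> Q)"
      using step(2)[of "adjoin_element I a"] adjoin_element_ideal[OF step(1)] * ab by meson
    obtain \<Q> where Q: "finite \<Q>" "\<forall>p\<in>\<Q>. primeideal p R \<and> adjoin_element I b \<subseteq> p"
      "\<forall>Q. primeideal Q R \<and> adjoin_element I b \<subseteq> Q \<longrightarrow> (\<exists>p\<in>\<Q>. p \<subseteq> Q)"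
      using step(2)[of "adjoin_element I b"] adjoin_element_ideal[OF step(1)] * ab by meson
    show ?thesis
    proof (intro exI[of _ "\<P> \<union> \<Q>"] conjI allI impI ballI)
      show "finite (\<P> \<union> \<Q>)" using P Q by simp
      fix p assume "p \<in> \<P> \<union> \<Q>"
      then have p: "primeideal p R" "adjoin_element I a \<subseteq> p \<or> adjoin_element I b \<subseteq> p"
        using P(2) Q(2) by auto
      show "primeideal p R" by (rule p(1))
      show "I \<subseteq> p" using p(2) *[OF ab(1,4)] *[OF ab(2,5)] by auto
    next
      fix q assume q: "primeideal q R \<and> I \<subseteq> q"
      then have "a \<in> q \<or> b \<in> q" using prime_mult[of q a b] ab by auto
      then have "adjoin_element I a \<subseteq> q \<or> adjoin_element I b \<subseteq> q"
        using q adjoin_element_least[OF prime_ideal, of q I] by auto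
      then show "\<exists>p\<in>\<P> \<union> \<Q>. p \<subseteq> q" 
        by (metis P(3) Q(3) q UnI1 UnI2)
    qed
  qed
qed

lemma exists_minimal_prime:
  assumes I: "ideal I R" and P: "primeideal P R" "I \<subseteq> P"
  obtains p where "primeideal p R" "I \<subseteq> p" "p \<subseteq> P"
    "\<And>Q. \<lbrakk>primeideal Q R; I \<subseteq> Q; Q \<subseteq> p\<rbrakk> \<Longrightarrow> Q = p"
proof -
  obtain \<P> where F: "finite \<P>" "\<forall>p\<in>\<P>. primeideal p R \<and> I \<subseteq> p"
           "\<forall>Q. primeideal Q R \<and> I \<subseteq> Q \<longrightarrow> (\<exists>p\<in>\<P>. p \<subseteq> Q)"
    using finitely_many_minimal_primes[OF I] by blast
  have "finite {p\<in>\<P>. p \<subseteq> P}" "{p\<in>\<P>. p \<subseteq> P} \<noteq> {}" using F P by auto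
  from finite_has_minimal[OF this]
  obtain p where p: "p \<in> {p\<in>\<P>. p \<subseteq> P}" "\<forall>q\<in>{p\<in>\<P>. p \<subseteq> P}. q \<subseteq> p \<longrightarrow> p = q"
    by auto
  show ?thesis
  proof (rule that[of p])
    fix Q assume Q: "primeideal Q R" "I \<subseteq> Q" "Q \<subseteq> p"
    then obtain q where "q \<in> \<P>" "q \<subseteq> Q" using F by blast
    then show "Q = p" using p Q by blast
  qed (use p F in auto)
qed

end

text \<open>Induction on the number of primes. If \<open>I\<close> were covered, each
  \<open>p\<close> would contain an element \<open>f p\<close> of \<open>I\<close> outside all the
  other primes. For a fixed \<open>p\<close>, the sum of \<open>f p\<close> and the product of the
  remaining \<open>f q\<close> then avoids every prime.\<close>

lemma (in cring) prime_avoidance: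
  assumes "finite \<P>" "\<And>p. p \<in> \<P> \<Longrightarrow> primeideal p R" "ideal I R" "\<And>p. p \<in> \<P> \<Longrightarrow> \<not> I \<subseteq> p"
  obtains y where "y \<in> I" "\<And>p. p \<in> \<P> \<Longrightarrow> y \<notin> p"
proof -
  have "\<exists>y\<in>I. \<forall>p\<in>\<P>. y \<notin> p"
    using assms
  proof (induction "card \<P>" arbitrary: \<P> rule: less_induct)
    case less
    note Ic = ideal_subset[OF less(4)]
    show ?case
    proof (rule ccontr)
      assume no: "\<not> ?thesis"
      then have ne: "\<P> \<noteq> {}" using ideal_zero[OF less(4)] by blast
      have "\<exists>y\<in>I. \<forall>q\<in>\<P> - {p}. y \<notin> q" if "p \<in> \<P>" for p
      proof (rule less(1))
        show "card (\<P> - {p}) < card \<P>" using less(2) that by (rule card_Diff1_less)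
      qed (use less in auto)
      then obtain f where f: "\<And>p. p \<in> \<P> \<Longrightarrow> f p \<in> I"
          "\<And>p q. \<lbrakk>p \<in> \<P>; q \<in> \<P>; q \<noteq> p\<rbrakk> \<Longrightarrow> f p \<notin> q"
        by (metis DiffI empty_iff insert_iff)
      then have ff: "f p \<in> p" if "p \<in> \<P>" for p using no that by blast
      obtain p where p: "p \<in> \<P>" using ne by blast
      show False
      \<comment> \<open>A single prime is treated apart: the product over the other primes would be
        empty, hence \<open>\<one>\<close>, which need not lie in \<open>I\<close>.\<close>
      proof (cases "\<P> = {p}")
        case True
        then show False using no less(5)[OF p] by auto
      next
        case False
        then have rest: "\<P> - {p} \<noteq> {}" using p by auto
        define z where "z = (\<Otimes>q\<in>\<P> - {p}. f q)"
        have fc: "f \<in> \<P> - {p} \<rightarrow> carrier R" using f Ic by auto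
        have zn: "z \<notin> p"
        proof -
          have "(\<Otimes>q\<in>Y. f q) \<notin> p" if "Y \<subseteq> \<P> - {p}" for Y
            using finite_subset[OF that finite_Diff[OF less(2)]] that
          proof (induction Y rule: finite_induct)
            case empty
            then show ?case using less(3)[OF p] prime_one by simp
          next
            case (insert x F)
            then have c: "f \<in> F \<rightarrow> carrier R" "f x \<in> carrier R" using fc by auto
            have "f x \<notin> p" using f(2)[of x p] insert p by auto
            then show ?case
              using insert c prime_mult[OF less(3)[OF p], of "f x" "\<Otimes>q\<in>F. f q"] by auto
          qed
          then show ?thesis by (simp add: z_def)
        qed
        have zq: "z \<in> q \<and> z \<in> I" if "q \<in> \<P> - {p}" for q
        proof -
          have q: "ideal q R" using less(3) that prime_ideal by auto
          have "finprod R f (insert q (\<P> - {p} - {q})) = f q \<otimes> (\<Otimes>q\<in>\<P> - {p} - {q}. f q)"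
            using less(2) fc that by (intro finprod_insert) auto
          then have "z = f q \<otimes> (\<Otimes>q\<in>\<P> - {p} - {q}. f q)"
            using that by (simp add: z_def insert_absorb)
          moreover have "(\<Otimes>q\<in>\<P> - {p} - {q}. f q) \<in> carrier R"
            using fc by (intro finprod_closed) auto
          ultimately show ?thesis
            using ideal_mult'[OF q ff] ideal_mult'[OF less(4) f(1)] that by auto
        qed
        have zI: "z \<in> I" using zq rest by blast
        define y where "y = f p \<oplus> z"
        have c: "f p \<in> carrier R" "z \<in> carrier R" using f p Ic zI by auto
        have "y \<in> I" using f(1)[OF p] zI less(4) ideal_add by (simp add: y_def)
        moreover have "y \<notin> p"
          using zn ideal_add_cancel[OF prime_ideal[OF less(3)[OF p]], of "f p" z] ff[OF p] c by (auto simp: y_def)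
        moreover have "y \<notin> q" if "q \<in> \<P> - {p}" for q
        proof
          assume "y \<in> q"
          then have "z \<oplus> f p \<in> q" using c by (simp add: y_def a_comm)
          then have "f p \<in> q"
            using ideal_add_cancel[OF prime_ideal[OF less(3)], of q z "f p"] zq[OF that] that c by auto
          then show False using f(2)[OF p] that by auto
        qed
        ultimately show False using no by blast
      qed
    qed
  qed
  then show ?thesis using that by blast
qed


section \<open>Artinian descent, Nakayama's lemma and the principal ideal theorem\<close>

context noetherian_cring
begin

text \<open>Associated primes exist: a maximal annihilator of a nonzero residue class modulo
  \<open>I\<close> is prime, because passing from \<open>g\<close> to \<open>b \<otimes> g\<close>
  can only enlarge the annihilator.\<close>

lemma colon_prime:
  assumes I: "ideal I R" "I \<noteq> carrier R"
  obtains g where "g \<in> carrier R" "g \<notin> I" "primeideal {r \<in> carrier R. r \<otimes> g \<in> I} R"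
proof -
  define colon where "colon h = {r \<in> carrier R. r \<otimes> h \<in> I}" for h
  have idc: "ideal (colon h) R" if h: "h \<in> carrier R" for h
    using I(1) h by (intro idealI') (auto simp: colon_def l_distr m_assoc ideal_zero ideal_add ideal_mult)
  let ?F = "colon ` (carrier R - I)"
  have "?F \<noteq> {}" using I ideal_subset[OF I(1)] by auto
  then obtain M where M: "M \<in> ?F" "\<And>J. \<lbrakk>J \<in> ?F; M \<subseteq> J\<rbrakk> \<Longrightarrow> J = M"
    by (rule ideal_family_has_maximal) (auto intro: idc)
  then obtain g where g: "g \<in> carrier R" "g \<notin> I" "M = colon g" by auto
  have "primeideal (colon g) R"
  proof (rule primeidealI)
    have "\<one> \<notin> colon g" using g by (simp add: colon_def)
    then show "carrier R \<noteq> colon g" by auto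
    fix a b assume ab: "a \<in> carrier R" "b \<in> carrier R" "a \<otimes> b \<in> colon g"
    show "a \<in> colon g \<or> b \<in> colon g"
    proof (cases "b \<in> colon g")
      case False
      then have bg: "b \<otimes> g \<in> carrier R - I" using ab g by (simp add: colon_def)
      have "colon g \<subseteq> colon (b \<otimes> g)"
      proof
        fix r assume "r \<in> colon g"
        then have "r \<in> carrier R" "b \<otimes> (r \<otimes> g) \<in> I" using ab ideal_mult[OF I(1)] by (auto simp: colon_def)
        then show "r \<in> colon (b \<otimes> g)" using ab g by (simp add: colon_def m_lcomm)
      qed
      then have "colon (b \<otimes> g) = colon g" using M(2)[of "colon (b \<otimes> g)"] bg g(3) by auto
      moreover have "a \<in> colon (b \<otimes> g)" using ab g by (simp add: colon_def m_assoc)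
      ultimately show ?thesis by simp
    qed simp
  qed (use idc g is_cring in auto)
  then show ?thesis using that g by (simp add: colon_def)
qed

text \<open>The descending chain condition for the Artinian ring \<open>R\<^sub>P/IR\<^sub>P\<close>, whose ideals are
  represented by the \<open>P\<close>-saturated ideals over \<open>I\<close>.\<close>

lemma saturated_descending_chain:
  assumes P: "primeideal P R"
    and "saturated P I" "\<And>Q. \<lbrakk>primeideal Q R; I \<subseteq> Q; Q \<subseteq> P\<rbrakk> \<Longrightarrow> Q = P"
    and "\<And>n. saturated P (L n)" "\<And>n. I \<subseteq> L n" "\<And>n. L (Suc n) \<subseteq> L n"
  shows "\<exists>N. \<forall>n\<ge>N. L n = L N"
proof -
  have *: "\<lbrakk>saturated P I; \<forall>Q. primeideal Q R \<and> I \<subseteq> Q \<and> Q \<subseteq> P \<longrightarrow> Q = P\<rbrakk> \<Longrightarrow>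
      \<forall>L. (\<forall>n. saturated P (L n) \<and> I \<subseteq> L n \<and> L (Suc n) \<subseteq> L n) \<longrightarrow> (\<exists>N::nat. \<forall>n\<ge>N. L n = L N)"
    if "ideal I R" for I
    using that
  proof (induction I rule: noetherian_induct)
    case (step I)
    show ?case
    proof (intro allI impI)
      fix L :: "nat \<Rightarrow> 'a set"
      assume L: "\<forall>n. saturated P (L n) \<and> I \<subseteq> L n \<and> L (Suc n) \<subseteq> L n"
      have dec: "L n \<subseteq> L m" if "m \<le> n" for m n
        using that L by (induction rule: dec_induct) blast+
      show "\<exists>N. \<forall>n\<ge>N. L n = L N"
      proof (cases "I = carrier R")
        case True
        then have "L n = carrier R" for n using L ideal_subset[OF saturated_ideal] by blast
        then show ?thesis by simp
      next
        case False
        obtain g where g: "g \<in> carrier R" "g \<notin> I" "primeideal {r \<in> carrier R. r \<otimes> g \<in> I} R"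
          using colon_prime[OF step(1) False] .
        \<comment> \<open>The annihilator of \<open>g\<close> modulo \<open>I\<close> is a prime
          over \<open>I\<close>, and saturation of \<open>I\<close> puts it inside \<open>P\<close>;
          minimality forces it to be \<open>P\<close>.\<close>
        have colon: "{r \<in> carrier R. r \<otimes> g \<in> I} = P"
        proof (rule step(4)[rule_format], intro conjI g(3))
          show "I \<subseteq> {r \<in> carrier R. r \<otimes> g \<in> I}"
            using ideal_mult'[OF step(1) _ g(1)] ideal_subset[OF step(1)] by auto
          show "{r \<in> carrier R. r \<otimes> g \<in> I} \<subseteq> P"
            using saturatedD[OF step(3)] g by auto
        qed
        define J where "J = localization_closure P (adjoin_element I g)"
        have idg: "ideal (adjoin_element I g) R" using adjoin_element_ideal step(1) g by simp
        have satJ: "saturated P J"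
          unfolding J_def by (rule localization_closure_saturated[OF P idg])
        have gJ: "adjoin_element I g \<subseteq> J"
          unfolding J_def by (rule subset_localization_closure[OF P idg])
        have IJ: "I \<subset> J"
          using gJ subset_adjoin_element[OF step(1) g(1)] mem_adjoin_element[OF step(1) g(1)] g(2) by auto
        \<comment> \<open>Since \<open>P\<close> annihilates \<open>g\<close> modulo
          \<open>I\<close>, the quotient of \<open>J\<close> by \<open>I\<close> is locally a
          one-dimensional space over the residue field of \<open>P\<close>, which leaves no room for
          a saturated ideal strictly between.\<close>
        have simple: "K = I \<or> K = J" if K: "saturated P K" "I \<subseteq> K" "K \<subseteq> J" for K
        proof (cases "K = I")
          case False
          then obtain x where x: "x \<in> K" "x \<notin> I" using K by auto
          then have "x \<in> J" using K by auto
          then obtain s where s: "s \<in> carrier R" "s \<notin> P" "s \<otimes> x \<in> adjoin_element I g" and xc: "x \<in> carrier R"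
            by (auto simp: J_def localization_closure_def)
          then obtain i d where id: "s \<otimes> x = i \<oplus> d \<otimes> g" "i \<in> I" "d \<in> carrier R"
            by (auto simp: adjoin_element_def)
          note Kid = saturated_ideal[OF K(1)]
          have "i \<oplus> d \<otimes> g \<in> K" using x ideal_mult[OF Kid] s id by metis
          then have dgK: "d \<otimes> g \<in> K" using ideal_add_cancel[OF Kid] id K(2) g by auto
          have "d \<notin> P"
          proof
            assume "d \<in> P"
            then have "d \<otimes> g \<in> I" using colon by auto
            then have "s \<otimes> x \<in> I" using id ideal_add[OF step(1)] by simp
            then show False using saturatedD[OF step(3)] s xc x by blast
          qed
          then have "g \<in> K" using saturatedD[OF K(1) dgK] id g by simp
          then have "J \<subseteq> K" unfolding J_def
            by (intro localization_closure_least K adjoin_element_least Kid)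
          then show ?thesis using K by auto
        qed auto
        obtain N1 where N1: "\<forall>n\<ge>N1. L n \<inter> J = L N1 \<inter> J"
        proof (cases "\<forall>n. L n \<inter> J = J")
          case True
          then show ?thesis using that[of 0] by simp
        next
          case False
          then obtain N where "L N \<inter> J \<noteq> J" by auto
          moreover have LJ: "L n \<inter> J = I \<or> L n \<inter> J = J" for n
            using simple[of "L n \<inter> J"] L satJ IJ saturated_inter by auto
          ultimately have N: "L N \<inter> J = I" by auto
          have "L n \<inter> J = I" if "n \<ge> N" for n using dec[OF that] N L IJ by auto
          then show ?thesis using that[of N] N by simp
        qed
        \<comment> \<open>The saturated sums of \<open>L n\<close> and \<open>J\<close>, to which
          the induction hypothesis for \<open>J\<close> applies.\<close>
        define L' where "L' n = localization_closure P (adjoin_element (L n) g)" for n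
        have Lid: "ideal (L n) R" for n using L saturated_ideal by blast
        have Laid: "ideal (adjoin_element (L n) g) R" for n
          by (rule adjoin_element_ideal[OF Lid g(1)])
        have L'sat: "saturated P (L' n)" for n
          unfolding L'_def by (rule localization_closure_saturated[OF P Laid])
        have aL: "adjoin_element (L n) g \<subseteq> L' n" for n
          unfolding L'_def by (rule subset_localization_closure[OF P Laid])
        have LL': "L n \<subseteq> L' n" for n
          using aL subset_adjoin_element[OF Lid g(1)] by blast
        have gL': "g \<in> L' n" for n
          using aL mem_adjoin_element[OF Lid g(1)] by blast
        have "\<exists>N. \<forall>n\<ge>N. L' n = L' N"
        proof (rule step(2)[rule_format, OF saturated_ideal[OF satJ] IJ satJ, rule_format])
          fix n
          show "saturated P (L' n) \<and> J \<subseteq> L' n \<and> L' (Suc n) \<subseteq> L' n"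
          proof (intro conjI L'sat)
            show "J \<subseteq> L' n" unfolding J_def
              using L LL' gL' by (intro localization_closure_least adjoin_element_least L'sat
                  saturated_ideal[OF L'sat]) blast+
            show "L' (Suc n) \<subseteq> L' n" unfolding L'_def[of "Suc n"]
              using L LL' gL' by (intro localization_closure_least adjoin_element_least L'sat
                  saturated_ideal[OF L'sat]) blast+
          qed
        qed (use step(4) IJ in auto)
        then obtain N2 where N2: "\<forall>n\<ge>N2. L' n = L' N2" by blast
        define N where "N = max N1 N2"
        \<comment> \<open>Modular law: \<open>L n\<close> is contained in \<open>L N\<close>, and
          both have the same saturated sum with \<open>J\<close> and the same intersection with
          \<open>J\<close>.\<close>
        have "L n = L N" if "n \<ge> N" for n
        proof
          show "L n \<subseteq> L N" by (rule dec[OF that])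
          show "L N \<subseteq> L n"
          proof
            fix x assume x: "x \<in> L N"
            then have xc: "x \<in> carrier R" using ideal_subset[OF Lid] by blast
            have "L' N = L' n" using N2 that unfolding N_def by (metis max.cobounded2 order_trans)
            then have "x \<in> L' n" using x LL' by blast
            then obtain s where s: "s \<in> carrier R" "s \<notin> P" "s \<otimes> x \<in> adjoin_element (L n) g"
              by (auto simp: L'_def localization_closure_def)
            then obtain l r where lr: "s \<otimes> x = l \<oplus> r \<otimes> g" "l \<in> L n" "r \<in> carrier R"
              by (auto simp: adjoin_element_def)
            have "l \<oplus> r \<otimes> g \<in> L N" using ideal_mult[OF Lid x s(1)] lr by simp
            then have "r \<otimes> g \<in> L N"
              using ideal_add_cancel[OF Lid] lr dec[OF that] g by auto
            moreover have "r \<otimes> g \<in> J"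
              using gJ mem_adjoin_element[OF step(1) g(1)] ideal_mult[OF saturated_ideal[OF satJ]] lr(3) by blast
            moreover have "L N \<inter> J = L n \<inter> J"
              using N1 that unfolding N_def by (metis max.cobounded1 order_trans)
            ultimately have "r \<otimes> g \<in> L n" by blast
            then have "s \<otimes> x \<in> L n" using lr ideal_add[OF Lid] by simp
            then show "x \<in> L n" using saturatedD[of P "L n" s x] L s xc by blast
          qed
        qed
        then show ?thesis by blast
      qed
    qed
  qed
  show ?thesis
    by (rule *[OF saturated_ideal[OF assms(2)] assms(2), rule_format]) (use assms in auto)
qed

text \<open>Nakayama's lemma at \<open>Q\<close> for \<open>L\<close> modulo \<open>N\<close>. A
  maximal counterexample \<open>K\<close> takes the place of a generating set: adding one element
  \<open>z\<close> of \<open>L\<close> to \<open>K\<close> absorbs all of \<open>L\<close>, so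
  \<open>L\<close> is locally generated by \<open>z\<close> over \<open>K\<close>, and modulo
  \<open>K\<close> a multiple of \<open>z\<close> from outside \<open>Q\<close> equals one from
  inside \<open>Q\<close>.\<close>

lemma saturated_nakayama:
  assumes Q: "primeideal Q R" and N: "saturated Q N" and L: "ideal L R"
    and sub: "\<And>z. z \<in> L \<Longrightarrow>
       \<exists>s\<in>carrier R - Q. s \<otimes> z \<in> genideal R (N \<union> {q \<otimes> l | q l. q \<in> Q \<and> l \<in> L})"
  shows "L \<subseteq> N"
proof (rule ccontr)
  assume "\<not> L \<subseteq> N"
  then have "{K. saturated Q K \<and> N \<subseteq> K \<and> \<not> L \<subseteq> K} \<noteq> {}" using N by auto
  then obtain K where K: "K \<in> {K. saturated Q K \<and> N \<subseteq> K \<and> \<not> L \<subseteq> K}"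
    and max: "\<And>J. \<lbrakk>J \<in> {K. saturated Q K \<and> N \<subseteq> K \<and> \<not> L \<subseteq> K}; K \<subseteq> J\<rbrakk> \<Longrightarrow> J = K"
    by (rule ideal_family_has_maximal) (auto intro: saturated_ideal)
  then have Ks: "saturated Q K" "N \<subseteq> K" and Kid: "ideal K R" by (auto intro: saturated_ideal)
  note Qid = prime_ideal[OF Q]
  obtain z where z: "z \<in> L" "z \<notin> K" using K by auto
  have zc: "z \<in> carrier R" using z ideal_subset[OF L] by auto
  define J where "J = localization_closure Q (adjoin_element K z)"
  have idz: "ideal (adjoin_element K z) R" by (rule adjoin_element_ideal[OF Kid zc])
  have J: "saturated Q J" "adjoin_element K z \<subseteq> J"
    unfolding J_def by (rule localization_closure_saturated[OF Q idz], rule subset_localization_closure[OF Q idz])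
  then have "K \<subset> J"
    using z subset_adjoin_element[OF Kid zc] mem_adjoin_element[OF Kid zc] by blast
  then have LJ: "L \<subseteq> J" using max[of J] J Ks by auto
  \<comment> \<open>Locally this is \<open>K\<close> plus the multiples of \<open>z\<close> by
    \<open>Q\<close>. It contains \<open>N\<close> and all products \<open>q \<otimes> l\<close>,
    hence the ideal from the hypothesis, and with it a multiple of \<open>z\<close> by some
    \<open>s\<close> outside \<open>Q\<close>.\<close>
  define T where "T = {w \<in> carrier R. \<exists>s\<in>carrier R - Q. \<exists>d\<in>Q. \<exists>k\<in>K. s \<otimes> w = k \<oplus> d \<otimes> z}"
  have TI: "w \<in> T" if "s \<otimes> w = k \<oplus> d \<otimes> z" "w \<in> carrier R" "s \<in> carrier R - Q" "d \<in> Q" "k \<in> K" for s w d k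
    using that unfolding T_def by blast
  note Qc = ideal_subset[OF Qid] and Kc = ideal_subset[OF Kid]
  have mc: "s \<otimes> t \<in> carrier R - Q" if "s \<in> carrier R - Q" "t \<in> carrier R - Q" for s t
    using that prime_mult[OF Q] by auto
  have Tid: "ideal T R"
  proof (rule idealI')
    show "\<zero> \<in> T" unfolding T_def using ideal_zero[OF Kid] ideal_zero[OF Qid] zc prime_one[OF Q]
      by (auto intro!: bexI[of _ \<one>] bexI[of _ \<zero>])
    show "x \<oplus> y \<in> T" if xy: "x \<in> T" "y \<in> T" for x y
    proof -
      obtain s d k t e l where *: "x \<in> carrier R" "s \<in> carrier R - Q" "d \<in> Q" "k \<in> K" "s \<otimes> x = k \<oplus> d \<otimes> z"
        "y \<in> carrier R" "t \<in> carrier R - Q" "e \<in> Q" "l \<in> K" "t \<otimes> y = l \<oplus> e \<otimes> z"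
        using xy by (auto simp: T_def)
      have c: "s \<in> carrier R" "d \<in> carrier R" "k \<in> carrier R" "t \<in> carrier R" "e \<in> carrier R" "l \<in> carrier R"
        "x \<in> carrier R" "y \<in> carrier R"
        using * Qc Kc by auto
      have "(s \<otimes> t) \<otimes> (x \<oplus> y) = t \<otimes> (s \<otimes> x) \<oplus> s \<otimes> (t \<otimes> y)"
        using c by (simp add: r_distr m_ac)
      also have "\<dots> = t \<otimes> (k \<oplus> d \<otimes> z) \<oplus> s \<otimes> (l \<oplus> e \<otimes> z)" using * by simp
      also have "\<dots> = (t \<otimes> k \<oplus> s \<otimes> l) \<oplus> (t \<otimes> d \<oplus> s \<otimes> e) \<otimes> z"
        using c zc by algebra
      finally show ?thesis
        using * mc[of s t] c ideal_add[OF Kid] ideal_mult[OF Kid] ideal_add[OF Qid] ideal_mult[OF Qid]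
        by (intro TI[of "s \<otimes> t" _ "t \<otimes> k \<oplus> s \<otimes> l" "t \<otimes> d \<oplus> s \<otimes> e"]) simp_all
    qed
    show "r \<otimes> x \<in> T" if xr: "x \<in> T" "r \<in> carrier R" for x r
    proof -
      obtain s d k where *: "x \<in> carrier R" "s \<in> carrier R - Q" "d \<in> Q" "k \<in> K" "s \<otimes> x = k \<oplus> d \<otimes> z"
        using xr by (auto simp: T_def)
      have c: "s \<in> carrier R" "d \<in> carrier R" "k \<in> carrier R" using * Qc Kc by auto
      have "s \<otimes> (r \<otimes> x) = r \<otimes> (s \<otimes> x)" using c * xr by (simp add: m_ac)
      also have "\<dots> = r \<otimes> k \<oplus> (r \<otimes> d) \<otimes> z" using c * xr zc by (simp add: r_distr m_assoc)
      finally show ?thesis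
        using * c xr ideal_mult[OF Kid] ideal_mult[OF Qid]
        by (intro TI[of s _ "r \<otimes> k" "r \<otimes> d"]) simp_all
    qed
  qed (auto simp: T_def)
  have "N \<subseteq> T"
  proof
    fix n assume "n \<in> N"
    then have "n \<in> K" "n \<in> carrier R" using Ks Kc by auto
    then show "n \<in> T" using ideal_zero[OF Qid] zc prime_one[OF Q]
      by (intro TI[of \<one> n n \<zero>]) auto
  qed
  moreover have "q \<otimes> l \<in> T" if ql: "q \<in> Q" "l \<in> L" for q l
  proof -
    have c: "q \<in> carrier R" "l \<in> carrier R" using ql Qc ideal_subset[OF L] by auto
    have "l \<in> J" using ql LJ by auto
    then obtain s k r where *: "s \<in> carrier R - Q" "k \<in> K" "r \<in> carrier R" "s \<otimes> l = k \<oplus> r \<otimes> z"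
      by (auto simp: J_def localization_closure_def adjoin_element_def)
    have c': "k \<in> carrier R" "s \<in> carrier R" using * Kc by auto
    have "s \<otimes> (q \<otimes> l) = q \<otimes> (s \<otimes> l)" using c c' by (simp add: m_ac)
    also have "\<dots> = q \<otimes> k \<oplus> (r \<otimes> q) \<otimes> z" using c c' * zc by (simp add: r_distr m_ac)
    finally show ?thesis
      using * c c' ql ideal_mult[OF Kid] ideal_mult[OF Qid]
      by (intro TI[of s _ "q \<otimes> k" "r \<otimes> q"]) simp_all
  qed
  ultimately have "genideal R (N \<union> {q \<otimes> l | q l. q \<in> Q \<and> l \<in> L}) \<subseteq> T"
    by (intro genideal_minimal[OF Tid]) auto
  then obtain s where s: "s \<in> carrier R - Q" "s \<otimes> z \<in> T" using sub[OF z(1)] by blast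
  then obtain t d k where *: "t \<in> carrier R - Q" "d \<in> Q" "k \<in> K" "t \<otimes> (s \<otimes> z) = k \<oplus> d \<otimes> z"
    by (auto simp: T_def)
  have c: "s \<in> carrier R" "t \<in> carrier R" "d \<in> carrier R" "k \<in> carrier R" using s * Qc Kc by auto
  \<comment> \<open>The factor \<open>t \<otimes> s \<ominus> d\<close> lies outside
    \<open>Q\<close>; it is the local unit by which \<open>z\<close> is recovered.\<close>
  have "(t \<otimes> s \<ominus> d) \<otimes> z = t \<otimes> (s \<otimes> z) \<ominus> d \<otimes> z"
    using c zc by algebra
  also have "\<dots> = k" unfolding *(4) using c zc by algebra
  finally have "(t \<otimes> s \<ominus> d) \<otimes> z \<in> K" using * by simp
  moreover have "t \<otimes> s \<ominus> d \<notin> Q"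
  proof
    assume "t \<otimes> s \<ominus> d \<in> Q"
    then have "(t \<otimes> s \<ominus> d) \<oplus> d \<in> Q" using ideal_add[OF Qid] * by blast
    moreover have "(t \<otimes> s \<ominus> d) \<oplus> d = t \<otimes> s" using c by algebra
    ultimately show False using mc[of t s] * s by auto
  qed
  ultimately have "z \<in> K" using saturatedD[OF Ks(1)] c zc by blast
  then show False using z by simp
qed


text \<open>Modulo \<open>P0\<close> and \<open>x\<close> the localization at \<open>P\<close> is
  Artinian, so the symbolic powers of \<open>Q\<close> become stationary once \<open>x\<close> is
  added to them. As \<open>x\<close> is outside \<open>Q\<close>, Nakayama at \<open>P\<close>
  removes \<open>x\<close> again, and Nakayama at \<open>Q\<close> pushes a symbolic power into
  \<open>P0\<close>. This contradicts the powers of an element of \<open>Q\<close> outside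
  \<open>P0\<close>.\<close>

theorem principal_ideal_theorem:
  assumes P0: "primeideal P0 R" and Q: "primeideal Q R" and P: "primeideal P R"
    and strict: "P0 \<subset> Q" "Q \<subset> P" and x: "x \<in> P"
    and min: "\<And>Q'. \<lbrakk>primeideal Q' R; P0 \<subseteq> Q'; x \<in> Q'; Q' \<subseteq> P\<rbrakk> \<Longrightarrow> Q' = P"
  shows False
proof -
  note P0id = prime_ideal[OF P0] and Qid = prime_ideal[OF Q] and Pid = prime_ideal[OF P]
  have xc: "x \<in> carrier R" using x ideal_subset[OF Pid] by auto
  have xQ: "x \<notin> Q" using min[OF Q] strict by auto
  have Qc: "Q \<subseteq> carrier R" by (rule ideal_subset[OF Qid])
  \<comment> \<open>\<open>S k\<close> is the \<open>k\<close>-th symbolic power of \<open>Q/P0\<close>, pulled back to \<open>R\<close>.\<close>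
  define gen where "gen L = P0 \<union> {q \<otimes> l | q l. q \<in> Q \<and> l \<in> L}" for L
  define S where "S = rec_nat (carrier R) (\<lambda>_ L. localization_closure Q (genideal R (gen L)))"
  have S0: "S 0 = carrier R" and SSuc: "S (Suc k) = localization_closure Q (genideal R (gen (S k)))" for k
    by (simp_all add: S_def)
  have genc: "gen L \<subseteq> carrier R" if "L \<subseteq> carrier R" for L
    using that Qc ideal_subset[OF P0id] by (auto simp: gen_def)
  have sat: "saturated Q (S k)" for k
  proof (induction k)
    case 0
    then show ?case using oneideal by (simp add: S0 saturated_def)
  next
    case (Suc k)
    then show ?case unfolding SSuc
      by (intro localization_closure_saturated Q genideal_ideal genc ideal_subset saturated_ideal)
  qed
  note Sid = saturated_ideal[OF sat]
  note Sc = ideal_subset[OF Sid]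
  have genS: "gen (S k) \<subseteq> S (Suc k)" for k
    unfolding SSuc using genideal_self[OF genc[OF Sc]]
      subset_localization_closure[OF Q genideal_ideal[OF genc[OF Sc]]] by (rule order_trans)
  have dec: "S (Suc k) \<subseteq> S k" for k
  proof (induction k)
    case 0
    then show ?case using Sc S0 by auto
  next
    case (Suc k)
    have "gen (S (Suc k)) \<subseteq> gen (S k)" using Suc by (auto simp: gen_def)
    then have "gen (S (Suc k)) \<subseteq> S (Suc k)" using genS by blast
    then show ?case unfolding SSuc[of "Suc k"]
      by (intro localization_closure_least sat genideal_minimal Sid)
  qed
  have P0S: "P0 \<subseteq> S k" for k
  proof (cases k)
    case 0
    then show ?thesis using ideal_subset[OF P0id] S0 by simp
  next
    case (Suc j)
    then show ?thesis using genS[of j] by (auto simp: gen_def)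
  qed
  define I where "I = localization_closure P (adjoin_element P0 x)"
  define L where "L k = localization_closure P (adjoin_element (S k) x)" for k
  have aS: "ideal (adjoin_element (S k) x) R" for k by (rule adjoin_element_ideal[OF Sid xc])
  have aP0: "ideal (adjoin_element P0 x) R" by (rule adjoin_element_ideal[OF P0id xc])
  have Lsat: "saturated P (L k)" for k
    unfolding L_def by (rule localization_closure_saturated[OF P aS])
  have subL: "adjoin_element (S k) x \<subseteq> L k" for k
    unfolding L_def by (rule subset_localization_closure[OF P aS])
  have SL: "S k \<subseteq> L k" for k
    using subL subset_adjoin_element[OF Sid xc] by blast
  have xL: "x \<in> L k" for k
    using subL mem_adjoin_element[OF Sid xc] by blast
  have subI: "adjoin_element P0 x \<subseteq> I"
    unfolding I_def by (rule subset_localization_closure[OF P aP0])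
  have "\<exists>N. \<forall>n\<ge>N. L n = L N"
  proof (rule saturated_descending_chain[OF P])
    show "saturated P I" unfolding I_def by (rule localization_closure_saturated[OF P aP0])
    show "Q' = P" if "primeideal Q' R" "I \<subseteq> Q'" "Q' \<subseteq> P" for Q'
      using min[of Q'] that subI subset_adjoin_element[OF P0id xc] mem_adjoin_element[OF P0id xc] by blast
    show "saturated P (L n)" for n by (rule Lsat)
    show "I \<subseteq> L n" for n unfolding I_def
      using P0S SL xL by (intro localization_closure_least adjoin_element_least Lsat
          saturated_ideal[OF Lsat]) blast+
    show "L (Suc n) \<subseteq> L n" for n unfolding L_def[of "Suc n"]
      using dec SL xL by (intro localization_closure_least adjoin_element_least Lsat
          saturated_ideal[OF Lsat]) blast+
  qed
  then obtain k where k: "L k = L (Suc k)" by (metis le_SucI order_refl)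
  have "S k \<subseteq> S (Suc k)"
  proof (rule saturated_nakayama[OF P _ Sid])
    show "saturated P (S (Suc k))" using saturated_mono[OF sat] strict by auto
    fix z assume z: "z \<in> S k"
    then have "z \<in> L (Suc k)" using SL k by auto
    then obtain s w r where *: "s \<in> carrier R - P" "w \<in> S (Suc k)" "r \<in> carrier R" "s \<otimes> z = w \<oplus> r \<otimes> x"
      by (auto simp: L_def localization_closure_def adjoin_element_def)
    \<comment> \<open>The coefficient \<open>r\<close> of \<open>x\<close> comes from
      \<open>S k\<close> itself: \<open>r \<otimes> x\<close> is in \<open>S k\<close>, which is
      saturated at \<open>Q\<close>, and \<open>x\<close> is outside \<open>Q\<close>.\<close>
    have "w \<oplus> r \<otimes> x \<in> S k" using ideal_mult[OF Sid z] * by (metis DiffD1)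
    moreover have "w \<in> S k" using * dec by blast
    ultimately have "x \<otimes> r \<in> S k"
      using ideal_add_cancel[OF Sid, of w "r \<otimes> x" k] * xc by (simp add: m_comm)
    then have r: "r \<in> S k" using saturatedD[OF sat] xc xQ * by blast
    let ?G = "S (Suc k) \<union> {q \<otimes> l |q l. q \<in> P \<and> l \<in> S k}"
    have Gc: "?G \<subseteq> carrier R" using Sc ideal_subset[OF Pid] by blast
    have "r \<otimes> x = x \<otimes> r" using xc * by (simp add: m_comm)
    then have "r \<otimes> x \<in> ?G" using r x by blast
    then have "r \<otimes> x \<in> genideal R ?G" "w \<in> genideal R ?G"
      using * genideal_self[OF Gc] by blast+
    then have "s \<otimes> z \<in> genideal R ?G"
      unfolding *(4) by (intro ideal_add[OF genideal_ideal[OF Gc]])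
    then show "\<exists>s\<in>carrier R - P. s \<otimes> z \<in> genideal R ?G" using * by blast
  qed
  moreover have "S k \<subseteq> P0" if "S k \<subseteq> S (Suc k)"
  proof (rule saturated_nakayama[OF Q saturated_mono[OF prime_saturated[OF P0]] Sid])
    show "P0 \<subseteq> Q" using strict by auto
    fix z assume "z \<in> S k"
    then show "\<exists>s\<in>carrier R - Q. s \<otimes> z \<in> genideal R (P0 \<union> {q \<otimes> l |q l. q \<in> Q \<and> l \<in> S k})"
      using that by (auto simp: SSuc localization_closure_def gen_def)
  qed
  ultimately have SP0: "S k \<subseteq> P0" by blast
  obtain y where y: "y \<in> Q" "y \<notin> P0" "y \<in> carrier R" using strict Qc by auto
  have "y [^] j \<in> S j" for j :: nat
  proof (induction j)
    case (Suc j)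
    have "y [^] Suc j = y \<otimes> y [^] j" using y by (simp add: m_comm)
    then have "y [^] Suc j \<in> gen (S j)" using Suc y by (auto simp: gen_def)
    then show ?case using genS by blast
  qed (simp add: S0)
  then show False using prime_pow[OF P0] SP0 y by blast
qed

end

section \<open>Chains of primes and systems of parameters\<close>

text \<open>Recursion from the bottom, for arguments that keep a prime and replace what lies above
  it; the top is not recorded. In contrast, \<open>descending_chain\<close> records both ends and
  recurses from the top, as needed for heights over \<open>P0\<close>.\<close>

fun ascending_chain :: "('a, 'm) ring_scheme \<Rightarrow> 'a set \<Rightarrow> nat \<Rightarrow> bool" where
  "ascending_chain R P 0 \<longleftrightarrow> primeideal P R"
| "ascending_chain R P (Suc n) \<longleftrightarrow> primeideal P R \<and> (\<exists>Q. P \<subset> Q \<and> ascending_chain R Q n)"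

lemma ascending_chain_prime: "ascending_chain R P n \<Longrightarrow> primeideal P R"
  by (cases n) auto

lemma ascending_chain_function:
  assumes "\<And>i. i \<le> n \<Longrightarrow> primeideal (P i) R" "\<And>i. i < n \<Longrightarrow> P i \<subset> P (Suc i)"
  shows "ascending_chain R (P 0) n"
  using assms
proof (induction n arbitrary: P)
  case (Suc n)
  have "ascending_chain R ((\<lambda>i. P (Suc i)) 0) n"
    by (rule Suc.IH) (use Suc.prems in auto)
  then show ?case using Suc.prems[of 0] by auto
qed simp

lemma ascending_chain_imp_function:
  assumes "ascending_chain R Q n"
  shows "\<exists>P. P 0 = Q \<and> (\<forall>i\<le>n. primeideal (P i) R) \<and> (\<forall>i<n. P i \<subset> P (Suc i))"
  using assms
proof (induction n arbitrary: Q)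
  case 0
  then show ?case by (intro exI[of _ "\<lambda>_. Q"]) auto
next
  case (Suc n)
  then obtain Q' where Q': "Q \<subset> Q'" "ascending_chain R Q' n" "primeideal Q R"
    by auto
  then obtain P where P: "P 0 = Q'" "\<forall>i\<le>n. primeideal (P i) R" "\<forall>i<n. P i \<subset> P (Suc i)"
    using Suc.IH[OF Q'(2)] by (elim exE conjE)
  show ?case
  proof (intro exI[of _ "case_nat Q P"] conjI allI impI)
    show "primeideal (case_nat Q P i) R" if "i \<le> Suc n" for i
      using that P Q' by (cases i) simp_all
    show "case_nat Q P i \<subset> case_nat Q P (Suc i)" if "i < Suc n" for i
      using that P Q' by (cases i) simp_all
  qed simp
qed

lemma ascending_chain_mono:
  assumes "ascending_chain R Q n" "P \<subseteq> Q" "primeideal P R"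
  shows "ascending_chain R P n"
proof (cases n)
  case (Suc m)
  then obtain Q' where "Q \<subset> Q'" "ascending_chain R Q' m" using assms(1) by auto
  moreover have "P \<subset> Q'" by (rule subset_psubset_trans[OF assms(2) \<open>Q \<subset> Q'\<close>])
  ultimately show ?thesis using Suc assms(3) by auto
qed (use assms in simp)

lemma ascending_chain_le:
  assumes "ascending_chain R P n" "m \<le> n"
  shows "ascending_chain R P m"
  using assms
proof (induction n arbitrary: P m)
  case (Suc n)
  then show ?case by (cases m) auto
qed simp

fun descending_chain :: "('a, 'm) ring_scheme \<Rightarrow> 'a set \<Rightarrow> nat \<Rightarrow> 'a set \<Rightarrow> bool" where
  "descending_chain R P0 0 P \<longleftrightarrow> primeideal P R \<and> P = P0"
| "descending_chain R P0 (Suc n) P \<longleftrightarrow> primeideal P R \<and> (\<exists>Q. Q \<subset> P \<and> descending_chain R P0 n Q)"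

lemma descending_chain_prime: "descending_chain R P0 n P \<Longrightarrow> primeideal P R"
  by (cases n) auto

lemma descending_chain_bot: "descending_chain R P0 n P \<Longrightarrow> primeideal P0 R \<and> P0 \<subseteq> P"
proof (induction n arbitrary: P)
  case (Suc n)
  then show ?case by fastforce
qed auto

lemma descending_chain_trans:
  assumes "descending_chain R Q n P" "descending_chain R P0 m Q"
  shows "descending_chain R P0 (m + n) P"
  using assms by (induction n arbitrary: P) auto

lemma ascending_chain_imp_descending:
  assumes "ascending_chain R P0 n"
  shows "\<exists>P. descending_chain R P0 n P"
  using assms
proof (induction n arbitrary: P0)
  case (Suc n)
  then obtain Q where Q: "P0 \<subset> Q" "primeideal P0 R" "ascending_chain R Q n" by auto
  then obtain P where "descending_chain R Q n P" using Suc.IH[OF Q(3)] by (elim exE)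
  with Q have *: "P0 \<subset> Q" "primeideal P0 R" "descending_chain R Q n P" by simp_all
  have "descending_chain R P0 1 Q"
    using * descending_chain_bot[OF *(3)] by auto
  then have "descending_chain R P0 (1 + n) P" by (rule descending_chain_trans[OF *(3)])
  then show ?case by (intro exI[of _ P]) simp
qed auto

lemma descending_chain_Suc_bottom:
  assumes "descending_chain R P0 (Suc n) P"
  shows "\<exists>Q. P0 \<subset> Q \<and> descending_chain R Q n P"
  using assms
proof (induction n arbitrary: P)
  case 0
  then show ?case by auto
next
  case (Suc n)
  then obtain Q Q' where *: "Q \<subset> P" "P0 \<subset> Q'" "descending_chain R Q' n Q" "primeideal P R"
    by (metis descending_chain.simps(2))
  then show ?case by (intro exI[of _ Q']) auto
qed

section \<open>Krull's height theorem and the moving of chains\<close>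

context noetherian_cring
begin

text \<open>A prime inside \<open>P2\<close> that is minimal over \<open>P0\<close> and
  \<open>x\<close> cannot be \<open>P2\<close> itself: \<open>P1\<close> lies strictly between
  \<open>P0\<close> and \<open>P2\<close>, against the principal ideal theorem.\<close>

lemma insert_element_between:
  assumes "primeideal P0 R" "primeideal P1 R" "primeideal P2 R"
    and "P0 \<subset> P1" "P1 \<subset> P2" "x \<in> P2"
  obtains Q where "primeideal Q R" "P0 \<subset> Q" "Q \<subset> P2" "x \<in> Q"
proof (cases "x \<in> P0")
  case True
  then show ?thesis using that[of P1] assms by auto
next
  case False
  have xc: "x \<in> carrier R" using assms ideal_subset[OF prime_ideal] by blast
  note id0 = prime_ideal[OF assms(1)]
  have sub2: "adjoin_element P0 x \<subseteq> P2"
    using assms by (intro adjoin_element_least prime_ideal) auto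
  obtain p where p: "primeideal p R" "adjoin_element P0 x \<subseteq> p" "p \<subseteq> P2"
    "\<And>Q. \<lbrakk>primeideal Q R; adjoin_element P0 x \<subseteq> Q; Q \<subseteq> p\<rbrakk> \<Longrightarrow> Q = p"
    by (rule exists_minimal_prime[OF adjoin_element_ideal[OF id0 xc] assms(3) sub2], rule that)
  have sub: "P0 \<subseteq> p" "x \<in> p"
    using p(2) subset_adjoin_element[OF id0 xc] mem_adjoin_element[OF id0 xc] by auto
  moreover have "p \<noteq> P2"
  proof
    assume "p = P2"
    show False
    proof (rule principal_ideal_theorem[OF assms(1-6)])
      fix Q' assume "primeideal Q' R" "P0 \<subseteq> Q'" "x \<in> Q'" "Q' \<subseteq> P2"
      then show "Q' = P2"
        using p(4)[of Q'] adjoin_element_least[OF prime_ideal[of Q']] \<open>p = P2\<close> by auto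
    qed
  qed
  ultimately show ?thesis using that[of p] p False by auto
qed

text \<open>The element is pushed down one prime at a time until it reaches the first prime above
  \<open>P0\<close>. This prime is \<open>Q\<close>, so the remaining length is one less.\<close>

lemma descending_chain_through_element:
  assumes "descending_chain R P0 (Suc n) P" "x \<in> P"
  obtains Q where "P0 \<subset> Q" "x \<in> Q" "descending_chain R Q n P"
proof -
  have "\<exists>Q. P0 \<subset> Q \<and> x \<in> Q \<and> descending_chain R Q n P"
    using assms
  proof (induction n arbitrary: P)
    case 0
    then show ?case by auto
  next
    case (Suc n)
    then obtain P1 P2 where *: "P1 \<subset> P" "P2 \<subset> P1" "descending_chain R P0 n P2" "primeideal P R" "primeideal P1 R"
      by auto
    obtain Q where Q: "primeideal Q R" "P2 \<subset> Q" "Q \<subset> P" "x \<in> Q"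
      using insert_element_between[OF descending_chain_prime[OF *(3)] *(5,4,2,1) Suc.prems(2)] .
    have "descending_chain R P0 (Suc n) Q"
      unfolding descending_chain.simps using Q(1,2) *(3) by (intro conjI exI[of _ P2])
    then obtain Q' where "P0 \<subset> Q'" "x \<in> Q'" "descending_chain R Q' n Q"
      using Suc.IH[of Q] Q(4) by metis
    then show ?case
      unfolding descending_chain.simps using Q(3) *(4) by (intro exI[of _ Q'] conjI exI[of _ Q])
  qed
  then show ?thesis using that by blast
qed

text \<open>Each element of \<open>S\<close> is absorbed into the base prime at the cost of one
  step. When none is left, minimality makes the base equal to \<open>P\<close>, and no step can
  remain.\<close>

theorem height_theorem:
  assumes "descending_chain R P0 n P" "finite S" "S \<subseteq> P"
    and "\<And>Q. \<lbrakk>primeideal Q R; P0 \<subseteq> Q; S \<subseteq> Q; Q \<subseteq> P\<rbrakk> \<Longrightarrow> Q = P"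
  shows "n \<le> card S"
  using assms(2,1,3,4)
proof (induction S arbitrary: n P0 rule: finite_induct)
  case empty
  then have "P0 = P" using descending_chain_bot[of R P0 n P] by simp
  show ?case
  proof (cases n)
    case (Suc m)
    then obtain Q where "P0 \<subset> Q" "descending_chain R Q m P"
      using descending_chain_Suc_bottom[of R P0 m P] empty(1) by blast
    then show ?thesis using descending_chain_bot[of R Q m P] \<open>P0 = P\<close> by (simp add: less_le_not_le)
  qed simp
next
  case (insert x S)
  show ?case
  proof (cases n)
    case (Suc m)
    then obtain Q where Q: "P0 \<subset> Q" "x \<in> Q" "descending_chain R Q m P"
      using descending_chain_through_element[of P0 m P x] insert.prems by auto
    have "m \<le> card S"
    proof (rule insert.IH[OF Q(3)])
      show "Q' = P" if "primeideal Q' R" "Q \<subseteq> Q'" "S \<subseteq> Q'" "Q' \<subseteq> P" for Q'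
        using insert.prems(3)[of Q'] that Q by auto
    qed (use insert.prems in auto)
    then show ?thesis using Suc insert.hyps by simp
  qed simp
qed

lemma primes_over_adjoined_element:
  assumes "primeideal P0 R" "c \<in> carrier R"
  obtains \<P> where "finite \<P>" "\<And>p. p \<in> \<P> \<Longrightarrow> primeideal p R" "\<And>p. p \<in> \<P> \<Longrightarrow> P0 \<subseteq> p"
    "\<And>p. p \<in> \<P> \<Longrightarrow> c \<in> p"
    "\<And>Q. \<lbrakk>primeideal Q R; P0 \<subseteq> Q; c \<in> Q\<rbrakk> \<Longrightarrow> \<exists>p\<in>\<P>. p \<subseteq> Q"
proof -
  note id0 = prime_ideal[OF assms(1)]
  obtain \<P> where F: "finite \<P>" "\<forall>p\<in>\<P>. primeideal p R \<and> adjoin_element P0 c \<subseteq> p"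
     "\<forall>Q. primeideal Q R \<and> adjoin_element P0 c \<subseteq> Q \<longrightarrow> (\<exists>p\<in>\<P>. p \<subseteq> Q)"
    using finitely_many_minimal_primes[OF adjoin_element_ideal[OF id0 assms(2)]] by blast
  show ?thesis
  proof (rule that[OF F(1)])
    show "primeideal p R" "P0 \<subseteq> p" "c \<in> p" if "p \<in> \<P>" for p
      using that F(2) subset_adjoin_element[OF id0 assms(2)] mem_adjoin_element[OF id0 assms(2)] by auto
    show "\<exists>p\<in>\<P>. p \<subseteq> Q" if "primeideal Q R" "P0 \<subseteq> Q" "c \<in> Q" for Q
      using F(3) that adjoin_element_least[OF prime_ideal[OF that(1)] that(2,3)] by blast
  qed
qed

text \<open>This moves an interior prime of a chain off \<open>c\<close>. Take \<open>y\<close> in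
  \<open>P2\<close> outside \<open>P0\<close> and outside the finitely many primes supplied for
  \<open>P0\<close> and \<open>c\<close>. A prime minimal over \<open>P0\<close> and
  \<open>y\<close> has no prime strictly between itself and \<open>P0\<close>, whereas containing
  \<open>c\<close> would create one.\<close>

lemma avoid_element_between:
  assumes "primeideal P0 R" "primeideal P1 R" "primeideal P2 R"
    and "P0 \<subset> P1" "P1 \<subset> P2" "c \<in> carrier R" "c \<notin> P0"
  obtains Q where "primeideal Q R" "P0 \<subset> Q" "Q \<subset> P2" "c \<notin> Q"
proof (cases "c \<in> P1")
  case True
  obtain \<P> where F: "finite \<P>" "\<And>p. p \<in> \<P> \<Longrightarrow> primeideal p R" "\<And>p. p \<in> \<P> \<Longrightarrow> P0 \<subseteq> p"
    "\<And>p. p \<in> \<P> \<Longrightarrow> c \<in> p"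
    "\<And>Q. \<lbrakk>primeideal Q R; P0 \<subseteq> Q; c \<in> Q\<rbrakk> \<Longrightarrow> \<exists>p\<in>\<P>. p \<subseteq> Q"
    by (rule primes_over_adjoined_element[OF assms(1,6)], rule that)
  \<comment> \<open>Primes containing \<open>P2\<close> cannot be avoided from within
    \<open>P2\<close> and are dropped; the prime \<open>p\<close> met below lies inside
    \<open>Q\<close>, which is strictly below \<open>P2\<close>.\<close>
  obtain y where y: "y \<in> P2" "\<And>p. p \<in> insert P0 {p \<in> \<P>. \<not> P2 \<subseteq> p} \<Longrightarrow> y \<notin> p"
  proof (rule prime_avoidance[of "insert P0 {p \<in> \<P>. \<not> P2 \<subseteq> p}" P2])
    show "ideal P2 R" by (rule prime_ideal[OF assms(3)])
  qed (use F assms in auto)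
  obtain Q where Q: "primeideal Q R" "P0 \<subset> Q" "Q \<subset> P2" "y \<in> Q"
    using insert_element_between[OF assms(1-5) y(1)] .
  note id0 = prime_ideal[OF assms(1)]
  have yc: "y \<in> carrier R" using y ideal_subset[OF prime_ideal[OF assms(3)]] by auto
  have "adjoin_element P0 y \<subseteq> Q" using Q by (intro adjoin_element_least prime_ideal) auto
  then obtain q where q: "primeideal q R" "adjoin_element P0 y \<subseteq> q" "q \<subseteq> Q"
    "\<And>Q'. \<lbrakk>primeideal Q' R; adjoin_element P0 y \<subseteq> Q'; Q' \<subseteq> q\<rbrakk> \<Longrightarrow> Q' = q"
    using exists_minimal_prime[OF adjoin_element_ideal[OF id0 yc] Q(1)] by blast
  have sub: "P0 \<subseteq> q" "y \<in> q"
    using q(2) subset_adjoin_element[OF id0 yc] mem_adjoin_element[OF id0 yc] by auto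
  moreover have "c \<notin> q"
  proof
    assume "c \<in> q"
    then obtain p where p: "p \<in> \<P>" "p \<subseteq> q" using F(5)[OF q(1) sub(1)] by blast
    then have "y \<notin> p" using y(2)[of p] q(3) Q(3) by auto
    show False
    proof (rule principal_ideal_theorem[OF assms(1) F(2)[OF p(1)] q(1)])
      show "P0 \<subset> p" using F(3,4)[OF p(1)] assms(7) by auto
      show "p \<subset> q" using p(2) sub \<open>y \<notin> p\<close> by auto
      show "y \<in> q" by (rule sub)
      show "Q' = q" if "primeideal Q' R" "P0 \<subseteq> Q'" "y \<in> Q'" "Q' \<subseteq> q" for Q'
        using q(4)[of Q'] that adjoin_element_least[OF prime_ideal[OF that(1)] that(2,3)] by auto
    qed
  qed
  moreover have "P0 \<subset> q" using sub y(2)[of P0] by auto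
  moreover have "q \<subset> P2" using q(3) Q(3) by auto
  ultimately show ?thesis using that[of q] q(1) by simp
qed (use assms that in auto)

lemma finite_primes_over:
  assumes "primeideal P0 R" "S \<subseteq> carrier R"
  obtains \<P> where "finite \<P>" "\<And>p. p \<in> \<P> \<Longrightarrow> primeideal p R" "\<And>p. p \<in> \<P> \<Longrightarrow> P0 \<union> S \<subseteq> p"
    "\<And>Q. \<lbrakk>primeideal Q R; P0 \<union> S \<subseteq> Q\<rbrakk> \<Longrightarrow> \<exists>p\<in>\<P>. p \<subseteq> Q"
proof -
  have c: "P0 \<union> S \<subseteq> carrier R" using assms ideal_subset[OF prime_ideal] by auto
  obtain \<P> where F: "finite \<P>" "\<forall>p\<in>\<P>. primeideal p R \<and> genideal R (P0 \<union> S) \<subseteq> p"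
     "\<forall>Q. primeideal Q R \<and> genideal R (P0 \<union> S) \<subseteq> Q \<longrightarrow> (\<exists>p\<in>\<P>. p \<subseteq> Q)"
    using finitely_many_minimal_primes[OF genideal_ideal[OF c]] by blast
  show ?thesis
  proof (rule that[OF F(1)])
    show "primeideal p R" "P0 \<union> S \<subseteq> p" if "p \<in> \<P>" for p
      using that F(2) genideal_self[OF c] by auto
    show "\<exists>p\<in>\<P>. p \<subseteq> Q" if "primeideal Q R" "P0 \<union> S \<subseteq> Q" for Q
      using F(3) that genideal_minimal[OF prime_ideal[OF that(1)] that(2)] by blast
  qed
qed

text \<open>Systems of parameters: the elements of \<open>as\<close> are chosen one after the other by prime
  avoidance.\<close>

lemma exists_parameters:
  assumes "descending_chain R P0 n P"
  obtains as where "length as = n" "set as \<subseteq> P"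
    "\<And>Q. \<lbrakk>primeideal Q R; P0 \<subseteq> Q; set as \<subseteq> Q; Q \<subseteq> P\<rbrakk> \<Longrightarrow> descending_chain R P0 n Q"
proof -
  have P: "primeideal P R" and P0: "primeideal P0 R"
    using assms descending_chain_prime descending_chain_bot by blast+
  \<comment> \<open>The invariant asks for a chain of length at least \<open>m\<close>. A new
    element gains a step at every prime other than \<open>P\<close>, since it avoids the supplied
    primes over the earlier elements; \<open>P\<close> itself has the given chain.\<close>
  have "\<exists>as. length as = m \<and> set as \<subseteq> P \<and>
      (\<forall>Q. primeideal Q R \<and> P0 \<subseteq> Q \<and> set as \<subseteq> Q \<and> Q \<subseteq> P \<longrightarrow> (\<exists>k\<ge>m. descending_chain R P0 k Q))"
    if "m \<le> n" for m
    using that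
  proof (induction m)
    case 0
    have "\<exists>k\<ge>0. descending_chain R P0 k Q" if "primeideal Q R" "P0 \<subseteq> Q" for Q
    proof (cases "Q = P0")
      case True
      then show ?thesis using that by (intro exI[of _ 0]) auto
    next
      case False
      then show ?thesis using that P0 by (intro exI[of _ 1]) auto
    qed
    then show ?case by auto
  next
    case (Suc m)
    then obtain as where as: "length as = m" "set as \<subseteq> P"
      "\<And>Q. \<lbrakk>primeideal Q R; P0 \<subseteq> Q; set as \<subseteq> Q; Q \<subseteq> P\<rbrakk> \<Longrightarrow> \<exists>k\<ge>m. descending_chain R P0 k Q"
      by auto
    have asc: "set as \<subseteq> carrier R" using as ideal_subset[OF prime_ideal[OF P]] by auto
    obtain \<P> where F: "finite \<P>" "\<And>p. p \<in> \<P> \<Longrightarrow> primeideal p R" "\<And>p. p \<in> \<P> \<Longrightarrow> P0 \<union> set as \<subseteq> p"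
      "\<And>Q. \<lbrakk>primeideal Q R; P0 \<union> set as \<subseteq> Q\<rbrakk> \<Longrightarrow> \<exists>p\<in>\<P>. p \<subseteq> Q"
      by (rule finite_primes_over[OF P0 asc], rule that)
    obtain y where y: "y \<in> P" "\<And>p. p \<in> {p \<in> \<P>. \<not> P \<subseteq> p} \<Longrightarrow> y \<notin> p"
    proof (rule prime_avoidance[of "{p \<in> \<P>. \<not> P \<subseteq> p}" P])
      show "ideal P R" by (rule prime_ideal[OF P])
    qed (use F in auto)
    have "\<exists>k\<ge>Suc m. descending_chain R P0 k Q"
      if Q: "primeideal Q R" "P0 \<subseteq> Q" "insert y (set as) \<subseteq> Q" "Q \<subseteq> P" for Q
    proof (cases "Q = P")
      case True
      then show ?thesis using assms Suc.prems by auto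
    next
      case False
      obtain p where p: "p \<in> \<P>" "p \<subseteq> Q" using F(4)[OF Q(1)] Q by auto
      then have "y \<notin> p" using y(2) Q False by auto
      then have "p \<subset> Q" using p Q by auto
      moreover obtain k where "k \<ge> m" "descending_chain R P0 k p"
        using as(3)[OF F(2)[OF p(1)]] F(3)[OF p(1)] p Q by auto
      ultimately show ?thesis using Q by (intro exI[of _ "Suc k"]) auto
    qed
    then show ?case using as y by (intro exI[of _ "y # as"]) auto
  qed
  from this[of n] obtain as where as: "length as = n" "set as \<subseteq> P"
      "\<And>Q. \<lbrakk>primeideal Q R; P0 \<subseteq> Q; set as \<subseteq> Q; Q \<subseteq> P\<rbrakk> \<Longrightarrow> \<exists>k\<ge>n. descending_chain R P0 k Q"
    by auto
  have asc: "set as \<subseteq> carrier R" using as ideal_subset[OF prime_ideal[OF P]] by auto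
  \<comment> \<open>Interior primes are dropped and both ends kept. Length \<open>0\<close> is
    excluded because it would demand \<open>Q = P0\<close>.\<close>
  have shorten: "descending_chain R P0 n Q" if "descending_chain R P0 k Q" "n \<le> k" "0 < n" for k Q
    using that
  proof (induction k arbitrary: n Q)
    case (Suc k)
    show ?case
    proof (cases "n = Suc k")
      case False
      obtain m where m: "n = Suc m" using Suc.prems by (cases n) auto
      obtain Q' where Q': "Q' \<subset> Q" "descending_chain R P0 k Q'" "primeideal Q R" using Suc.prems by auto
      show ?thesis
      proof (cases m)
        case 0
        then show ?thesis using Q' m descending_chain_bot[OF Q'(2)] by auto
      next
        case (Suc j)
        then have "descending_chain R P0 m Q'" using Suc.IH[OF Q'(2), of m] m \<open>n \<le> Suc k\<close> False by auto
        then show ?thesis using Q' m by auto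
      qed
    qed (use Suc.prems in simp)
  qed simp
  show ?thesis
  proof (cases "n = 0")
    case True
    then have "P = P0" using assms by simp
    then show ?thesis using that[of "[]"] True P0 by (simp add: subset_antisym)
  next
    case False
    then show ?thesis using that[OF as(1,2)] as(3) shorten by blast
  qed
qed

end

section \<open>Independence of parameters\<close>

context cring
begin

definition power_product :: "(nat \<Rightarrow> 'a) \<Rightarrow> nat \<Rightarrow> (nat \<Rightarrow> nat) \<Rightarrow> 'a" where
  "power_product a n m = (\<Otimes>i\<in>{..<n}. a i [^] m i)"

lemma power_product_closed:
  "(\<And>i. i < n \<Longrightarrow> a i \<in> carrier R) \<Longrightarrow> power_product a n m \<in> carrier R"
  unfolding power_product_def by (intro finprod_closed) auto

lemma power_product_0: "power_product a 0 m = \<one>"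
  by (simp add: power_product_def)

lemma power_product_Suc:
  assumes "\<And>i. i < Suc n \<Longrightarrow> a i \<in> carrier R"
  shows "power_product a (Suc n) m = a n [^] m n \<otimes> power_product a n m"
  unfolding power_product_def lessThan_Suc
  using assms by (intro finprod_insert) auto

lemma power_product_add:
  assumes "\<And>i. i < n \<Longrightarrow> a i \<in> carrier R"
  shows "power_product a n (\<lambda>i. m i + k i) = power_product a n m \<otimes> power_product a n k"
  using assms
proof (induction n)
  case (Suc n)
  have c: "a n \<in> carrier R" "power_product a n m \<in> carrier R" "power_product a n k \<in> carrier R"
    using Suc.prems power_product_closed by auto
  then show ?case
    using Suc by (simp add: power_product_Suc nat_pow_mult[symmetric] m_ac)
qed (simp add: power_product_0)

lemma ideal_cong_mult:
  assumes J: "ideal J R" and c: "x \<in> carrier R" "y \<in> carrier R" "u \<in> carrier R" "v \<in> carrier R"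
    and "x \<ominus> y \<in> J" "u \<ominus> v \<in> J"
  shows "x \<otimes> u \<ominus> y \<otimes> v \<in> J"
proof -
  have "x \<otimes> u \<ominus> y \<otimes> v = u \<otimes> (x \<ominus> y) \<oplus> y \<otimes> (u \<ominus> v)"
    using c by algebra
  then show ?thesis using assms ideal_add[OF J] ideal_mult[OF J] by simp
qed

lemma ideal_cong_pow:
  assumes J: "ideal J R" and c: "x \<in> carrier R" "y \<in> carrier R" and "x \<ominus> y \<in> J"
  shows "x [^] (k::nat) \<ominus> y [^] k \<in> J"
proof (induction k)
  case 0
  then show ?case using ideal_zero[OF J] by (simp add: r_neg minus_eq)
next
  case (Suc k)
  then show ?case using assms ideal_cong_mult[OF J, of "x [^] k" "y [^] k" x y] by simp
qed

lemma ideal_cong_adjoin: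
  assumes "ideal J R" "x \<in> carrier R" "y \<in> carrier R" "x \<ominus> y \<in> J"
  shows "x \<in> adjoin_element J y"
proof -
  have "x = (x \<ominus> y) \<oplus> \<one> \<otimes> y" using assms by algebra
  then show ?thesis using assms unfolding adjoin_element_def by blast
qed

text \<open>The \<open>k\<close>-th term of the filtration in which \<open>a i\<close> has weight
  \<open>w i\<close>. Power products of the \<open>a i\<close> may satisfy relations, so the weight
  is attached to ideals and not to elements.\<close>

definition weighted_ideal :: "(nat \<Rightarrow> 'a) \<Rightarrow> nat \<Rightarrow> (nat \<Rightarrow> nat) \<Rightarrow> nat \<Rightarrow> 'a set" where
  "weighted_ideal a n w k = genideal R {power_product a n m | m. k \<le> (\<Sum>i<n. w i * m i)}"

context
  fixes a :: "nat \<Rightarrow> 'a" and n :: nat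
  assumes a: "\<And>i. i < n \<Longrightarrow> a i \<in> carrier R"
begin

lemma weighted_ideal_gens: "{power_product a n m | m. k \<le> (\<Sum>i<n. w i * m i)} \<subseteq> carrier R"
  using power_product_closed[OF a] by auto

lemma weighted_ideal_ideal: "ideal (weighted_ideal a n w k) R"
  unfolding weighted_ideal_def by (rule genideal_ideal[OF weighted_ideal_gens])

lemma power_product_in_weighted_ideal:
  "k \<le> (\<Sum>i<n. w i * m i) \<Longrightarrow> power_product a n m \<in> weighted_ideal a n w k"
  unfolding weighted_ideal_def using genideal_self[OF weighted_ideal_gens] by blast

lemma weighted_ideal_least:
  assumes "ideal I R" "\<And>m. k \<le> (\<Sum>i<n. w i * m i) \<Longrightarrow> power_product a n m \<in> I"
  shows "weighted_ideal a n w k \<subseteq> I"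
  unfolding weighted_ideal_def using assms by (intro genideal_minimal) auto

lemma colon_ideal:
  assumes "ideal I R" "x \<in> carrier R"
  shows "ideal {y \<in> carrier R. x \<otimes> y \<in> I} R"
  using assms by (intro idealI') (auto simp: ideal_zero r_distr ideal_add m_lcomm[of x] ideal_mult)

text \<open>Membership is tested on generators of each factor in turn, because the elements that
  multiply a given one into an ideal form an ideal.\<close>

lemma weighted_ideal_mult:
  assumes x: "x \<in> weighted_ideal a n w k" and y: "y \<in> weighted_ideal a n w l"
  shows "x \<otimes> y \<in> weighted_ideal a n w (k + l)"
proof -
  have yc: "y \<in> carrier R" using y ideal_subset[OF weighted_ideal_ideal] by blast
  have *: "power_product a n m \<otimes> y \<in> weighted_ideal a n w (k + l)"
    if m: "k \<le> (\<Sum>i<n. w i * m i)" for m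
  proof -
    have "weighted_ideal a n w l \<subseteq>
        {y \<in> carrier R. power_product a n m \<otimes> y \<in> weighted_ideal a n w (k + l)}"
    proof (rule weighted_ideal_least[OF colon_ideal[OF weighted_ideal_ideal power_product_closed[OF a]]])
      fix m' assume "l \<le> (\<Sum>i<n. w i * m' i)"
      then have "power_product a n (\<lambda>i. m i + m' i) \<in> weighted_ideal a n w (k + l)"
        using m by (intro power_product_in_weighted_ideal) (simp add: sum.distrib add_mult_distrib2)
      then show "power_product a n m' \<in>
          {y \<in> carrier R. power_product a n m \<otimes> y \<in> weighted_ideal a n w (k + l)}"
        using power_product_closed[OF a] power_product_add[OF a] by simp
    qed
    then show ?thesis using y by auto
  qed
  have "weighted_ideal a n w k \<subseteq> {x \<in> carrier R. y \<otimes> x \<in> weighted_ideal a n w (k + l)}"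
  proof (rule weighted_ideal_least[OF colon_ideal[OF weighted_ideal_ideal yc]])
    fix m assume m: "k \<le> (\<Sum>i<n. w i * m i)"
    show "power_product a n m \<in> {x \<in> carrier R. y \<otimes> x \<in> weighted_ideal a n w (k + l)}"
      using *[OF m] power_product_closed[OF a] yc by (simp add: m_comm)
  qed
  then show ?thesis using x yc by (auto simp: m_comm)
qed

lemma weighted_ideal_pow:
  assumes x: "x \<in> weighted_ideal a n w k"
  shows "x [^] (e::nat) \<in> weighted_ideal a n w (e * k)"
proof (induction e)
  case 0
  have "power_product a n (\<lambda>_. 0) \<in> weighted_ideal a n w 0"
    by (rule power_product_in_weighted_ideal) simp
  moreover have "power_product a n (\<lambda>_. 0) = \<one>"
    unfolding power_product_def by (simp add: finprod_one_eqI)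
  ultimately show ?case by simp
next
  case (Suc e)
  then show ?case using weighted_ideal_mult[OF Suc x] by (simp add: add.commute)
qed

text \<open>Modulo \<open>J\<close> every \<open>a i\<close> is an \<open>e i\<close>-th root of \<open>\<beta>\<close>.\<close>

lemma weighted_ideal_subset_adjoin:
  assumes J: "ideal J R" and b: "\<beta> \<in> carrier R"
    and cong: "\<And>i. i < n \<Longrightarrow> a i [^] e i \<ominus> \<beta> \<in> J"
    and we: "\<And>i. i < n \<Longrightarrow> w i * e i = W" and W: "W > 0"
    and k: "(q + n) * W \<le> k"
  shows "weighted_ideal a n w k \<subseteq> adjoin_element J (\<beta> [^] q)"
proof (rule weighted_ideal_least)
  show "ideal (adjoin_element J (\<beta> [^] q)) R" using b by (intro adjoin_element_ideal J) simp
  fix m assume m: "k \<le> (\<Sum>i<n. w i * m i)"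
  have pos: "e i > 0" "w i > 0" if "i < n" for i using we[OF that] W by (auto intro: gr0I)
  \<comment> \<open>Division of each \<open>m i\<close> by \<open>e i\<close> splits off a power of
    \<open>\<beta>\<close> modulo \<open>J\<close>; the remainder of the exponent goes into the
    coefficient.\<close>
  have "power_product a l m \<in> adjoin_element J (\<beta> [^] (\<Sum>i<l. m i div e i))" if "l \<le> n" for l
    using that
  proof (induction l)
    case 0
    then show ?case using mem_adjoin_element[OF J, of \<one>] by (simp add: power_product_0)
  next
    case (Suc l)
    define s where "s = (\<Sum>i<l. m i div e i)"
    define t where "t = m l div e l"
    have al: "a l \<in> carrier R" using a Suc by auto
    obtain j r where jr: "power_product a l m = j \<oplus> r \<otimes> \<beta> [^] s" "j \<in> J" "r \<in> carrier R"
      using Suc by (auto simp: adjoin_element_def s_def)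
    have "(a l [^] e l) [^] t \<in> adjoin_element J (\<beta> [^] t)"
      using Suc.prems al b cong by (intro ideal_cong_adjoin ideal_cong_pow J) auto
    then obtain j' r' where j'r': "(a l [^] e l) [^] t = j' \<oplus> r' \<otimes> \<beta> [^] t" "j' \<in> J" "r' \<in> carrier R"
      by (auto simp: adjoin_element_def)
    have "a l [^] m l = a l [^] (m l mod e l) \<otimes> (a l [^] e l) [^] t"
      using al by (simp add: nat_pow_pow nat_pow_mult t_def)
    then have "power_product a (Suc l) m = (a l [^] (m l mod e l) \<otimes> (j' \<oplus> r' \<otimes> \<beta> [^] t)) \<otimes> (j \<oplus> r \<otimes> \<beta> [^] s)"
      using power_product_Suc[of l a m] a Suc.prems jr j'r' by simp
    also have "\<dots> = (a l [^] (m l mod e l) \<otimes> (j \<oplus> r \<otimes> \<beta> [^] s) \<otimes> j' \<oplus> a l [^] (m l mod e l) \<otimes> r' \<otimes> \<beta> [^] t \<otimes> j)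
        \<oplus> (a l [^] (m l mod e l) \<otimes> r' \<otimes> r) \<otimes> (\<beta> [^] s \<otimes> \<beta> [^] t)"
    proof -
      have "\<And>x y z u v p p'. \<lbrakk>x \<in> carrier R; y \<in> carrier R; z \<in> carrier R; u \<in> carrier R; v \<in> carrier R;
         p \<in> carrier R; p' \<in> carrier R\<rbrakk> \<Longrightarrow>
         (x \<otimes> (y \<oplus> z \<otimes> p)) \<otimes> (u \<oplus> v \<otimes> p') = (x \<otimes> (u \<oplus> v \<otimes> p') \<otimes> y \<oplus> x \<otimes> z \<otimes> p \<otimes> u)
          \<oplus> (x \<otimes> z \<otimes> v) \<otimes> (p' \<otimes> p)"
        by (simp add: r_distr l_distr m_ac a_ac)
      then show ?thesis using al b jr j'r' ideal_subset[OF J] by (meson nat_pow_closed subset_iff)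
    qed
    finally have "power_product a (Suc l) m = (a l [^] (m l mod e l) \<otimes> (j \<oplus> r \<otimes> \<beta> [^] s) \<otimes> j' \<oplus> a l [^] (m l mod e l) \<otimes> r' \<otimes> \<beta> [^] t \<otimes> j)
        \<oplus> (a l [^] (m l mod e l) \<otimes> r' \<otimes> r) \<otimes> (\<beta> [^] (\<Sum>i<Suc l. m i div e i))"
      using b by (simp add: nat_pow_mult s_def t_def)
    moreover have "a l [^] (m l mod e l) \<otimes> (j \<oplus> r \<otimes> \<beta> [^] s) \<otimes> j' \<oplus> a l [^] (m l mod e l) \<otimes> r' \<otimes> \<beta> [^] t \<otimes> j \<in> J"
    proof -
      have "j \<in> carrier R" using jr ideal_subset[OF J] by auto
      then show ?thesis using al b jr j'r' by (intro ideal_add[OF J] ideal_mult[OF J]) auto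
    qed
    moreover have "a l [^] (m l mod e l) \<otimes> r' \<otimes> r \<in> carrier R" using al jr j'r' by simp
    ultimately show ?case unfolding adjoin_element_def by blast
  qed
  then have *: "power_product a n m \<in> adjoin_element J (\<beta> [^] (\<Sum>i<n. m i div e i))" by simp
  define s where "s = (\<Sum>i<n. m i div e i)"
  \<comment> \<open>Rounding down costs at most \<open>W\<close> in each coordinate and
    \<open>n * W\<close> in all, hence the summand \<open>n\<close> in the bound on
    \<open>k\<close>.\<close>
  have "w i * m i \<le> W * (m i div e i) + W" if "i < n" for i
  proof -
    have "m i = e i * (m i div e i) + m i mod e i" by simp
    also have "\<dots> \<le> e i * (m i div e i) + e i" using mod_less_divisor[OF pos(1)[OF that], of "m i"] by linarith
    finally have "w i * m i \<le> w i * (e i * (m i div e i) + e i)" by (rule mult_le_mono2)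
    then show ?thesis using we[OF that] by (simp add: add_mult_distrib2 mult.assoc[symmetric])
  qed
  then have "(\<Sum>i<n. w i * m i) \<le> (\<Sum>i<n. W * (m i div e i) + W)" by (intro sum_mono) simp
  also have "\<dots> = W * s + n * W" by (simp add: sum.distrib sum_distrib_left s_def)
  finally have "(q + n) * W \<le> W * s + n * W" using k m by linarith
  then have "q * W \<le> s * W" using add_mult_distrib[of q n W] mult.commute[of W s] by linarith
  then have "q \<le> s" using W by simp
  then have "\<beta> [^] s = \<beta> [^] (s - q) \<otimes> \<beta> [^] q" using b by (simp add: nat_pow_mult)
  then have "\<beta> [^] s \<in> adjoin_element J (\<beta> [^] q)"
    using ideal_mult[OF adjoin_element_ideal[OF J] mem_adjoin_element[OF J], of "\<beta> [^] q" "\<beta> [^] (s - q)"] b by simp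
  then have "adjoin_element J (\<beta> [^] s) \<subseteq> adjoin_element J (\<beta> [^] q)"
    using b by (intro adjoin_element_least adjoin_element_ideal subset_adjoin_element J) auto
  then show "power_product a n m \<in> adjoin_element J (\<beta> [^] q)" using * by (auto simp: s_def)
qed

end

end

text \<open>The elements \<open>b i = a i [^] e i\<close> all have weight \<open>W\<close>. If a power product lay in the ideal of
  higher weight, then modulo the \<open>n - 1\<close> elements \<open>b i - b 0\<close> a power of \<open>b 0\<close> would be a multiple
  of a higher power of \<open>b 0\<close>, so \<open>P\<close> would be minimal over these \<open>n - 1\<close> elements.\<close>

lemma (in noetherian_cring) parameters_weighted_independent:
  assumes chain: "descending_chain R P0 n P" and n: "n > 0"
    and aP: "\<And>i. i < n \<Longrightarrow> a i \<in> P"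
    and min: "\<And>Q. \<lbrakk>primeideal Q R; P0 \<subseteq> Q; \<And>i. i < n \<Longrightarrow> a i \<in> Q; Q \<subseteq> P\<rbrakk> \<Longrightarrow> Q = P"
    and w: "\<And>i. i < n \<Longrightarrow> w i > 0"
  shows "power_product a n m \<notin> weighted_ideal a n w (Suc (\<Sum>i<n. w i * m i))"
proof
  assume rel: "power_product a n m \<in> weighted_ideal a n w (Suc (\<Sum>i<n. w i * m i))"
  have P: "primeideal P R" and P0: "primeideal P0 R" and P0P: "P0 \<subseteq> P"
    using chain descending_chain_prime descending_chain_bot by blast+
  note Pc = ideal_subset[OF prime_ideal[OF P]]
  have a: "a i \<in> carrier R" if "i < n" for i using aP[OF that] Pc by auto
  \<comment> \<open>A common multiple of the weights, so that every \<open>a i [^] e i\<close>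
    receives the same weight \<open>W\<close>.\<close>
  define W where "W = (\<Prod>i<n. w i)"
  define e where "e i = W div w i" for i
  have W: "W > 0" using w by (auto simp: W_def intro: prod_pos)
  have we: "w i * e i = W" if "i < n" for i
    using that by (simp add: e_def W_def dvd_prodI dvd_mult_div_cancel)
  have e: "e i > 0" if "i < n" for i using we[OF that] W by (auto intro: gr0I)
  define \<beta> where "\<beta> = a 0 [^] e 0"
  have bc: "\<beta> \<in> carrier R" using a n by (simp add: \<beta>_def)
  \<comment> \<open>Index \<open>0\<close> would contribute zero and is left out. This leaves at
    most \<open>n - 1\<close> elements, one too few for the height theorem.\<close>
  define S where "S = (\<lambda>i. a i [^] e i \<ominus> \<beta>) ` {1..<n}"
  have Sc: "P0 \<union> S \<subseteq> carrier R" using a bc ideal_subset[OF prime_ideal[OF P0]] by (auto simp: S_def)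
  define J where "J = genideal R (P0 \<union> S)"
  have J: "ideal J R" unfolding J_def by (rule genideal_ideal[OF Sc])
  have SJ: "P0 \<union> S \<subseteq> J" unfolding J_def by (rule genideal_self[OF Sc])
  have cong: "a i [^] e i \<ominus> \<beta> \<in> J" if "i < n" for i
  proof (cases "i = 0")
    case True
    then have "a i [^] e i \<ominus> \<beta> = \<zero>" using bc by (simp add: \<beta>_def)
    then show ?thesis using ideal_zero[OF J] by simp
  next
    case False
    then have "a i [^] e i \<ominus> \<beta> \<in> S" using that by (auto simp: S_def)
    then show ?thesis using SJ by auto
  qed
  \<comment> \<open>Large enough for \<open>N * e i\<close> to dominate \<open>m i\<close>. The
    product \<open>h\<close> with these exponents is a multiple of the given one, still lies in the
    ideal of weight one above its own, and is congruent to \<open>\<beta> [^] (n * N)\<close> modulo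
    \<open>J\<close>.\<close>
  define N where "N = (\<Sum>i<n. m i)"
  have mN: "m i \<le> N * e i" if "i < n" for i
  proof -
    have "m i \<le> N" unfolding N_def using that by (intro member_le_sum) auto
    also have "\<dots> \<le> N * e i" using e[OF that] by simp
    finally show ?thesis .
  qed
  define M where "M i = N * e i" for i
  define h where "h = power_product a n M"
  have wM: "(\<Sum>i<n. w i * M i) = n * (N * W)"
    using we by (simp add: M_def mult.left_commute)
  have "power_product a n (\<lambda>i. M i - m i) \<otimes> power_product a n m
      \<in> weighted_ideal a n w ((\<Sum>i<n. w i * (M i - m i)) + Suc (\<Sum>i<n. w i * m i))"
    by (intro weighted_ideal_mult a rel power_product_in_weighted_ideal) simp_all
  moreover have "power_product a n (\<lambda>i. M i - m i) \<otimes> power_product a n m = h"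
  proof -
    have "power_product a n (\<lambda>i. M i - m i) \<otimes> power_product a n m = power_product a n (\<lambda>i. M i - m i + m i)"
      using power_product_add[OF a] by simp
    also have "\<dots> = h" unfolding h_def power_product_def
      using mN a by (intro finprod_cong) (auto simp: M_def)
    finally show ?thesis .
  qed
  moreover have "(\<Sum>i<n. w i * (M i - m i)) + Suc (\<Sum>i<n. w i * m i) = Suc (n * (N * W))"
  proof -
    have "(\<Sum>i<n. w i * (M i - m i)) + (\<Sum>i<n. w i * m i) = (\<Sum>i<n. w i * M i)"
      unfolding sum.distrib[symmetric] using mN
      by (intro sum.cong) (auto simp: M_def add_mult_distrib2[symmetric])
    then show ?thesis using wM by simp
  qed
  ultimately have hI: "h \<in> weighted_ideal a n w (Suc (n * (N * W)))" by simp
  \<comment> \<open>The power \<open>E\<close> multiplies the excess weight one of \<open>h\<close>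
    to \<open>(n + 1) * W\<close>: rounding consumes \<open>n * W\<close>, and the remaining
    \<open>W\<close> pays for one additional factor \<open>\<beta>\<close>.\<close>
  define E where "E = (n + 1) * W"
  have "h [^] E \<in> weighted_ideal a n w (E * Suc (n * (N * W)))"
    by (rule weighted_ideal_pow[OF a hI])
  moreover have "weighted_ideal a n w (E * Suc (n * (N * W))) \<subseteq> adjoin_element J (\<beta> [^] (n * N * E + 1))"
    by (rule weighted_ideal_subset_adjoin[OF a J bc cong we W])
      (simp_all add: E_def algebra_simps)
  ultimately have hE: "h [^] E \<in> adjoin_element J (\<beta> [^] (n * N * E + 1))" by blast
  have hc: "h \<in> carrier R" unfolding h_def by (rule power_product_closed[OF a])
  have "power_product a l M \<ominus> \<beta> [^] (l * N) \<in> J" if "l \<le> n" for l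
    using that
  proof (induction l)
    case 0
    then show ?case using ideal_zero[OF J] by (simp add: power_product_0 minus_eq r_neg)
  next
    case (Suc l)
    have al: "a l \<in> carrier R" using a Suc by auto
    have "a l [^] M l \<ominus> \<beta> [^] N \<in> J"
      using ideal_cong_pow[OF J _ bc cong[of l], of N] al Suc.prems
      by (simp add: nat_pow_pow M_def mult.commute)
    then have "a l [^] M l \<otimes> power_product a l M \<ominus> \<beta> [^] N \<otimes> \<beta> [^] (l * N) \<in> J"
      using Suc al bc a by (intro ideal_cong_mult J power_product_closed) auto
    then show ?case using power_product_Suc[of l a M] a Suc.prems bc by (simp add: nat_pow_mult)
  qed
  then have "h \<ominus> \<beta> [^] (n * N) \<in> J" by (simp add: h_def)
  then have "h [^] E \<ominus> (\<beta> [^] (n * N)) [^] E \<in> J"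
    using hc bc by (intro ideal_cong_pow J) auto
  then have hb: "h [^] E \<ominus> \<beta> [^] (n * N * E) \<in> J" using bc by (simp add: nat_pow_pow)
  obtain j r where jr: "h [^] E = j \<oplus> r \<otimes> \<beta> [^] (n * N * E + 1)" "j \<in> J" "r \<in> carrier R"
    using hE by (auto simp: adjoin_element_def)
  define c where "c = \<beta> [^] (n * N * E)"
  have cc: "c \<in> carrier R" using bc by (simp add: c_def)
  have rc: "r \<in> carrier R" by (rule jr(3))
  have jc: "j \<in> carrier R" using jr ideal_subset[OF J] by auto
  \<comment> \<open>Modulo \<open>J\<close>, the power \<open>h [^] E\<close> is congruent to
    \<open>c\<close> and also to a multiple of \<open>c \<otimes> \<beta>\<close>. The resulting
    factor \<open>\<one> \<ominus> r \<otimes> \<beta>\<close> is outside \<open>P\<close>, so a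
    prime inside \<open>P\<close> that contains the product contains \<open>c\<close>.\<close>
  have "c \<otimes> (\<one> \<ominus> r \<otimes> \<beta>) = j \<ominus> (h [^] E \<ominus> c)"
  proof -
    have "h [^] E = j \<oplus> r \<otimes> (c \<otimes> \<beta>)" using jr(1) bc by (simp add: c_def)
    then have "j \<ominus> (h [^] E \<ominus> c) = j \<ominus> ((j \<oplus> r \<otimes> (c \<otimes> \<beta>)) \<ominus> c)" by simp
    also have "\<dots> = c \<otimes> (\<one> \<ominus> r \<otimes> \<beta>)"
      using jc cc bc rc by algebra
    finally show ?thesis by simp
  qed
  also have "\<dots> \<in> J" using jr hb ideal_minus[OF J] by (simp add: c_def)
  finally have main: "c \<otimes> (\<one> \<ominus> r \<otimes> \<beta>) \<in> J" .
  have bP: "\<beta> \<in> P"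
    using aP[OF n] e[OF n] a[OF n] ideal_mult[OF prime_ideal[OF P]]
    by (cases "e 0") (auto simp: \<beta>_def)
  have "n \<le> card S"
  proof (rule height_theorem[OF chain])
    show "finite S" by (simp add: S_def)
    have biP: "a i [^] e i \<in> P" if "i < n" for i
      using aP[OF that] e[OF that] a[OF that] ideal_mult[OF prime_ideal[OF P]]
      by (cases "e i") auto
    then show "S \<subseteq> P" using bP ideal_minus[OF prime_ideal[OF P]] by (auto simp: S_def)
    fix Q assume Q: "primeideal Q R" "P0 \<subseteq> Q" "S \<subseteq> Q" "Q \<subseteq> P"
    have JQ: "J \<subseteq> Q" unfolding J_def using Q by (intro genideal_minimal prime_ideal) auto
    have "\<one> \<ominus> r \<otimes> \<beta> \<notin> Q"
    proof
      assume "\<one> \<ominus> r \<otimes> \<beta> \<in> Q"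
      then have "(\<one> \<ominus> r \<otimes> \<beta>) \<oplus> r \<otimes> \<beta> \<in> P"
        using Q bP jr ideal_add[OF prime_ideal[OF P]] ideal_mult[OF prime_ideal[OF P]] by blast
      moreover have "(\<one> \<ominus> r \<otimes> \<beta>) \<oplus> r \<otimes> \<beta> = \<one>"
        using bc rc by algebra
      ultimately show False using prime_one[OF P] by simp
    qed
    then have "c \<in> Q" using prime_mult[OF Q(1), of c "\<one> \<ominus> r \<otimes> \<beta>"] main JQ cc bc jr by auto
    then have bQ: "\<beta> \<in> Q" using prime_pow[OF Q(1)] bc by (simp add: c_def)
    have "a i \<in> Q" if "i < n" for i
    proof -
      have "(a i [^] e i \<ominus> \<beta>) \<oplus> \<beta> \<in> Q"
        using cong[OF that] JQ bQ ideal_add[OF prime_ideal[OF Q(1)]] by blast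
      moreover have "(a i [^] e i \<ominus> \<beta>) \<oplus> \<beta> = a i [^] e i"
        using a[OF that] bc by (simp add: minus_eq a_assoc l_neg)
      ultimately show ?thesis using prime_pow[OF Q(1)] a[OF that] by simp
    qed
    then show "Q = P" using min Q by blast
  qed
  also have "card S \<le> n - 1" unfolding S_def using card_image_le[of "{1..<n}"] by simp
  finally show False using n by simp
qed

text \<open>Gordan's alternative, by Fourier-Motzkin elimination of the last coordinate.\<close>

lemma exists_positive_weights:
  fixes V :: "(nat \<Rightarrow> int) set"
  assumes "finite V" "\<And>v. v \<in> V \<Longrightarrow> Pos v"
    and "\<And>u v. \<lbrakk>Pos u; Pos v\<rbrakk> \<Longrightarrow> Pos (\<lambda>i. u i + v i)"
    and "\<And>v. Pos v \<Longrightarrow> \<exists>i<n. v i \<noteq> 0"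
  shows "\<exists>w::nat \<Rightarrow> int. \<forall>v\<in>V. 0 < (\<Sum>i<n. w i * v i)"
  using assms
proof (induction n arbitrary: V Pos)
  case 0
  then show ?case by force
next
  case (Suc n)
  \<comment> \<open>Elimination takes combinations with positive integral coefficients, which
    repeated addition provides.\<close>
  have scale: "Pos (\<lambda>i. k * v i)" if "Pos v" "k > 0" for v and k :: int
  proof -
    have "Pos (\<lambda>i. int (Suc j) * v i)" for j
    proof (induction j)
      case (Suc j)
      then show ?case using Suc.prems \<open>Pos v\<close> \<open>\<And>u v. \<lbrakk>Pos u; Pos v\<rbrakk> \<Longrightarrow> Pos (\<lambda>i. u i + v i)\<close>[OF \<open>Pos v\<close> Suc]
        by (simp add: algebra_simps)
    qed (use that in simp)
    from this[of "nat (k - 1)"] show ?thesis using that by simp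
  qed
  \<comment> \<open>For \<open>p n > 0\<close> and \<open>q n < 0\<close>, the positive combination
    in which coordinate \<open>n\<close> cancels.\<close>
  define comb where "comb = (\<lambda>(p, q) i. (- q n) * p i + p n * q i :: int)"
  define Vp where "Vp = {v \<in> V. v n > 0}"
  define Vm where "Vm = {v \<in> V. v n < 0}"
  define V' where "V' = {v \<in> V. v n = 0} \<union> comb ` (Vp \<times> Vm)"
  have "\<exists>w::nat \<Rightarrow> int. \<forall>v\<in>V'. 0 < (\<Sum>i<n. w i * v i)"
  proof (rule Suc.IH[of V' "\<lambda>v. Pos v \<and> v n = 0"])
    show "finite V'" using Suc.prems(1) by (simp add: V'_def Vp_def Vm_def)
    show "Pos v \<and> v n = 0" if "v \<in> V'" for v
    proof -
      have "Pos (comb (p, q)) \<and> comb (p, q) n = 0" if "p \<in> Vp" "q \<in> Vm" for p q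
        using that Suc.prems(2) Suc.prems(3)[OF scale scale, of p "- q n" q "p n"]
        by (auto simp: comb_def Vp_def Vm_def)
      then show ?thesis using that Suc.prems(2) by (auto simp: V'_def)
    qed
    show "\<exists>i<n. v i \<noteq> 0" if "Pos v \<and> v n = 0" for v
      using Suc.prems(4)[of v] that less_Suc_eq by auto
  qed (use Suc.prems(3) in auto)
  then obtain w :: "nat \<Rightarrow> int" where w: "\<And>v. v \<in> V' \<Longrightarrow> 0 < (\<Sum>i<n. w i * v i)" by blast
  define L where "L v = (\<Sum>i<n. w i * v i)" for v
  have Lcomb: "0 < (- q n) * L p + p n * L q" if "p \<in> Vp" "q \<in> Vm" for p q
  proof -
    have "0 < L (comb (p, q))" using w[of "comb (p, q)"] that by (auto simp: V'_def L_def)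
    also have "L (comb (p, q)) = (- q n) * L p + p n * L q"
      by (simp add: L_def comb_def sum_distrib_left algebra_simps sum.distrib sum_negf sum_subtractf)
    finally show ?thesis .
  qed
  \<comment> \<open>With the other weights fixed, the condition \<open>0 < L v + s * v n\<close>
    bounds the last weight \<open>s\<close> from one side. By \<open>Lcomb\<close> every lower bound
    is smaller than every upper bound.\<close>
  define lb where "lb p = (- of_int (L p) / of_int (p n) :: rat)" for p
  define ub where "ub q = (of_int (L q) / of_int (- q n) :: rat)" for q
  define lo where "lo = lb ` Vp"
  define hi where "hi = ub ` Vm"
  have "finite Vp" "finite Vm"
    unfolding Vp_def Vm_def by (rule finite_subset[OF _ Suc.prems(1)], auto)+
  then have fin: "finite lo" "finite hi" by (simp_all add: lo_def hi_def)
  have lohi: "a < b" if ab: "a \<in> lo" "b \<in> hi" for a b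
  proof -
    obtain p q where pq: "p \<in> Vp" "q \<in> Vm" "a = lb p" "b = ub q"
      using ab by (auto simp: lo_def hi_def)
    have "p n > 0" "- q n > 0" using pq(1,2) by (simp_all add: Vp_def Vm_def)
    then have pos: "(of_int (p n) :: rat) > 0" "(of_int (- q n) :: rat) > 0"
      by (simp_all only: of_int_0_less_iff)
    have "(0::rat) < of_int ((- q n) * L p + p n * L q)" using Lcomb[OF pq(1,2)] by (simp only: of_int_0_less_iff)
    then have *: "- of_int (L p) * of_int (- q n) < (of_int (L q) * of_int (p n) :: rat)"
      by (simp add: algebra_simps)
    show ?thesis unfolding pq(3,4) lb_def ub_def
      using * pos
      by (simp only: divide_less_eq pos_less_divide_eq if_True times_divide_eq_left)
  qed
  obtain s where s: "\<forall>a\<in>lo. a < s" "\<forall>b\<in>hi. s < b"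
  proof (cases "lo = {} \<or> hi = {}")
    case True
    show ?thesis
    proof (cases "lo = {}")
      case True
      show ?thesis
      proof (cases "hi = {}")
        case False
        have "Min hi - 1 < b" if "b \<in> hi" for b
          using Min_le[OF fin(2) that] by linarith
        then show ?thesis using that[of "Min hi - 1"] True by auto
      qed (use that[of 0] True in auto)
    next
      case False
      have "a < Max lo + 1" if "a \<in> lo" for a
        using Max_ge[OF fin(1) that] by linarith
      then show ?thesis using that[of "Max lo + 1"] True False by auto
    qed
  next
    case False
    then have "Max lo < Min hi" using fin lohi by simp
    then obtain s where "Max lo < s" "s < Min hi" using dense by blast
    then show ?thesis using that[of s] False fin by simp
  qed
  \<comment> \<open>Clearing the denominator of \<open>s\<close> makes the weights integral:
    \<open>b * w i\<close> below \<open>n\<close>, and \<open>a\<close> at \<open>n\<close>.\<close>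
  obtain a b where ab: "quotient_of s = (a, b)" by fastforce
  have b: "b > 0" using quotient_of_denom_pos[OF ab] .
  have sab: "s = of_int a / of_int b" using quotient_of_div[OF ab] .
  have "0 < b * L v + a * v n" if "v \<in> V" for v
  proof -
    have "(0::rat) < of_int (L v) + s * of_int (v n)"
    proof (cases "v n" "0::int" rule: linorder_cases)
      case less
      then have "v \<in> Vm" using that by (simp add: Vm_def)
      then have "s < of_int (L v) / of_int (- v n)" using s(2) unfolding hi_def ub_def by blast
      moreover have "(of_int (- v n) :: rat) > 0" using less by simp
      ultimately have "s * of_int (- v n) < of_int (L v)" by (simp only: less_divide_eq if_True)
      then show ?thesis by simp
    next
      case equal
      then have "v \<in> V'" using that by (simp add: V'_def)
      then have "0 < L v" using w by (simp add: L_def)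
      then show ?thesis using equal by simp
    next
      case greater
      then have "v \<in> Vp" using that by (simp add: Vp_def)
      then have "- of_int (L v) / of_int (v n) < s" using s(1) unfolding lo_def lb_def by blast
      moreover have "(of_int (v n) :: rat) > 0" using greater by simp
      ultimately have "- of_int (L v) < s * of_int (v n)" by (simp only: divide_less_eq if_True)
      then show ?thesis by simp
    qed
    then have "(0::rat) < of_int b * (of_int (L v) + s * of_int (v n))" using b by simp
    also have "\<dots> = of_int (b * L v + a * v n)" using b by (simp add: sab field_simps)
    finally show ?thesis by (simp only: of_int_0_less_iff)
  qed
  moreover have "(\<Sum>i<Suc n. ((\<lambda>i. b * w i)(n := a)) i * v i) = b * L v + a * v n" for v
    by (simp add: L_def sum_distrib_left mult.assoc)
  ultimately show ?case by (intro exI[of _ "(\<lambda>i. b * w i)(n := a)"]) simp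
qed

text \<open>Exponent differences of strictly increasing pairs are closed under addition and never
  vanish, which is what Gordan's alternative requires. Only finitely many comparisons are imposed,
  so integral weights exist even for orderings that no single weight vector represents.\<close>

lemma monomial_ordering_weights:
  assumes ord: "monomial_ordering ord" and m: "set_mset m \<subseteq> {..<n}"
    and F: "finite F" "\<And>t. t \<in> F \<Longrightarrow> (m, t) \<in> ord \<and> t \<noteq> m \<and> set_mset t \<subseteq> {..<n}"
  obtains w :: "nat \<Rightarrow> nat" where "\<And>i. i < n \<Longrightarrow> w i > 0"
    "\<And>t. t \<in> F \<Longrightarrow> (\<Sum>i<n. w i * count m i) < (\<Sum>i<n. w i * count t i)"
proof -
  define vec where "vec = (\<lambda>(s :: monomial, t :: monomial) i. int (count t i) - int (count s i) :: int)"
  define Pos where "Pos v \<longleftrightarrow> (\<exists>s t. (s, t) \<in> ord \<and> s \<noteq> t \<and> set_mset s \<subseteq> {..<n} \<and> set_mset t \<subseteq> {..<n}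
      \<and> v = vec (s, t))" for v
  \<comment> \<open>The second family compares \<open>{#}\<close> with each indeterminate and
    thereby makes the weights positive.\<close>
  define V where "V = vec ` ({m} \<times> F) \<union> vec ` ({{#}} \<times> (\<lambda>i. {#i#}) ` {..<n})"
  have trans: "trans ord" and antisym: "antisym ord" and one: "\<And>s. ({#}, s) \<in> ord"
    and mult: "\<And>s t u. (t, u) \<in> ord \<Longrightarrow> (s + t, s + u) \<in> ord"
    using ord by (auto simp: monomial_ordering_def linear_order_on_def partial_order_on_def preorder_on_def)
  have "\<exists>w::nat \<Rightarrow> int. \<forall>v\<in>V. 0 < (\<Sum>i<n. w i * v i)"
  proof (rule exists_positive_weights[of V Pos n])
    show "finite V" using F by (simp add: V_def)
    show "Pos v" if "v \<in> V" for v
      using that unfolding V_def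
    proof
      assume "v \<in> vec ` ({m} \<times> F)"
      then obtain t where "t \<in> F" "v = vec (m, t)" by auto
      then show ?thesis using F(2)[of t] m unfolding Pos_def by blast
    next
      assume "v \<in> vec ` ({{#}} \<times> (\<lambda>i. {#i#}) ` {..<n})"
      then obtain i where "i < n" "v = vec ({#}, {#i#})" by auto
      then show ?thesis unfolding Pos_def using one[of "{#i#}"]
        by (intro exI[of _ "{#}"] exI[of _ "{#i#}"]) auto
    qed
    show "Pos (\<lambda>i. u i + v i)" if uv: "Pos u" "Pos v" for u v
    proof -
      obtain s t s' t' where *: "(s, t) \<in> ord" "s \<noteq> t" "set_mset s \<subseteq> {..<n}" "set_mset t \<subseteq> {..<n}" "u = vec (s, t)"
        "(s', t') \<in> ord" "s' \<noteq> t'" "set_mset s' \<subseteq> {..<n}" "set_mset t' \<subseteq> {..<n}" "v = vec (s', t')"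
        using uv unfolding Pos_def by blast
      have o: "(s + s', t + s') \<in> ord" "(t + s', t + t') \<in> ord"
        using mult[OF *(1), of s'] mult[OF *(6), of t] by (simp_all add: add.commute)
      have "(s + s', t + t') \<in> ord" using trans o by (rule transD)
      moreover have "s + s' \<noteq> t + t'"
      proof
        assume "s + s' = t + t'"
        then have "s + s' = t + s'" using antisym o by (auto dest: antisymD)
        then show False using *(2) by simp
      qed
      moreover have "(\<lambda>i. u i + v i) = vec (s + s', t + t')" using * by (auto simp: vec_def)
      ultimately show ?thesis unfolding Pos_def using * by (intro exI[of _ "s + s'"] exI[of _ "t + t'"]) auto
    qed
    show "\<exists>i<n. v i \<noteq> 0" if v: "Pos v" for v
    proof (rule ccontr)
      assume no: "\<not> ?thesis"
      obtain s t where *: "s \<noteq> t" "set_mset s \<subseteq> {..<n}" "set_mset t \<subseteq> {..<n}" "v = vec (s, t)"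
        using v unfolding Pos_def by blast
      have "count s i = count t i" for i
      proof (cases "i < n")
        case True
        then show ?thesis using no * by (auto simp: vec_def)
      next
        case False
        then have "i \<notin># s" "i \<notin># t" using *(2,3) by auto
        then show ?thesis by (simp add: not_in_iff)
      qed
      then show False using * by (simp add: multiset_eq_iff)
    qed
  qed
  then obtain w :: "nat \<Rightarrow> int" where w: "\<And>v. v \<in> V \<Longrightarrow> 0 < (\<Sum>i<n. w i * v i)" by blast
  have wpos: "w i > 0" if "i < n" for i
  proof -
    have "vec ({#}, {#i#}) \<in> V" unfolding V_def using that by blast
    then have "0 < (\<Sum>j<n. w j * vec ({#}, {#i#}) j)" by (rule w)
    also have "\<dots> = (\<Sum>j<n. if j = i then w i else 0)"
      by (intro sum.cong) (auto simp: vec_def)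
    also have "\<dots> = w i" using that by simp
    finally show ?thesis .
  qed
  show ?thesis
  proof (rule that[of "\<lambda>i. nat (w i)"])
    show "0 < nat (w i)" if "i < n" for i using wpos[OF that] by simp
    fix t assume "t \<in> F"
    then have "vec (m, t) \<in> V" unfolding V_def by blast
    then have "0 < (\<Sum>i<n. w i * vec (m, t) i)" by (rule w)
    also have "\<dots> = (\<Sum>i<n. w i * int (count t i)) - (\<Sum>i<n. w i * int (count m i))"
      by (simp add: vec_def right_diff_distrib sum_subtractf)
    finally have "(\<Sum>i<n. w i * int (count m i)) < (\<Sum>i<n. w i * int (count t i))" by simp
    moreover have "int (\<Sum>i<n. nat (w i) * count u i) = (\<Sum>i<n. w i * int (count u i))" for u
      unfolding of_nat_sum using wpos by (intro sum.cong) (auto simp: less_imp_le)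
    ultimately have "int (\<Sum>i<n. nat (w i) * count m i) < int (\<Sum>i<n. nat (w i) * count t i)"
      by presburger
    then show "(\<Sum>i<n. nat (w i) * count m i) < (\<Sum>i<n. nat (w i) * count t i)"
      by (simp only: of_nat_less_iff)
  qed
qed

section \<open>Polynomials as coefficient functions of finite support\<close>

context ring
begin

lemma indexed_pset_finite_support:
  assumes "f \<in> indexed_pset I (carrier R)"
  shows "finite {m. f m \<noteq> \<zero>}" "f m \<in> carrier R" "f m \<noteq> \<zero> \<Longrightarrow> set_mset m \<subseteq> I"
proof -
  have "finite {m. f m \<noteq> \<zero>} \<and> (\<forall>m. f m \<in> carrier R) \<and> (\<forall>m. f m \<noteq> \<zero> \<longrightarrow> set_mset m \<subseteq> I)"
    using assms
  proof induction
    case (indexed_const k)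
    have "{m. indexed_const k m \<noteq> \<zero>} \<subseteq> {{#}}" by (auto simp: indexed_const_def)
    then show ?case using indexed_const by (auto simp: indexed_const_def intro: finite_subset)
  next
    case (indexed_padd P Q)
    have "{m. indexed_padd P Q m \<noteq> \<zero>} \<subseteq> {m. P m \<noteq> \<zero>} \<union> {m. Q m \<noteq> \<zero>}"
      by (auto simp: indexed_padd_def)
    then show ?case using indexed_padd
      by (auto simp: indexed_padd_def intro: finite_subset) (metis l_zero r_zero subsetD)+
  next
    case (indexed_pmult P i)
    have "{m. indexed_pmult P i m \<noteq> \<zero>} \<subseteq> (\<lambda>m. add_mset i m) ` {m. P m \<noteq> \<zero>}"
    proof
      fix m assume "m \<in> {m. indexed_pmult P i m \<noteq> \<zero>}"
      then have "i \<in># m" "P (m - {#i#}) \<noteq> \<zero>" by (auto simp: indexed_pmult_def split: if_splits)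
      then show "m \<in> (\<lambda>m. add_mset i m) ` {m. P m \<noteq> \<zero>}"
        by (intro image_eqI[of _ _ "m - {#i#}"]) auto
    qed
    moreover have "set_mset m \<subseteq> I" if "indexed_pmult P i m \<noteq> \<zero>" for m
    proof -
      have *: "i \<in># m" "P (m - {#i#}) \<noteq> \<zero>" using that by (auto simp: indexed_pmult_def split: if_splits)
      then have "set_mset (m - {#i#}) \<subseteq> I" using indexed_pmult by blast
      moreover have "m = add_mset i (m - {#i#})" using * by simp
      ultimately show ?thesis using \<open>i \<in> I\<close> by (metis insert_subset set_mset_add_mset_insert)
    qed
    moreover have "indexed_pmult P i m \<in> carrier R" for m
      using indexed_pmult by (simp add: indexed_pmult_def)
    moreover have "finite ((\<lambda>m. add_mset i m) ` {m. P m \<noteq> \<zero>})" using indexed_pmult by simp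
    ultimately show ?case using finite_subset by (intro conjI allI impI; assumption?)
  qed
  then show "finite {m. f m \<noteq> \<zero>}" "f m \<in> carrier R" "f m \<noteq> \<zero> \<Longrightarrow> set_mset m \<subseteq> I" by auto
qed

lemma indexed_pset_single:
  assumes "set_mset m \<subseteq> I" "k \<in> carrier R"
  shows "(\<lambda>t. if t = m then k else \<zero>) \<in> indexed_pset I (carrier R)"
  using assms(1)
proof (induction m)
  case empty
  show ?case using indexed_pset.indexed_const[OF assms(2), of I] unfolding indexed_const_def .
next
  case (add i m)
  have "(\<lambda>t. if t = add_mset i m then k else \<zero>) = indexed_pmult (\<lambda>t. if t = m then k else \<zero>) i"
  proof
    fix t
    show "(if t = add_mset i m then k else \<zero>) = indexed_pmult (\<lambda>t. if t = m then k else \<zero>) i t"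
      by (cases "i \<in># t") (auto simp: indexed_pmult_def)
  qed
  then show ?case using add indexed_pset.indexed_pmult[of _ I "carrier R" i] by simp
qed

lemma indexed_psetI:
  assumes "finite S" "\<And>m. f m \<noteq> \<zero> \<Longrightarrow> m \<in> S" "\<And>m. f m \<in> carrier R" "\<And>m. m \<in> S \<Longrightarrow> set_mset m \<subseteq> I"
  shows "f \<in> indexed_pset I (carrier R)"
  using assms
proof (induction S arbitrary: f rule: finite_induct)
  case empty
  then have "f = indexed_const \<zero>" by (auto simp: indexed_const_def)
  then show ?case using indexed_pset.indexed_const[of \<zero> "carrier R" I] by simp
next
  case (insert m S)
  have "f(m := \<zero>) \<in> indexed_pset I (carrier R)"
    by (rule insert.IH) (use insert.prems in \<open>auto split: if_splits\<close>)
  moreover have "(\<lambda>t. if t = m then f m else \<zero>) \<in> indexed_pset I (carrier R)"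
    using insert.prems by (intro indexed_pset_single) auto
  moreover have "f = indexed_padd (f(m := \<zero>)) (\<lambda>t. if t = m then f m else \<zero>)"
    using insert.prems(2) by (auto simp: indexed_padd_def)
  ultimately show ?case using indexed_pset.indexed_padd by metis
qed

end

lemma (in cring) monomial_eq_power_product:
  assumes "set_mset m \<subseteq> {..<n}" "\<And>i. i < n \<Longrightarrow> a i \<in> carrier R"
  shows "(\<Otimes>i\<in>set_mset m. a i [^] count m i) = power_product a n (count m)"
  unfolding power_product_def
  using assms by (intro finprod_mono_neutral_cong_left) (auto simp: not_in_iff)

lemma (in cring) ideal_finsum:
  assumes "ideal I R" "finite S" "\<And>x. x \<in> S \<Longrightarrow> f x \<in> I"
  shows "(\<Oplus>x\<in>S. f x) \<in> I"
  using assms(2,3)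
proof (induction S rule: finite_induct)
  case empty
  then show ?case using ideal_zero[OF assms(1)] by simp
next
  case (insert x S)
  then have "f \<in> S \<rightarrow> carrier R" "f x \<in> carrier R" using ideal_subset[OF assms(1)] by auto
  then show ?case using insert ideal_add[OF assms(1)] by simp
qed

context cring
begin

context
  fixes K :: "('k, 'm) ring_scheme" and \<phi> and as :: "'a list" and n
  assumes K: "ring K" and \<phi>: "\<phi> \<in> ring_hom K R" and as: "set as \<subseteq> carrier R" "length as = n"
begin

lemma as_carrier: "i < n \<Longrightarrow> as ! i \<in> carrier R"
  using as by auto

lemma phi_closed: "k \<in> carrier K \<Longrightarrow> \<phi> k \<in> carrier R"
  by (rule ring_hom_closed[OF \<phi>])

lemma phi_zero: "\<phi> \<zero>\<^bsub>K\<^esub> = \<zero>"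
  using ring_hom_zero[OF \<phi> K ring_axioms] .

lemma poly_value_eq_finsum:
  assumes f: "f \<in> ring.indexed_pset K {..<n} (carrier K)" and S: "finite S" "{m. f m \<noteq> \<zero>\<^bsub>K\<^esub>} \<subseteq> S"
    and Sn: "\<And>m. m \<in> S \<Longrightarrow> set_mset m \<subseteq> {..<n}"
  shows "poly_value K R \<phi> f as = (\<Oplus>m\<in>S. \<phi> (f m) \<otimes> power_product ((!) as) n (count m))"
proof -
  interpret K: ring K by (rule K)
  note f' = K.indexed_pset_finite_support[OF f]
  have c: "\<phi> (f m) \<otimes> power_product ((!) as) n (count m) \<in> carrier R" for m
    using f'(2) phi_closed power_product_closed[of n "(!) as"] as_carrier by auto
  show ?thesis unfolding poly_value_def
  proof (rule add.finprod_mono_neutral_cong_left[OF S(1,2)])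
    show "\<phi> (f m) \<otimes> power_product ((!) as) n (count m) = \<zero>" if "m \<in> S - {m. f m \<noteq> \<zero>\<^bsub>K\<^esub>}" for m
      using that phi_zero power_product_closed[of n "(!) as"] as_carrier by auto
    show "\<phi> (f m) \<otimes> (\<Otimes>i\<in>set_mset m. as ! i [^] count m i) = \<phi> (f m) \<otimes> power_product ((!) as) n (count m)"
      if "m \<in> {m. f m \<noteq> \<zero>\<^bsub>K\<^esub>}" for m
      using monomial_eq_power_product[of m n "(!) as"] as_carrier Sn S that by auto
  qed (use c in auto)
qed

end

end

text \<open>For suitable weights all other terms of a submonic relation are heavier than the
  trailing one, whose coefficient is one. The relation thus puts the trailing power product into the
  ideal of higher weight, which parameters do not allow.\<close>

lemma (in noetherian_cring) exists_independent_of_chain: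
  fixes K :: "('k, 'm) ring_scheme"
  assumes K: "cring K" and \<phi>: "\<phi> \<in> ring_hom K R"
    and chain: "ascending_chain R P0 n" and n: "n > 0"
  obtains as where "length as = n" "set as \<subseteq> carrier R" "\<not> algebraically_dependent K R \<phi> as"
proof -
  interpret K: cring K by (rule K)
  obtain P where P: "descending_chain R P0 n P"
    using ascending_chain_imp_descending[OF chain] by blast
  obtain as where as: "length as = n" "set as \<subseteq> P"
    "\<And>Q. \<lbrakk>primeideal Q R; P0 \<subseteq> Q; set as \<subseteq> Q; Q \<subseteq> P\<rbrakk> \<Longrightarrow> descending_chain R P0 n Q"
    by (rule exists_parameters[OF P], rule that)
  have pr: "primeideal P R" "primeideal P0 R" "P0 \<subseteq> P"
    using P descending_chain_prime descending_chain_bot by blast+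
  have asc: "set as \<subseteq> carrier R" using as(2) ideal_subset[OF prime_ideal[OF pr(1)]] by auto
  have c: "P0 \<union> set as \<subseteq> carrier R" using asc ideal_subset[OF prime_ideal[OF pr(2)]] by auto
  \<comment> \<open>\<open>P\<close> need not be minimal over \<open>P0\<close> and the chosen
    elements. It is replaced by a minimal prime \<open>p\<close>, which by the choice of the
    parameters still has a chain of length \<open>n\<close> from \<open>P0\<close>.\<close>
  have "genideal R (P0 \<union> set as) \<subseteq> P"
    using pr as by (intro genideal_minimal prime_ideal) auto
  then obtain p where p: "primeideal p R" "genideal R (P0 \<union> set as) \<subseteq> p" "p \<subseteq> P"
    "\<And>Q. \<lbrakk>primeideal Q R; genideal R (P0 \<union> set as) \<subseteq> Q; Q \<subseteq> p\<rbrakk> \<Longrightarrow> Q = p"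
    using exists_minimal_prime[OF genideal_ideal[OF c] pr(1)] by blast
  have sub: "P0 \<subseteq> p" "set as \<subseteq> p" using p(2) genideal_self[OF c] by auto
  have pchain: "descending_chain R P0 n p" using as(3)[OF p(1) sub p(3)] .
  have "\<not> algebraically_dependent K R \<phi> as"
  proof
    assume "algebraically_dependent K R \<phi> as"
    then obtain f ord where f: "f \<in> ring.indexed_pset K {..<n} (carrier K)" and ord: "monomial_ordering ord"
      and sm: "submonic_wrt ord K f" and f0: "poly_value K R \<phi> f as = \<zero>"
      unfolding algebraically_dependent_def submonic_def as(1) by auto
    note f' = K.indexed_pset_finite_support[OF f]
    have "\<one> \<noteq> \<zero>" using prime_one[OF p(1)] ideal_zero[OF prime_ideal[OF p(1)]] by metis
    have "carrier K \<noteq> {\<zero>\<^bsub>K\<^esub>}"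
    proof
      assume "carrier K = {\<zero>\<^bsub>K\<^esub>}"
      then have "\<one>\<^bsub>K\<^esub> = \<zero>\<^bsub>K\<^esub>" using K.one_closed by auto
      then have "\<one> = \<zero>"
        using ring_hom_one[OF \<phi>] ring_hom_zero[OF \<phi> K.ring_axioms ring_axioms] by simp
      then show False using \<open>\<one> \<noteq> \<zero>\<close> by simp
    qed
    then obtain m where m: "f m = \<one>\<^bsub>K\<^esub>" "f m \<noteq> \<zero>\<^bsub>K\<^esub>" "\<And>t. f t \<noteq> \<zero>\<^bsub>K\<^esub> \<Longrightarrow> (m, t) \<in> ord"
      using sm unfolding submonic_wrt_def by blast
    define F where "F = {t. f t \<noteq> \<zero>\<^bsub>K\<^esub>} - {m}"
    have F: "finite F" "\<And>t. t \<in> F \<Longrightarrow> (m, t) \<in> ord \<and> t \<noteq> m \<and> set_mset t \<subseteq> {..<n}"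
      using f' m by (auto simp: F_def)
    obtain w :: "nat \<Rightarrow> nat" where w: "\<And>i. i < n \<Longrightarrow> w i > 0"
      "\<And>t. t \<in> F \<Longrightarrow> (\<Sum>i<n. w i * count m i) < (\<Sum>i<n. w i * count t i)"
      by (rule monomial_ordering_weights[OF ord f'(3)[OF m(2)] F(1)], rule F(2), assumption, rule that)
    let ?v = "\<lambda>t. power_product ((!) as) n (count t)"
    let ?I = "weighted_ideal ((!) as) n w (Suc (\<Sum>i<n. w i * count m i))"
    have asi: "as ! i \<in> carrier R" if "i < n" for i using asc as(1) that by auto
    have vc: "?v t \<in> carrier R" for t by (rule power_product_closed[OF asi])
    have Iid: "ideal ?I R" by (rule weighted_ideal_ideal[OF asi])
    have fc: "\<phi> (f t) \<in> carrier R" for t using f'(2) ring_hom_closed[OF \<phi>] by blast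
    have "\<zero> = (\<Oplus>t\<in>insert m F. \<phi> (f t) \<otimes> ?v t)"
      unfolding f0[symmetric]
      using F f'(3)[OF m(2)] by (intro poly_value_eq_finsum[OF K.ring_axioms \<phi> asc as(1) f]) (auto simp: F_def)
    also have "\<dots> = \<phi> (f m) \<otimes> ?v m \<oplus> (\<Oplus>t\<in>F. \<phi> (f t) \<otimes> ?v t)"
      using F(1) fc vc by (subst finsum_insert) (auto simp: F_def)
    finally have eq: "\<zero> = ?v m \<oplus> (\<Oplus>t\<in>F. \<phi> (f t) \<otimes> ?v t)"
      using m(1) ring_hom_one[OF \<phi>] vc by simp
    have "(\<Oplus>t\<in>F. \<phi> (f t) \<otimes> ?v t) \<in> ?I"
    proof (rule ideal_finsum[OF Iid F(1)])
      fix t assume "t \<in> F"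
      then have "?v t \<in> ?I"
        using w(2) by (intro power_product_in_weighted_ideal[OF asi]) (simp_all add: Suc_le_eq)
      then show "\<phi> (f t) \<otimes> ?v t \<in> ?I" using fc by (intro ideal_mult[OF Iid])
    qed
    moreover have "(\<Oplus>t\<in>F. \<phi> (f t) \<otimes> ?v t) \<oplus> ?v m \<in> ?I"
    proof -
      have "(\<Oplus>t\<in>F. \<phi> (f t) \<otimes> ?v t) \<in> carrier R" using fc vc by (intro finsum_closed) auto
      then have "(\<Oplus>t\<in>F. \<phi> (f t) \<otimes> ?v t) \<oplus> ?v m = \<zero>" using eq vc by (simp add: a_comm)
      then show ?thesis using ideal_zero[OF Iid] by simp
    qed
    ultimately have "?v m \<in> ?I" using ideal_add_cancel[OF Iid] vc by blast
    moreover have "?v m \<notin> ?I"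
    proof (rule parameters_weighted_independent[OF pchain n])
      show "as ! i \<in> p" if "i < n" for i using that sub as(1) by auto
      show "Q = p" if Q: "primeideal Q R" "P0 \<subseteq> Q" "\<And>i. i < n \<Longrightarrow> as ! i \<in> Q" "Q \<subseteq> p" for Q
      proof (rule p(4)[OF Q(1) _ Q(4)])
        have "set as \<subseteq> Q" using Q(3) as(1) by (auto simp: in_set_conv_nth)
        then show "genideal R (P0 \<union> set as) \<subseteq> Q" using Q by (intro genideal_minimal prime_ideal) auto
      qed
    qed (rule w(1))
    ultimately show False by simp
  qed
  then show ?thesis using that as(1) asc by blast
qed

lemma algebraically_dependent_wrt_imp_dependent:
  assumes "monomial_ordering ord" "algebraically_dependent_wrt ord K R \<phi> as"
  shows "algebraically_dependent K R \<phi> as"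
  using assms unfolding algebraically_dependent_wrt_def algebraically_dependent_def submonic_def by blast

section \<open>Lexicographic independence\<close>

context cring
begin

text \<open>The sum \<open>S i\<close> collects the terms that agree with the trailing monomial in the first \<open>i\<close>
  indeterminates, divided by their common factor; it stays in the \<open>i\<close>-th prime.\<close>

lemma lex_independent_of_chain:
  fixes K :: "('k, 'm) ring_scheme"
  assumes K: "cring K" and \<phi>: "\<phi> \<in> ring_hom K R"
    and as: "length as = n" "set as \<subseteq> carrier R"
    and P: "\<And>i. i \<le> n \<Longrightarrow> primeideal (P i) R" "\<And>i. i < n \<Longrightarrow> P i \<subseteq> P (Suc i)"
      "\<And>i. i < n \<Longrightarrow> as ! i \<in> P (Suc i)" "\<And>i. i < n \<Longrightarrow> as ! i \<notin> P i"
  shows "\<not> algebraically_dependent_wrt lex_ordering K R \<phi> as"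
proof
  interpret K: cring K by (rule K)
  assume "algebraically_dependent_wrt lex_ordering K R \<phi> as"
  then obtain f where f: "f \<in> ring.indexed_pset K {..<n} (carrier K)"
    and sm: "submonic_wrt lex_ordering K f" and f0: "poly_value K R \<phi> f as = \<zero>"
    unfolding algebraically_dependent_wrt_def as(1) by auto
  note f' = K.indexed_pset_finite_support[OF f]
  have "\<one> \<noteq> \<zero>" using prime_one[OF P(1)[of 0]] ideal_zero[OF prime_ideal[OF P(1)[of 0]]] by auto
  have "carrier K \<noteq> {\<zero>\<^bsub>K\<^esub>}"
  proof
    assume "carrier K = {\<zero>\<^bsub>K\<^esub>}"
    then have "\<one>\<^bsub>K\<^esub> = \<zero>\<^bsub>K\<^esub>" using K.one_closed by auto
    then have "\<one> = \<zero>"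
      using ring_hom_one[OF \<phi>] ring_hom_zero[OF \<phi> K.ring_axioms ring_axioms] by simp
    then show False using \<open>\<one> \<noteq> \<zero>\<close> by simp
  qed
  then obtain m where m: "f m = \<one>\<^bsub>K\<^esub>" "f m \<noteq> \<zero>\<^bsub>K\<^esub>" "\<And>t. f t \<noteq> \<zero>\<^bsub>K\<^esub> \<Longrightarrow> (m, t) \<in> lex_ordering"
    using sm unfolding submonic_wrt_def by blast
  define F where "F i = {t. f t \<noteq> \<zero>\<^bsub>K\<^esub> \<and> (\<forall>j<i. count t j = count m j)}" for i
  have finF: "finite (F i)" for i using f'(1) by (rule finite_subset[rotated]) (auto simp: F_def)
  define a where "a i = as ! i" for i
  have a: "a i \<in> carrier R" if "i < n" for i using as that by (auto simp: a_def)
  define tl where "tl i t = (\<Otimes>j\<in>{i..<n}. a j [^] count t j)" for i and t :: monomial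
  have tlc: "tl i t \<in> carrier R" for i t unfolding tl_def using a by (intro finprod_closed) auto
  have tlSuc: "tl i t = a i [^] count t i \<otimes> tl (Suc i) t" if "i < n" for i t
  proof -
    have "{i..<n} = insert i {Suc i..<n}" using that by auto
    then show ?thesis unfolding tl_def using a that by (simp del: finprod_closed add: Pi_def)
  qed
  have fc: "\<phi> (f t) \<in> carrier R" for t using f'(2) ring_hom_closed[OF \<phi>] by blast
  define S where "S i = (\<Oplus>t\<in>F i. \<phi> (f t) \<otimes> tl i t)" for i
  have Sc: "S i \<in> carrier R" for i unfolding S_def using fc tlc by (intro finsum_closed) auto
  have "S i \<in> P i" if "i \<le> n" for i
    using that
  proof (induction i)
    case 0
    have "poly_value K R \<phi> f as = (\<Oplus>t\<in>F 0. \<phi> (f t) \<otimes> power_product ((!) as) n (count t))"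
      using f'(1,3) by (intro poly_value_eq_finsum[OF K.ring_axioms \<phi> as(2,1) f]) (auto simp: F_def)
    also have "\<dots> = S 0"
      by (simp add: S_def tl_def power_product_def a_def atLeast0LessThan)
    finally show ?case using f0 ideal_zero[OF prime_ideal[OF P(1)]] by simp
  next
    case (Suc i)
    then have i: "i < n" by simp
    have pr: "primeideal (P i) R" "primeideal (P (Suc i)) R" using P(1) i by auto
    have ge: "count m i \<le> count t i" if "t \<in> F i" for t
    proof -
      have "(m, t) \<in> lex_ordering" "\<forall>j<i. count t j = count m j" using that m(3) by (auto simp: F_def)
      then consider "m = t" | k where "count m k < count t k" "\<forall>j<k. count m j = count t j"
        unfolding lex_ordering_def by auto
      then show ?thesis
      proof cases
        case 2
        then show ?thesis using \<open>\<forall>j<i. count t j = count m j\<close> by (cases k i rule: linorder_cases) auto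
      qed simp
    qed
    define g where "g t = \<phi> (f t) \<otimes> (a i [^] (count t i - count m i) \<otimes> tl (Suc i) t)" for t
    have gc: "g t \<in> carrier R" for t unfolding g_def using fc a[OF i] tlc by simp
    define U where "U = (\<Oplus>t\<in>F i. g t)"
    have Uc: "U \<in> carrier R" unfolding U_def using gc by (intro finsum_closed) auto
    have "S i = (\<Oplus>t\<in>F i. a i [^] count m i \<otimes> g t)" unfolding S_def
    proof (rule finsum_cong')
      fix t assume t: "t \<in> F i"
      have "a i [^] count t i = a i [^] count m i \<otimes> a i [^] (count t i - count m i)"
        using a[OF i] ge[OF t] by (simp add: nat_pow_mult)
      then show "\<phi> (f t) \<otimes> tl i t = a i [^] count m i \<otimes> g t"
        unfolding g_def tlSuc[OF i] using fc a[OF i] tlc by (simp add: m_ac)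
    qed (use gc a[OF i] in auto)
    also have "\<dots> = a i [^] count m i \<otimes> U" unfolding U_def
      using finF gc a[OF i] by (intro finsum_rdistr[symmetric]) auto
    \<comment> \<open>The common factor is a power of an element outside the prime
      \<open>P i\<close> and can be cancelled.\<close>
    finally have "a i [^] count m i \<otimes> U \<in> P i" using Suc by simp
    moreover have "a i [^] count m i \<notin> P i"
      using prime_pow[OF pr(1)] a[OF i] P(4)[OF i] by (auto simp: a_def)
    ultimately have "U \<in> P i" using prime_mult[OF pr(1)] Uc a[OF i] by blast
    then have UP: "U \<in> P (Suc i)" using P(2)[OF i] by auto
    \<comment> \<open>Terms of \<open>G\<close> keep a positive power of \<open>a i\<close> after
      the cancellation and so lie in \<open>P (Suc i)\<close>; the others make up
      \<open>S (Suc i)\<close>.\<close>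
    define G where "G = F i - F (Suc i)"
    have FG: "F i = G \<union> F (Suc i)" "G \<inter> F (Suc i) = {}" by (auto simp: G_def F_def)
    have "U = (\<Oplus>t\<in>G. g t) \<oplus> (\<Oplus>t\<in>F (Suc i). g t)"
      unfolding U_def FG(1) using finF FG(2) gc by (intro finsum_Un_disjoint) (auto simp: G_def)
    also have "(\<Oplus>t\<in>F (Suc i). g t) = S (Suc i)" unfolding S_def
      using gc fc tlc by (intro finsum_cong') (auto simp: g_def F_def)
    finally have "U = (\<Oplus>t\<in>G. g t) \<oplus> S (Suc i)" .
    moreover have "(\<Oplus>t\<in>G. g t) \<in> P (Suc i)"
    proof (rule ideal_finsum[OF prime_ideal[OF pr(2)]])
      show "finite G" using finF by (simp add: G_def)
      fix t assume "t \<in> G"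
      then have "t \<in> F i" "count t i \<noteq> count m i" by (auto simp: G_def F_def less_Suc_eq)
      then have "count m i < count t i" using ge[of t] by simp
      then obtain k where "count t i = Suc (count m i + k)" using less_imp_Suc_add by blast
      then have k: "count t i - count m i = Suc k" by simp
      have "a i [^] Suc k \<in> P (Suc i)"
        using ideal_mult[OF prime_ideal[OF pr(2)] P(3)[OF i], of "a i [^] k"] a[OF i] by (simp add: a_def)
      then have *: "a i [^] Suc k \<otimes> tl (Suc i) t \<in> P (Suc i)"
        by (rule ideal_mult'[OF prime_ideal[OF pr(2)] _ tlc])
      show "g t \<in> P (Suc i)" unfolding g_def k
        by (rule ideal_mult[OF prime_ideal[OF pr(2)] * fc])
    qed
    ultimately show ?case
      using ideal_add_cancel[OF prime_ideal[OF pr(2)]] UP Sc by blast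
  qed
  then have "S n \<in> P n" by simp
  \<comment> \<open>No indeterminate from \<open>n\<close> on occurs, so only the trailing term is
    left and \<open>S n\<close> is the image of its coefficient one.\<close>
  moreover have "F n = {m}"
  proof -
    have "t = m" if "f t \<noteq> \<zero>\<^bsub>K\<^esub>" "\<forall>j<n. count t j = count m j" for t
    proof (rule multiset_eqI)
      fix j
      show "count t j = count m j"
      proof (cases "j < n")
        case False
        then have "j \<notin># t" "j \<notin># m" using f'(3)[OF that(1)] f'(3)[OF m(2)] by auto
        then show ?thesis by (simp add: not_in_iff)
      qed (use that in simp)
    qed
    then show ?thesis using m(2) by (auto simp: F_def)
  qed
  moreover have "tl n m = \<one>" by (simp add: tl_def)
  ultimately have "\<one> \<in> P n" unfolding S_def using ring_hom_one[OF \<phi>] m(1) by simp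
  then show False using prime_one[OF P(1)[of n]] by simp
qed

lemma exists_lex_independent_of_chain:
  fixes K :: "('k, 'm) ring_scheme"
  assumes K: "cring K" and \<phi>: "\<phi> \<in> ring_hom K R" and chain: "ascending_chain R P0 n"
  obtains as where "length as = n" "set as \<subseteq> carrier R"
    "\<not> algebraically_dependent_wrt lex_ordering K R \<phi> as"
proof -
  obtain P where P: "\<And>i. i \<le> n \<Longrightarrow> primeideal (P i) R" "\<And>i. i < n \<Longrightarrow> P i \<subset> P (Suc i)"
    using ascending_chain_imp_function[OF chain] by blast
  have "\<exists>x. x \<in> P (Suc i) \<and> x \<notin> P i" if "i < n" for i using P(2)[OF that] by blast
  then obtain a where a: "\<And>i. i < n \<Longrightarrow> a i \<in> P (Suc i) \<and> a i \<notin> P i" by metis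
  have ac: "a i \<in> carrier R" if "i < n" for i
    using a[OF that] ideal_subset[OF prime_ideal[OF P(1)[of "Suc i"]]] that by auto
  show ?thesis
  proof (rule that[of "map a [0..<n]"])
    show "\<not> algebraically_dependent_wrt lex_ordering K R \<phi> (map a [0..<n])"
      by (rule lex_independent_of_chain[OF K \<phi>, where P = P and n = n])
        (use P a ac in \<open>auto simp: psubset_imp_subset\<close>)
  qed (use ac in auto)
qed

end

section \<open>Values of polynomials with prescribed support\<close>

context cring
begin

text \<open>The values at \<open>as\<close> of polynomials with monomials in \<open>S\<close>. The
  inductive form yields sums and products without handling coefficient functions, while
  \<open>S\<close> keeps track of the support until a submonic polynomial has to be
  produced.\<close>

inductive_set poly_span :: "('k, 'm) ring_scheme \<Rightarrow> ('k \<Rightarrow> 'a) \<Rightarrow> 'a list \<Rightarrow> nat \<Rightarrow> monomial set \<Rightarrow> 'a set"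
  for K :: "('k, 'm) ring_scheme" and \<phi> as n S where
  zero: "\<zero> \<in> poly_span K \<phi> as n S"
| add_term: "\<lbrakk>x \<in> poly_span K \<phi> as n S; k \<in> carrier K; m \<in> S; set_mset m \<subseteq> {..<n}\<rbrakk> \<Longrightarrow>
    \<phi> k \<otimes> power_product ((!) as) n (count m) \<oplus> x \<in> poly_span K \<phi> as n S"

context
  fixes K :: "('k, 'm) ring_scheme" and \<phi> and as :: "'a list" and n
  assumes K: "cring K" and \<phi>: "\<phi> \<in> ring_hom K R" and as: "set as \<subseteq> carrier R" "length as = n"
begin

interpretation K: cring K by (rule K)

lemma nth_closed: "i < n \<Longrightarrow> as ! i \<in> carrier R"
  using as by auto

lemma power_product_nth_closed: "power_product ((!) as) n m \<in> carrier R"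
  by (rule power_product_closed[OF nth_closed])

lemma coeff_image_closed: "k \<in> carrier K \<Longrightarrow> \<phi> k \<in> carrier R"
  by (rule ring_hom_closed[OF \<phi>])

lemma poly_span_closed: "x \<in> poly_span K \<phi> as n S \<Longrightarrow> x \<in> carrier R"
  by (induction rule: poly_span.induct) (auto intro: power_product_nth_closed coeff_image_closed)

lemma poly_span_mono: "x \<in> poly_span K \<phi> as n S \<Longrightarrow> S \<subseteq> T \<Longrightarrow> x \<in> poly_span K \<phi> as n T"
  by (induction rule: poly_span.induct) (auto intro: poly_span.intros)

lemma poly_span_term:
  "\<lbrakk>k \<in> carrier K; m \<in> S; set_mset m \<subseteq> {..<n}\<rbrakk> \<Longrightarrow> \<phi> k \<otimes> power_product ((!) as) n (count m) \<in> poly_span K \<phi> as n S"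
  using poly_span.add_term[OF poly_span.zero, of k K m S n \<phi> as] power_product_nth_closed coeff_image_closed by simp

lemma poly_span_add: "\<lbrakk>x \<in> poly_span K \<phi> as n S; y \<in> poly_span K \<phi> as n S\<rbrakk> \<Longrightarrow> x \<oplus> y \<in> poly_span K \<phi> as n S"
proof (induction rule: poly_span.induct)
  case zero
  then show ?case using poly_span_closed by simp
next
  case (add_term x k m)
  then show ?case using poly_span.add_term[of "x \<oplus> y" K \<phi> as n S k m] power_product_nth_closed coeff_image_closed poly_span_closed
    by (simp add: a_assoc)
qed

lemma power_product_union:
  "power_product ((!) as) n (count (s + t)) = power_product ((!) as) n (count s) \<otimes> power_product ((!) as) n (count t)"
  using power_product_add[of n "(!) as" "count s" "count t"] nth_closed by (simp add: plus_multiset.rep_eq)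

lemma poly_span_mult_term:
  assumes "x \<in> poly_span K \<phi> as n S" "k \<in> carrier K" "set_mset m \<subseteq> {..<n}"
  shows "(\<phi> k \<otimes> power_product ((!) as) n (count m)) \<otimes> x \<in> poly_span K \<phi> as n ((+) m ` S)"
  using assms(1)
proof (induction rule: poly_span.induct)
  case zero
  then show ?case using assms power_product_nth_closed coeff_image_closed by (simp add: poly_span.zero)
next
  case (add_term x l t)
  have "(\<phi> k \<otimes> power_product ((!) as) n (count m)) \<otimes> (\<phi> l \<otimes> power_product ((!) as) n (count t) \<oplus> x)
    = \<phi> (k \<otimes>\<^bsub>K\<^esub> l) \<otimes> power_product ((!) as) n (count (m + t)) \<oplus> (\<phi> k \<otimes> power_product ((!) as) n (count m)) \<otimes> x"
    unfolding power_product_union using add_term assms power_product_nth_closed coeff_image_closed poly_span_closed ring_hom_mult[OF \<phi>]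
    by (simp add: r_distr m_ac)
  then show ?case using add_term assms by (auto intro!: poly_span.add_term)
qed

lemma poly_span_mult:
  assumes "x \<in> poly_span K \<phi> as n UNIV" "y \<in> poly_span K \<phi> as n UNIV"
  shows "x \<otimes> y \<in> poly_span K \<phi> as n UNIV"
  using assms(1)
proof (induction rule: poly_span.induct)
  case zero
  then show ?case using assms poly_span_closed by (simp add: poly_span.zero)
next
  case (add_term x k m)
  have "(\<phi> k \<otimes> power_product ((!) as) n (count m)) \<otimes> y \<in> poly_span K \<phi> as n UNIV"
    using poly_span_mult_term[OF assms(2) add_term(2,4)] by (rule poly_span_mono) simp
  then have "(\<phi> k \<otimes> power_product ((!) as) n (count m)) \<otimes> y \<oplus> x \<otimes> y \<in> poly_span K \<phi> as n UNIV"
    using add_term by (intro poly_span_add)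
  then show ?case using add_term poly_span_closed assms(2) power_product_nth_closed coeff_image_closed by (simp add: l_distr)
qed

lemma power_product_single:
  assumes "i < n"
  shows "power_product ((!) as) n (count {#i#}) = as ! i"
proof -
  have "(\<Otimes>j\<in>set_mset {#i#}. as ! j [^] count {#i#} j) = power_product ((!) as) n (count {#i#})"
    using assms nth_closed by (intro monomial_eq_power_product) auto
  then show ?thesis using nth_closed[OF assms] by simp
qed

lemma power_product_empty: "power_product ((!) as) n (count {#}) = \<one>"
  unfolding power_product_def by (intro finprod_one_eqI) auto

lemma const_in_poly_span: "k \<in> carrier K \<Longrightarrow> \<phi> k \<in> poly_span K \<phi> as n UNIV"
  using poly_span_term[of k "{#}" UNIV] power_product_empty coeff_image_closed by simp

lemma var_in_poly_span:
  assumes "i < n"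
  shows "as ! i \<in> poly_span K \<phi> as n UNIV"
  using poly_span_term[of "\<one>\<^bsub>K\<^esub>" "{#i#}" UNIV] power_product_single[OF assms] nth_closed[OF assms]
    ring_hom_one[OF \<phi>] assms by simp

lemma generate_ring_subset_poly_span:
  "generate_ring R (\<phi> ` carrier K \<union> set as) \<subseteq> poly_span K \<phi> as n UNIV"
proof
  fix x assume x: "x \<in> generate_ring R (\<phi> ` carrier K \<union> set as)"
  have incl: "h \<in> poly_span K \<phi> as n UNIV" if "h \<in> \<phi> ` carrier K \<union> set as" for h
    using that const_in_poly_span var_in_poly_span as(2) by (auto simp: in_set_conv_nth)
  show "x \<in> poly_span K \<phi> as n UNIV"
    using x
  proof (induction rule: generate_ring.induct)
    case one
    then show ?case using const_in_poly_span[of "\<one>\<^bsub>K\<^esub>"] ring_hom_one[OF \<phi>] by simp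
  next
    case (a_inv h)
    have "\<phi> (\<ominus>\<^bsub>K\<^esub> \<one>\<^bsub>K\<^esub>) = \<ominus> \<one>"
    proof -
      interpret ring_hom_ring K R \<phi>
        by (rule ring_hom_ringI2[OF K.ring_axioms ring_axioms \<phi>])
      show ?thesis by simp
    qed
    then have "\<ominus> \<one> \<otimes> h \<in> poly_span K \<phi> as n UNIV"
      using poly_span_mult[OF const_in_poly_span[of "\<ominus>\<^bsub>K\<^esub> \<one>\<^bsub>K\<^esub>"] a_inv.IH] by simp
    then show ?case using poly_span_closed[OF a_inv.IH] by (simp add: l_minus)
  qed (auto intro: poly_span_add poly_span_mult incl)
qed

lemma poly_span_imp_poly_value:
  assumes "x \<in> poly_span K \<phi> as n S"
  shows "\<exists>f \<in> ring.indexed_pset K {..<n} (carrier K). {m. f m \<noteq> \<zero>\<^bsub>K\<^esub>} \<subseteq> S \<and> poly_value K R \<phi> f as = x"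
  using assms
proof (induction rule: poly_span.induct)
  case zero
  have "K.indexed_const \<zero>\<^bsub>K\<^esub> \<in> K.indexed_pset {..<n} (carrier K)"
    by (intro K.indexed_pset.indexed_const) simp
  moreover have "poly_value K R \<phi> (K.indexed_const \<zero>\<^bsub>K\<^esub>) as = \<zero>"
    by (simp add: poly_value_def K.indexed_const_def)
  ultimately show ?case by (intro bexI[of _ "K.indexed_const \<zero>\<^bsub>K\<^esub>"]) (auto simp: K.indexed_const_def)
next
  case (add_term x k m)
  then obtain f where f: "f \<in> K.indexed_pset {..<n} (carrier K)" "{m. f m \<noteq> \<zero>\<^bsub>K\<^esub>} \<subseteq> S"
      "poly_value K R \<phi> f as = x" by blast
  note f' = K.indexed_pset_finite_support[OF f(1)]
  define T where "T = insert m {m. f m \<noteq> \<zero>\<^bsub>K\<^esub>}"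
  have T: "finite T" "\<And>t. t \<in> T \<Longrightarrow> set_mset t \<subseteq> {..<n}" using f' add_term by (auto simp: T_def)
  \<comment> \<open>\<open>m\<close> may already occur in \<open>f\<close>, so the coefficients are
    added; if they cancel, the support only shrinks.\<close>
  define h where "h = f(m := k \<oplus>\<^bsub>K\<^esub> f m)"
  have h: "h \<in> K.indexed_pset {..<n} (carrier K)"
    by (rule K.indexed_psetI[OF T(1)]) (use f' add_term T in \<open>auto simp: h_def T_def split: if_splits\<close>)
  have sub: "{t. h t \<noteq> \<zero>\<^bsub>K\<^esub>} \<subseteq> T" by (auto simp: h_def T_def)
  let ?v = "\<lambda>t. power_product ((!) as) n (count t)"
  have hc: "\<phi> (h t) \<otimes> ?v t \<in> carrier R" for t using K.indexed_pset_finite_support(2)[OF h] coeff_image_closed power_product_nth_closed by simp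
  have fvc: "\<phi> (f t) \<otimes> ?v t \<in> carrier R" for t using f' coeff_image_closed power_product_nth_closed by simp
  have "poly_value K R \<phi> h as = (\<Oplus>t\<in>T. \<phi> (h t) \<otimes> ?v t)"
    by (rule poly_value_eq_finsum[OF K.ring_axioms \<phi> as h T(1) sub T(2)])
  also have "\<dots> = (\<Oplus>t\<in>insert m (T - {m}). \<phi> (h t) \<otimes> ?v t)"
    by (simp add: T_def insert_absorb)
  also have "\<dots> = \<phi> (h m) \<otimes> ?v m \<oplus> (\<Oplus>t\<in>T - {m}. \<phi> (h t) \<otimes> ?v t)"
    using T(1) hc by (intro finsum_insert) auto
  also have "(\<Oplus>t\<in>T - {m}. \<phi> (h t) \<otimes> ?v t) = (\<Oplus>t\<in>T - {m}. \<phi> (f t) \<otimes> ?v t)"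
    using fvc by (intro finsum_cong') (auto simp: h_def)
  also have "\<phi> (h m) \<otimes> ?v m = \<phi> k \<otimes> ?v m \<oplus> \<phi> (f m) \<otimes> ?v m"
    using add_term f' coeff_image_closed power_product_nth_closed ring_hom_add[OF \<phi>] by (simp add: h_def l_distr)
  also have "(\<phi> k \<otimes> ?v m \<oplus> \<phi> (f m) \<otimes> ?v m) \<oplus> (\<Oplus>t\<in>T - {m}. \<phi> (f t) \<otimes> ?v t)
      = \<phi> k \<otimes> ?v m \<oplus> (\<phi> (f m) \<otimes> ?v m \<oplus> (\<Oplus>t\<in>T - {m}. \<phi> (f t) \<otimes> ?v t))"
    using add_term fvc coeff_image_closed power_product_nth_closed by (intro a_assoc finsum_closed) auto
  also have "\<phi> (f m) \<otimes> ?v m \<oplus> (\<Oplus>t\<in>T - {m}. \<phi> (f t) \<otimes> ?v t) = (\<Oplus>t\<in>insert m (T - {m}). \<phi> (f t) \<otimes> ?v t)"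
    using T(1) fvc by (intro finsum_insert[symmetric]) auto
  also have "\<dots> = (\<Oplus>t\<in>T. \<phi> (f t) \<otimes> ?v t)" by (simp add: T_def insert_absorb)
  also have "\<dots> = x" unfolding f(3)[symmetric]
    by (rule poly_value_eq_finsum[OF K.ring_axioms \<phi> as f(1) T(1) _ T(2), symmetric]) (auto simp: T_def)
  finally have "poly_value K R \<phi> h as = \<phi> k \<otimes> ?v m \<oplus> x" .
  moreover have "{t. h t \<noteq> \<zero>\<^bsub>K\<^esub>} \<subseteq> S" using f(2) add_term by (auto simp: h_def)
  ultimately show ?case using h by blast
qed

end

end

section \<open>Boundary monoids and chains of primes\<close>

context noetherian_cring
begin

text \<open>The head \<open>a\<close> of the list governs the lowest step of the chain and the tail
  the primes above it, which matches the lexicographic order with the first indeterminate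
  largest.\<close>

fun boundary_monoid :: "'a list \<Rightarrow> 'a set" where
  "boundary_monoid [] = {\<one>}"
| "boundary_monoid (a # as) =
     {a [^] (k::nat) \<otimes> (s \<oplus> a \<otimes> c) | k s c. s \<in> boundary_monoid as \<and> c \<in> carrier R}"

lemma boundary_monoid_closed: "set as \<subseteq> carrier R \<Longrightarrow> boundary_monoid as \<subseteq> carrier R"
  by (induction as) auto

lemma boundary_monoidI:
  "\<lbrakk>x = a [^] (k::nat) \<otimes> (s \<oplus> a \<otimes> c); s \<in> boundary_monoid as; c \<in> carrier R\<rbrakk> \<Longrightarrow> x \<in> boundary_monoid (a # as)"
  by auto

lemma one_in_boundary_monoid: "set as \<subseteq> carrier R \<Longrightarrow> \<one> \<in> boundary_monoid as"
proof (induction as)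
  case (Cons a as)
  then show ?case by (intro boundary_monoidI[of _ a 0 \<one> \<zero>]) auto
qed simp

lemma boundary_monoid_mult:
  "\<lbrakk>set as \<subseteq> carrier R; x \<in> boundary_monoid as; y \<in> boundary_monoid as\<rbrakk> \<Longrightarrow> x \<otimes> y \<in> boundary_monoid as"
proof (induction as arbitrary: x y)
  case (Cons a as)
  obtain k s c where x: "x = a [^] (k::nat) \<otimes> (s \<oplus> a \<otimes> c)" "s \<in> boundary_monoid as" "c \<in> carrier R"
    using Cons.prems(2) by auto
  obtain l t d where y: "y = a [^] (l::nat) \<otimes> (t \<oplus> a \<otimes> d)" "t \<in> boundary_monoid as" "d \<in> carrier R"
    using Cons.prems(3) by auto
  have c: "a \<in> carrier R" "s \<in> carrier R" "t \<in> carrier R"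
    using Cons.prems(1) boundary_monoid_closed[of as] x y by auto
  define p where "p = a [^] k"
  define q where "q = a [^] l"
  have cc: "p \<in> carrier R" "q \<in> carrier R" "c \<in> carrier R" "d \<in> carrier R"
    using c x y by (auto simp: p_def q_def)
  have "(p \<otimes> (s \<oplus> a \<otimes> c)) \<otimes> (q \<otimes> (t \<oplus> a \<otimes> d)) =
    (p \<otimes> q) \<otimes> (s \<otimes> t \<oplus> a \<otimes> (s \<otimes> d \<oplus> c \<otimes> (t \<oplus> a \<otimes> d)))"
    using c cc by algebra
  then have "x \<otimes> y = a [^] (k + l) \<otimes> (s \<otimes> t \<oplus> a \<otimes> (s \<otimes> d \<oplus> c \<otimes> (t \<oplus> a \<otimes> d)))"
    using x y c by (simp add: p_def q_def nat_pow_mult)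
  then show ?case
  proof (rule boundary_monoidI)
    show "s \<otimes> t \<in> boundary_monoid as" using Cons x y by simp
  qed (use c cc in simp)
qed simp

text \<open>If \<open>q \<oplus> r \<otimes> a\<close> with \<open>q\<close> in \<open>Q\<close>
  were in the monoid of the tail, \<open>q\<close> itself would be in the full monoid, with exponent
  \<open>0\<close>. So a prime over \<open>Q\<close> and \<open>a\<close> avoids the tail's monoid.
  As \<open>a\<close> itself belongs to the monoid, it is outside \<open>Q\<close> and the step is
  strict.\<close>

lemma chain_avoiding_boundary_monoid:
  assumes "set as \<subseteq> carrier R" "primeideal Q R" "Q \<inter> boundary_monoid as = {}"
  shows "ascending_chain R Q (length as)"
  using assms
proof (induction as arbitrary: Q)
  case (Cons a as)
  have ac: "a \<in> carrier R" using Cons.prems by simp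
  note Qid = prime_ideal[OF Cons.prems(2)]
  have disj: "adjoin_element Q a \<inter> boundary_monoid as = {}"
  proof (rule ccontr)
    assume "adjoin_element Q a \<inter> boundary_monoid as \<noteq> {}"
    then obtain q r where *: "q \<in> Q" "r \<in> carrier R" "q \<oplus> r \<otimes> a \<in> boundary_monoid as"
      by (auto simp: adjoin_element_def)
    have qc: "q \<in> carrier R" using * ideal_subset[OF Qid] by auto
    have "q = a [^] (0::nat) \<otimes> ((q \<oplus> r \<otimes> a) \<oplus> a \<otimes> (\<ominus> r))"
    proof -
      have rc: "r \<in> carrier R" by fact
      have "q = (q \<oplus> r \<otimes> a) \<oplus> a \<otimes> (\<ominus> r)" using ac qc rc by algebra
      then show ?thesis using ac qc rc by simp
    qed
    then have "q \<in> boundary_monoid (a # as)"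
      by (rule boundary_monoidI[OF _ *(3)]) (use *(2) in simp)
    then show False using Cons.prems * by blast
  qed
  obtain Q' where Q': "primeideal Q' R" "adjoin_element Q a \<subseteq> Q'" "Q' \<inter> boundary_monoid as = {}"
    by (rule exists_prime_disjoint[OF adjoin_element_ideal[OF Qid ac] boundary_monoid_closed one_in_boundary_monoid boundary_monoid_mult disj])
      (use Cons.prems in auto)
  have "a \<in> boundary_monoid (a # as)"
    using ac one_in_boundary_monoid[of as] Cons.prems by (intro boundary_monoidI[of _ a 1 \<one> \<zero>]) auto
  then have "a \<notin> Q" using Cons.prems by blast
  then have "Q \<subset> Q'"
    using Q'(2) subset_adjoin_element[OF Qid ac] mem_adjoin_element[OF Qid ac] by blast
  moreover have "ascending_chain R Q' (length as)" using Cons.IH[OF _ Q'(1,3)] Cons.prems by simp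
  ultimately show ?case using Cons.prems(2) by auto
qed simp

text \<open>\<open>u\<close> begins with a monomial in later indeterminates only, so every term of
  \<open>as ! i \<otimes> c\<close> is lexicographically larger, whatever indeterminates
  \<open>c\<close> involves. Multiplication by a power of \<open>as ! i\<close> preserves the
  comparison. Hypothesis \<open>gen\<close> is what makes \<open>c\<close> the value of a
  polynomial.\<close>

lemma boundary_monoid_submonic:
  fixes K :: "('k, 'm) ring_scheme"
  assumes K: "cring K" and \<phi>: "\<phi> \<in> ring_hom K R" and as: "set as \<subseteq> carrier R" "length as = n"
    and gen: "carrier R \<subseteq> generate_ring R (\<phi> ` carrier K \<union> set as)"
    and i: "i \<le> n" and s: "s \<in> boundary_monoid (drop i as)"
  shows "\<exists>m g. set_mset m \<subseteq> {i..<n} \<and> g \<in> poly_span K \<phi> as n {t. (m, t) \<in> lex_ordering \<and> t \<noteq> m}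
    \<and> s = power_product ((!) as) n (count m) \<oplus> g"
  using i s
proof (induction i arbitrary: s rule: inc_induct)
  case base
  then have "s = \<one>" using as by simp
  moreover have "\<one> = power_product ((!) as) n (count {#}) \<oplus> \<zero>"
    unfolding power_product_empty[OF K \<phi> as] by simp
  ultimately have "s = power_product ((!) as) n (count {#}) \<oplus> \<zero>" by (rule trans)
  then show ?case by (intro exI[of _ "{#}"] exI[of _ \<zero>] conjI poly_span.zero; (assumption | simp))
next
  case (step i)
  have drop: "drop i as = as ! i # drop (Suc i) as" using step as by (simp add: Cons_nth_drop_Suc)
  let ?a = "as ! i"
  let ?v = "\<lambda>t. power_product ((!) as) n (count t)"
  let ?gt = "\<lambda>m. {t. (m, t) \<in> lex_ordering \<and> t \<noteq> m}"
  note ps = poly_span_closed[OF K \<phi> as]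
  obtain k u c where ku: "s = ?a [^] (k::nat) \<otimes> (u \<oplus> ?a \<otimes> c)" "u \<in> boundary_monoid (drop (Suc i) as)" "c \<in> carrier R"
    using step.prems unfolding drop by auto
  obtain m g where mg: "set_mset m \<subseteq> {Suc i..<n}" "g \<in> poly_span K \<phi> as n (?gt m)" "u = ?v m \<oplus> g"
    using step.IH[OF ku(2)] by blast
  have ac: "?a \<in> carrier R" using as step by auto
  have vc: "?v t \<in> carrier R" for t by (rule power_product_nth_closed[OF K \<phi> as])
  interpret K: cring K by (rule K)
  have x: "\<phi> \<one>\<^bsub>K\<^esub> \<otimes> ?v {#i#} = ?a"
    using power_product_single[OF K \<phi> as, of i] ring_hom_one[OF \<phi>] ac step by simp
  have "c \<in> poly_span K \<phi> as n UNIV"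
    using generate_ring_subset_poly_span[OF K \<phi> as] gen ku(3) by auto
  then have "?a \<otimes> c \<in> poly_span K \<phi> as n (range ((+) {#i#}))"
    using poly_span_mult_term[OF K \<phi> as, of c UNIV "\<one>\<^bsub>K\<^esub>" "{#i#}"] x step by simp
  moreover have "range ((+) {#i#}) \<subseteq> ?gt m"
  proof
    fix x assume "x \<in> range ((+) {#i#})"
    then have xi: "count x i > 0" by auto
    have mi: "count m j = 0" if "j \<le> i" for j
    proof -
      have "j \<notin># m" using mg(1) that by auto
      then show ?thesis by (simp add: not_in_iff)
    qed
    have "(m, x) \<in> lex_ordering"
    proof (rule ccontr)
      assume no: "(m, x) \<notin> lex_ordering"
      have "total_on UNIV lex_ordering" "refl lex_ordering"
        using monomial_ordering_lex_ordering
        by (auto simp: monomial_ordering_def linear_order_on_def partial_order_on_def preorder_on_def)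
      then have "(x, m) \<in> lex_ordering" using no by (metis UNIV_I total_on_def refl_onD)
      then consider "x = m" | j where "count x j < count m j" "\<forall>l<j. count x l = count m l"
        unfolding lex_ordering_def by auto
      then show False
      proof cases
        case 1
        then show ?thesis using xi mi[OF order_refl] by (simp only:)
      next
        case 2
        then have "j > i" using mi[of j] by (metis not_le not_less0)
        then show ?thesis using 2 xi mi[of i] by auto
      qed
    qed
    moreover have "x \<noteq> m" using xi mi[OF order_refl] by (metis less_irrefl)
    ultimately show "x \<in> ?gt m" by simp
  qed
  ultimately have "?a \<otimes> c \<in> poly_span K \<phi> as n (?gt m)" by (rule poly_span_mono[OF K \<phi> as])
  then have g': "g \<oplus> ?a \<otimes> c \<in> poly_span K \<phi> as n (?gt m)"
    using mg by (intro poly_span_add[OF K \<phi> as])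
  define e where "e = replicate_mset k i"
  have e: "set_mset e \<subseteq> {..<n}" "?v e = ?a [^] k"
  proof -
    show "set_mset e \<subseteq> {..<n}" using step by (auto simp: e_def)
    show "?v e = ?a [^] k" unfolding e_def
    proof (induction k)
      case 0
      then show ?case using power_product_empty[OF K \<phi> as] by (simp only: replicate_mset_0 nat_pow_0)
    next
      case (Suc k)
      have "?v (replicate_mset (Suc k) i) = ?v (replicate_mset k i + {#i#})" by simp
      also have "\<dots> = ?v (replicate_mset k i) \<otimes> ?v {#i#}" by (rule power_product_union[OF K \<phi> as])
      also have "?v (replicate_mset k i) = ?a [^] k" by (rule Suc)
      also have "?v {#i#} = ?a" by (rule power_product_single[OF K \<phi> as step(2)])
      finally show ?case by (simp only: nat_pow_Suc)
    qed
  qed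
  define h where "h = (\<phi> \<one>\<^bsub>K\<^esub> \<otimes> ?v e) \<otimes> (g \<oplus> ?a \<otimes> c)"
  have "h \<in> poly_span K \<phi> as n ((+) e ` ?gt m)" unfolding h_def
    using g' e by (intro poly_span_mult_term[OF K \<phi> as]) auto
  moreover have "(+) e ` ?gt m \<subseteq> ?gt (e + m)"
    using monomial_ordering_lex_ordering by (auto simp: monomial_ordering_def)
  ultimately have h: "h \<in> poly_span K \<phi> as n (?gt (e + m))" by (rule poly_span_mono[OF K \<phi> as])
  have gc: "g \<in> carrier R" using mg(2) ps by blast
  have "s = ?v e \<otimes> (?v m \<oplus> (g \<oplus> ?a \<otimes> c))"
    using ku mg e gc vc ac by (simp add: a_assoc)
  also have "\<dots> = ?v (e + m) \<oplus> h"
    unfolding h_def power_product_union[OF K \<phi> as] using ring_hom_one[OF \<phi>] vc gc ac ku by (simp add: r_distr)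
  finally have "s = ?v (e + m) \<oplus> h" .
  moreover have "set_mset (e + m) \<subseteq> {i..<n}" using mg step by (auto simp: e_def)
  ultimately show ?case using h by blast
qed

lemma chain_of_lex_independent:
  fixes K :: "('k, 'm) ring_scheme"
  assumes K: "cring K" and \<phi>: "\<phi> \<in> ring_hom K R" and as: "set as \<subseteq> carrier R"
    and gen: "carrier R \<subseteq> generate_ring R (\<phi> ` carrier K \<union> set as)"
    and indep: "\<not> algebraically_dependent_wrt lex_ordering K R \<phi> as"
  obtains P where "ascending_chain R P (length as)"
proof -
  interpret K: cring K by (rule K)
  define n where "n = length as"
  have len: "length as = n" by (simp add: n_def)
  have "\<zero> \<notin> boundary_monoid as"
  proof
    assume "\<zero> \<in> boundary_monoid as"
    then have "\<zero> \<in> boundary_monoid (drop 0 as)" by simp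
    then obtain m g where mg: "set_mset m \<subseteq> {0..<n}" "g \<in> poly_span K \<phi> as n {t. (m, t) \<in> lex_ordering \<and> t \<noteq> m}"
      "\<zero> = power_product ((!) as) n (count m) \<oplus> g"
      using boundary_monoid_submonic[OF K \<phi> as len gen, of 0 \<zero>] by blast
    let ?S = "{t. (m, t) \<in> lex_ordering}"
    have vc: "power_product ((!) as) n (count m) \<in> carrier R" by (rule power_product_nth_closed[OF K \<phi> as len])
    obtain f where f: "f \<in> K.indexed_pset {..<n} (carrier K)"
      "{t. f t \<noteq> \<zero>\<^bsub>K\<^esub>} \<subseteq> {t. (m, t) \<in> lex_ordering \<and> t \<noteq> m}" "poly_value K R \<phi> f as = g"
      using poly_span_imp_poly_value[OF K \<phi> as len mg(2)] by blast
    note f' = K.indexed_pset_finite_support[OF f(1)]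
    define T where "T = {t. f t \<noteq> \<zero>\<^bsub>K\<^esub>}"
    have fm: "f m = \<zero>\<^bsub>K\<^esub>" "m \<notin> T" using f(2) by (auto simp: T_def)
    \<comment> \<open>\<open>f\<close> has no term at \<open>m\<close>, so this inserts the trailing
      term with coefficient one.\<close>
    define h where "h = f(m := \<one>\<^bsub>K\<^esub>)"
    have T: "finite (insert m T)" "\<And>t. t \<in> insert m T \<Longrightarrow> set_mset t \<subseteq> {..<n}"
      using f' mg by (auto simp: T_def atLeast0LessThan)
    have h: "h \<in> K.indexed_pset {..<n} (carrier K)"
      by (rule K.indexed_psetI[OF T(1)]) (use f' T in \<open>auto simp: h_def T_def split: if_splits\<close>)
    have hU: "h \<in> K.indexed_pset UNIV (carrier K)"
      by (rule K.indexed_psetI[OF T(1)]) (use f' T in \<open>auto simp: h_def T_def split: if_splits\<close>)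
    let ?v = "\<lambda>t. power_product ((!) as) n (count t)"
    have vc: "?v t \<in> carrier R" for t by (rule power_product_nth_closed[OF K \<phi> as len])
    have hc: "\<phi> (h t) \<otimes> ?v t \<in> carrier R" for t
      using K.indexed_pset_finite_support(2)[OF h] ring_hom_closed[OF \<phi>] vc by simp
    have fvc: "\<phi> (f t) \<otimes> ?v t \<in> carrier R" for t
      using f' ring_hom_closed[OF \<phi>] vc by simp
    have "poly_value K R \<phi> h as = (\<Oplus>t\<in>insert m T. \<phi> (h t) \<otimes> ?v t)"
      by (rule poly_value_eq_finsum[OF K.ring_axioms \<phi> as len h T(1) _ T(2)]) (auto simp: h_def T_def)
    also have "\<dots> = \<phi> (h m) \<otimes> ?v m \<oplus> (\<Oplus>t\<in>T. \<phi> (h t) \<otimes> ?v t)"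
      using T(1) hc fm by (intro finsum_insert) auto
    also have "(\<Oplus>t\<in>T. \<phi> (h t) \<otimes> ?v t) = (\<Oplus>t\<in>T. \<phi> (f t) \<otimes> ?v t)"
      using fvc fm by (intro finsum_cong') (auto simp: h_def)
    also have "\<dots> = g" unfolding f(3)[symmetric]
      using T by (intro poly_value_eq_finsum[OF K.ring_axioms \<phi> as len f(1), symmetric]) (auto simp: T_def)
    also have "\<phi> (h m) \<otimes> ?v m \<oplus> g = \<zero>"
      using ring_hom_one[OF \<phi>] vc mg(3) by (simp add: h_def)
    finally have h0: "poly_value K R \<phi> h as = \<zero>" .
    have "submonic_wrt lex_ordering K h"
      unfolding submonic_wrt_def
    proof (intro conjI hU)
      show "carrier K = {\<zero>\<^bsub>K\<^esub>} \<or> (\<exists>m. h m \<noteq> \<zero>\<^bsub>K\<^esub> \<and> (\<forall>m'. h m' \<noteq> \<zero>\<^bsub>K\<^esub> \<longrightarrow> (m, m') \<in> lex_ordering) \<and> h m = \<one>\<^bsub>K\<^esub>)"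
      \<comment> \<open>Over the zero ring \<open>h\<close> is the zero polynomial, which counts as
        submonic there.\<close>
      proof (cases "\<one>\<^bsub>K\<^esub> = \<zero>\<^bsub>K\<^esub>")
        case True
        then show ?thesis using K.carrier_one_zero by blast
      next
        case False
        have "(m, t) \<in> lex_ordering" if "h t \<noteq> \<zero>\<^bsub>K\<^esub>" for t
          using that f(2) by (cases "t = m") (auto simp: h_def lex_ordering_def)
        then show ?thesis using False by (intro disjI2 exI[of _ m]) (auto simp: h_def)
      qed
    qed
    then show False using indep h h0 len unfolding algebraically_dependent_wrt_def by auto
  qed
  then have "{\<zero>} \<inter> boundary_monoid as = {}" by simp
  then obtain Q where Q: "primeideal Q R" "Q \<inter> boundary_monoid as = {}"
    using exists_prime_disjoint[OF zeroideal boundary_monoid_closed[OF as] one_in_boundary_monoid[OF as] boundary_monoid_mult[OF as]]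
    by metis
  then show ?thesis using that chain_avoiding_boundary_monoid[OF as] by blast
qed

end

section \<open>Lifting primes to finitely generated extensions\<close>

definition contraction :: "('a, 'm) ring_scheme \<Rightarrow> ('a \<Rightarrow> 'b) \<Rightarrow> 'b set \<Rightarrow> 'a set" where
  "contraction R h Q = {x \<in> carrier R. h x \<in> Q}"

lemma (in ring_hom_cring) contraction_ideal: "ideal Q S \<Longrightarrow> ideal (contraction R h Q) R"
  unfolding contraction_def by (rule ring.ideal_vimage)

lemma (in ring_hom_cring) contraction_prime:
  assumes "primeideal Q S"
  shows "primeideal (contraction R h Q) R"
proof (rule primeidealI)
  show "ideal (contraction R h Q) R"
    by (rule contraction_ideal[OF S.prime_ideal[OF assms]])
  have "\<one> \<notin> contraction R h Q" using S.prime_one[OF assms] by (simp add: contraction_def)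
  then show "carrier R \<noteq> contraction R h Q" by auto
  show "a \<in> contraction R h Q \<or> b \<in> contraction R h Q"
    if "a \<in> carrier R" "b \<in> carrier R" "a \<otimes>\<^bsub>R\<^esub> b \<in> contraction R h Q" for a b
    using that S.prime_mult[OF assms, of "h a" "h b"] by (auto simp: contraction_def)
qed (rule R.is_cring)

text \<open>An elementwise form of Chevalley's theorem on images: among the primes over the contraction of
  \<open>Q0\<close>, those in a nonempty open set lift.\<close>

definition lifts_primes :: "('a, 'm) ring_scheme \<Rightarrow> ('b, 'n) ring_scheme \<Rightarrow> ('a \<Rightarrow> 'b) \<Rightarrow> bool" where
  "lifts_primes R S h \<longleftrightarrow> (\<forall>Q0 u. primeideal Q0 S \<and> u \<in> carrier S \<and> u \<notin> Q0 \<longrightarrow>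
     (\<exists>d\<in>carrier R. h d \<notin> Q0 \<and>
       (\<forall>P. primeideal P R \<and> contraction R h Q0 \<subseteq> P \<and> d \<notin> P \<longrightarrow>
         (\<exists>Q. primeideal Q S \<and> Q0 \<subseteq> Q \<and> u \<notin> Q \<and> contraction R h Q = P))))"

lemma lifts_primesE:
  assumes "lifts_primes R S h" "primeideal Q0 S" "u \<in> carrier S" "u \<notin> Q0"
  obtains d where "d \<in> carrier R" "h d \<notin> Q0"
    "\<And>P. \<lbrakk>primeideal P R; contraction R h Q0 \<subseteq> P; d \<notin> P\<rbrakk> \<Longrightarrow>
      \<exists>Q. primeideal Q S \<and> Q0 \<subseteq> Q \<and> u \<notin> Q \<and> contraction R h Q = P"
  using assms unfolding lifts_primes_def by metis

section \<open>Polynomials in one indeterminate modulo a prime\<close>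

context UP_cring
begin

sublocale P: cring P
  by (rule UP_cring)

definition const :: "'a \<Rightarrow> nat \<Rightarrow> 'a" where
  "const c = up_ring.monom P c 0"

text \<open>The extension of the ideal \<open>I\<close> to the polynomial ring.\<close>

definition coeff_extension :: "'a set \<Rightarrow> (nat \<Rightarrow> 'a) set" where
  "coeff_extension I = {f \<in> carrier P. \<forall>i. up_ring.coeff P f i \<in> I}"

text \<open>\<open>a\<close> is the degree of the image of \<open>f\<close> in \<open>(R/p)[x]\<close>.\<close>

definition degree_mod :: "'a set \<Rightarrow> (nat \<Rightarrow> 'a) \<Rightarrow> nat \<Rightarrow> bool" where
  "degree_mod p f a \<longleftrightarrow> f \<in> carrier P \<and> up_ring.coeff P f a \<notin> p \<and> (\<forall>i>a. up_ring.coeff P f i \<in> p)"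

lemma const_closed [simp]: "c \<in> carrier R \<Longrightarrow> const c \<in> carrier P"
  by (simp add: const_def)

lemma const_hom: "const \<in> ring_hom R P"
  using const_ring_hom by (simp add: const_def[abs_def])

lemma const_hom_cring: "ring_hom_cring R P const"
  by (rule RingHom.ring_hom_cringI[OF ring_hom_ringI2[OF R.ring_axioms P.ring_axioms const_hom]])
    (rule R.is_cring P.is_cring)+

lemma coeff_const: "c \<in> carrier R \<Longrightarrow> up_ring.coeff P (const c) i = (if i = 0 then c else \<zero>)"
  by (auto simp: const_def)

lemma coeff_monom_mult_le:
  assumes "c \<in> carrier R" "f \<in> carrier P" "n \<le> i"
  shows "up_ring.coeff P (up_ring.monom P c n \<otimes>\<^bsub>P\<^esub> f) i = c \<otimes> up_ring.coeff P f (i - n)"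
  using coeff_monom_mult[OF assms(1,2), of n "i - n"] assms(3) by simp

lemma coeff_const_mult:
  assumes "c \<in> carrier R" "f \<in> carrier P"
  shows "up_ring.coeff P (const c \<otimes>\<^bsub>P\<^esub> f) i = c \<otimes> up_ring.coeff P f i"
  using coeff_monom_mult_le[OF assms, of 0 i] by (simp add: const_def)

lemma coeff_mult_in_ideal:
  assumes p: "ideal p R" and f: "f \<in> carrier P" "\<forall>i>a. up_ring.coeff P f i \<in> p"
    and g: "g \<in> carrier P" "\<forall>i>b. up_ring.coeff P g i \<in> p" and k: "k > a + b"
  shows "up_ring.coeff P (f \<otimes>\<^bsub>P\<^esub> g) k \<in> p"
proof -
  have "up_ring.coeff P f i \<otimes> up_ring.coeff P g (k - i) \<in> p" if "i \<le> k" for i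
  proof (cases "i > a")
    case True
    then show ?thesis using f g by (intro R.ideal_mult'[OF p]) auto
  next
    case False
    then have "k - i > b" using k by simp
    then show ?thesis using f g by (intro R.ideal_mult[OF p]) auto
  qed
  then show ?thesis unfolding coeff_mult[OF f(1) g(1)] by (intro R.ideal_finsum[OF p]) auto
qed

text \<open>Degrees add because the residue ring modulo \<open>p\<close> is a domain.\<close>

lemma degree_mod_mult:
  assumes p: "primeideal p R" and f: "degree_mod p f a" and g: "degree_mod p g b"
  shows "degree_mod p (f \<otimes>\<^bsub>P\<^esub> g) (a + b)"
proof -
  note pid = R.prime_ideal[OF p]
  have fg: "f \<in> carrier P" "g \<in> carrier P" using f g by (auto simp: degree_mod_def)
  have c: "up_ring.coeff P f i \<in> carrier R" "up_ring.coeff P g i \<in> carrier R" for i using fg by auto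
  have split: "{..a + b} = insert a ({..a + b} - {a})" by auto
  have "up_ring.coeff P (f \<otimes>\<^bsub>P\<^esub> g) (a + b) =
      up_ring.coeff P f a \<otimes> up_ring.coeff P g b \<oplus> (\<Oplus>i\<in>{..a + b} - {a}. up_ring.coeff P f i \<otimes> up_ring.coeff P g (a + b - i))"
      (is "?y = ?x \<oplus> ?s")
    unfolding coeff_mult[OF fg] using c by (subst split, subst R.finsum_insert) auto
  moreover have "?s \<in> p"
  proof (rule R.ideal_finsum[OF pid])
    fix i assume i: "i \<in> {..a + b} - {a}"
    show "up_ring.coeff P f i \<otimes> up_ring.coeff P g (a + b - i) \<in> p"
    proof (cases "i > a")
      case True
      then show ?thesis using f c by (intro R.ideal_mult'[OF pid]) (auto simp: degree_mod_def)
    next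
      case False
      then have "a + b - i > b" using i by auto
      then show ?thesis using g c by (intro R.ideal_mult[OF pid]) (auto simp: degree_mod_def)
    qed
  qed simp
  moreover have "?x \<notin> p"
    using R.prime_mult[OF p] c f g unfolding degree_mod_def by blast
  ultimately have "?y \<notin> p"
  proof -
    assume y: "?y = ?x \<oplus> ?s" and s: "?s \<in> p" and x: "?x \<notin> p"
    have "?s \<in> carrier R" using s R.ideal_subset[OF pid] by blast
    then have "?y = ?s \<oplus> ?x" using y c by (simp add: R.a_comm)
    then show ?thesis using R.ideal_add_cancel[OF pid _ s, of ?x] x c by auto
  qed
  then show ?thesis
    using coeff_mult_in_ideal[OF pid, of f a g b] f g fg by (auto simp: degree_mod_def)
qed

lemma exists_degree_mod:
  assumes p: "ideal p R" and f: "f \<in> carrier P" "f \<notin> coeff_extension p"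
  obtains a where "degree_mod p f a"
proof -
  let ?A = "{i. up_ring.coeff P f i \<notin> p}"
  have "?A \<subseteq> {..deg R f}"
  proof
    fix i assume "i \<in> ?A"
    then have "up_ring.coeff P f i \<noteq> \<zero>" using R.ideal_zero[OF p] by auto
    then show "i \<in> {..deg R f}" using deg_aboveD[OF _ f(1), of i] by (auto simp: not_le[symmetric])
  qed
  then have fin: "finite ?A" by (rule finite_subset) simp
  have ne: "?A \<noteq> {}" using f by (auto simp: coeff_extension_def)
  define m where "m = Max ?A"
  have m: "m \<in> ?A" unfolding m_def by (rule Max_in[OF fin ne])
  have "up_ring.coeff P f i \<in> p" if "i > m" for i
  proof (rule ccontr)
    assume "up_ring.coeff P f i \<notin> p"
    then have "i \<le> m" unfolding m_def by (intro Max_ge[OF fin]) simp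
    then show False using that by simp
  qed
  then have "degree_mod p f m" using m f(1) by (simp add: degree_mod_def)
  then show ?thesis by (rule that)
qed

lemma degree_mod_not_extension: "degree_mod p f a \<Longrightarrow> f \<notin> coeff_extension p"
  by (auto simp: degree_mod_def coeff_extension_def)

lemma coeff_extension_ideal:
  assumes I: "ideal I R"
  shows "ideal (coeff_extension I) P"
proof (rule P.idealI')
  show "f \<otimes>\<^bsub>P\<^esub> g \<in> coeff_extension I" if fg: "g \<in> coeff_extension I" "f \<in> carrier P" for g f
  proof -
    have g: "g \<in> carrier P" "\<And>i. up_ring.coeff P g i \<in> I" using fg by (auto simp: coeff_extension_def)
    have "up_ring.coeff P (f \<otimes>\<^bsub>P\<^esub> g) n \<in> I" for n
      unfolding coeff_mult[OF fg(2) g(1)]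
      using g fg(2) by (intro R.ideal_finsum[OF I] R.ideal_mult[OF I]) auto
    then show ?thesis using g fg by (simp add: coeff_extension_def)
  qed
qed (use R.ideal_zero[OF I] R.ideal_add[OF I] in \<open>auto simp: coeff_extension_def\<close>)

lemma coeff_extension_prime:
  assumes p: "primeideal p R"
  shows "primeideal (coeff_extension p) P"
proof (rule primeidealI)
  note pid = R.prime_ideal[OF p]
  show "ideal (coeff_extension p) P" by (rule coeff_extension_ideal[OF pid])
  have "\<one>\<^bsub>P\<^esub> \<notin> coeff_extension p" using R.prime_one[OF p] by (auto simp: coeff_extension_def)
  then show "carrier P \<noteq> coeff_extension p" by auto
  fix f g assume fg: "f \<in> carrier P" "g \<in> carrier P" "f \<otimes>\<^bsub>P\<^esub> g \<in> coeff_extension p"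
  show "f \<in> coeff_extension p \<or> g \<in> coeff_extension p"
  proof (rule ccontr)
    assume "\<not> ?thesis"
    then obtain a b where "degree_mod p f a" "degree_mod p g b"
      using exists_degree_mod[OF pid] fg by metis
    then show False using degree_mod_not_extension[OF degree_mod_mult[OF p]] fg by blast
  qed
qed (rule P.is_cring)

lemma coeff_extension_contraction:
  assumes I: "ideal I R"
  shows "contraction R const (coeff_extension I) = I"
  using R.ideal_subset[OF I] R.ideal_zero[OF I]
  by (auto simp: contraction_def coeff_extension_def coeff_const split: if_splits)

lemma coeff_extension_subset:
  assumes J: "ideal J P"
  shows "coeff_extension (contraction R const J) \<subseteq> J"
proof
  fix f assume "f \<in> coeff_extension (contraction R const J)"
  then have f: "f \<in> carrier P" "\<And>i. const (up_ring.coeff P f i) \<in> J"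
    by (auto simp: coeff_extension_def contraction_def)
  have "up_ring.monom P (up_ring.coeff P f i) i \<in> J" for i
  proof -
    have "up_ring.monom P (up_ring.coeff P f i \<otimes> \<one>) (0 + i) = const (up_ring.coeff P f i) \<otimes>\<^bsub>P\<^esub> up_ring.monom P \<one> i"
      unfolding const_def using f(1) by (intro monom_mult) auto
    then have "up_ring.monom P (up_ring.coeff P f i) i = const (up_ring.coeff P f i) \<otimes>\<^bsub>P\<^esub> up_ring.monom P \<one> i" using f(1) by simp
    then show ?thesis using P.ideal_mult'[OF J f(2)[of i], of "up_ring.monom P \<one> i"] by simp
  qed
  then have "(\<Oplus>\<^bsub>P\<^esub>i\<in>{..deg R f}. up_ring.monom P (up_ring.coeff P f i) i) \<in> J"
    by (intro P.ideal_finsum[OF J]) auto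
  then show "f \<in> J" using up_repr[OF f(1)] by simp
qed

text \<open>Division by \<open>g\<close> over the domain \<open>R/p\<close>, with denominators
  cleared by powers of the leading coefficient. The larger ideal \<open>I\<close> records that
  division keeps the remainder in the extension of \<open>I\<close>; the lifting theorem needs this
  with a prime in the role of \<open>I\<close>.\<close>

lemma pseudo_division:
  assumes p: "ideal p R" and I: "ideal I R" "p \<subseteq> I"
    and g: "g \<in> carrier P" "\<forall>i>r. up_ring.coeff P g i \<in> p" and f: "f \<in> coeff_extension I"
  obtains k q h where "q \<in> carrier P" "h \<in> coeff_extension I"
    "const (up_ring.coeff P g r [^] (k::nat)) \<otimes>\<^bsub>P\<^esub> f = q \<otimes>\<^bsub>P\<^esub> g \<oplus>\<^bsub>P\<^esub> h" "\<forall>i\<ge>r. up_ring.coeff P h i \<in> p"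
proof -
  define c where "c = up_ring.coeff P g r"
  have c: "c \<in> carrier R" using g by (simp add: c_def)
  have main: "\<exists>(k::nat) q h. q \<in> carrier P \<and> h \<in> coeff_extension I \<and>
      const (c [^] k) \<otimes>\<^bsub>P\<^esub> f = q \<otimes>\<^bsub>P\<^esub> g \<oplus>\<^bsub>P\<^esub> h \<and> (\<forall>i\<ge>r. up_ring.coeff P h i \<in> p)"
    if "f \<in> coeff_extension I" "\<forall>i\<ge>N. up_ring.coeff P f i \<in> p" for N f
    using that
  proof (induction N arbitrary: f)
    case 0
    have "f \<in> carrier P" using 0 by (simp add: coeff_extension_def)
    then show ?case using 0 g
      by (intro exI[of _ 0] exI[of _ "\<zero>\<^bsub>P\<^esub>"] exI[of _ f]) (simp add: const_def)
  next
    case (Suc N)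
    have fP: "f \<in> carrier P" using Suc.prems by (simp add: coeff_extension_def)
    show ?case
    proof (cases "Suc N \<le> r")
      case True
      then show ?thesis using Suc.prems g fP
        by (intro exI[of _ 0] exI[of _ "\<zero>\<^bsub>P\<^esub>"] exI[of _ f]) (simp add: const_def)
    next
      case False
      then have rN: "r \<le> N" by simp
      define l where "l = up_ring.coeff P f N"
      have l: "l \<in> carrier R" "l \<in> I" using fP Suc.prems by (auto simp: l_def coeff_extension_def)
      define t where "t = up_ring.monom P l (N - r)"
      have tI: "t \<in> coeff_extension I"
        using l R.ideal_zero[OF I(1)] by (auto simp: t_def coeff_extension_def)
      have tP: "t \<in> carrier P" using tI by (simp add: coeff_extension_def)
      \<comment> \<open>The coefficient at \<open>N\<close> cancels, and those above it remain in
        \<open>p\<close>.\<close>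
      define f' where "f' = const c \<otimes>\<^bsub>P\<^esub> f \<ominus>\<^bsub>P\<^esub> t \<otimes>\<^bsub>P\<^esub> g"
      note Iid = coeff_extension_ideal[OF I(1)]
      have f'I: "f' \<in> coeff_extension I" unfolding f'_def
        using Suc.prems(1) tI g c by (intro P.ideal_minus[OF Iid] P.ideal_mult[OF Iid] P.ideal_mult'[OF Iid]) auto
      have f'P: "f' \<in> carrier P" using f'I by (simp add: coeff_extension_def)
      have cf: "up_ring.coeff P f' i = c \<otimes> up_ring.coeff P f i \<ominus> l \<otimes> up_ring.coeff P g (i - (N - r))" if "i \<ge> N" for i
      proof -
        have "up_ring.coeff P f' i = up_ring.coeff P (const c \<otimes>\<^bsub>P\<^esub> f) i \<ominus> up_ring.coeff P (t \<otimes>\<^bsub>P\<^esub> g) i"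
          unfolding f'_def using c fP tP g by (intro coeff_minus) auto
        then show ?thesis unfolding t_def
          using coeff_const_mult[OF c fP] coeff_monom_mult_le[OF l(1) g(1), of "N - r" i] that by simp
      qed
      have "up_ring.coeff P f' i \<in> p" if "i \<ge> N" for i
      proof (cases "i = N")
        case True
        then have "up_ring.coeff P f' i = c \<otimes> l \<ominus> l \<otimes> c" using cf[of N] rN by (simp add: l_def c_def)
        also have "\<dots> = \<zero>" using c l by (simp add: R.m_comm)
        finally show ?thesis using R.ideal_zero[OF p] by simp
      next
        case False
        then have "up_ring.coeff P f i \<in> p" "up_ring.coeff P g (i - (N - r)) \<in> p" using that Suc.prems(2) g(2) rN by auto
        then show ?thesis unfolding cf[OF that] using c l
          by (intro R.ideal_minus[OF p] R.ideal_mult[OF p]) auto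
      qed
      then obtain k q h where *: "q \<in> carrier P" "h \<in> coeff_extension I"
         "const (c [^] (k::nat)) \<otimes>\<^bsub>P\<^esub> f' = q \<otimes>\<^bsub>P\<^esub> g \<oplus>\<^bsub>P\<^esub> h" "\<forall>i\<ge>r. up_ring.coeff P h i \<in> p"
        using Suc.IH[OF f'I] by blast
      define s where "s = const (c [^] k)"
      define u where "u = const c"
      have su: "s \<in> carrier P" "u \<in> carrier P" "const (c [^] Suc k) = s \<otimes>\<^bsub>P\<^esub> u"
        using c ring_hom_mult[OF const_hom] by (auto simp: s_def u_def)
      have hP: "h \<in> carrier P" using * by (simp add: coeff_extension_def)
      have gP: "g \<in> carrier P" and qP: "q \<in> carrier P" by fact+
      have "s \<otimes>\<^bsub>P\<^esub> u \<otimes>\<^bsub>P\<^esub> f = s \<otimes>\<^bsub>P\<^esub> (u \<otimes>\<^bsub>P\<^esub> f \<ominus>\<^bsub>P\<^esub> t \<otimes>\<^bsub>P\<^esub> g) \<oplus>\<^bsub>P\<^esub> (s \<otimes>\<^bsub>P\<^esub> t) \<otimes>\<^bsub>P\<^esub> g"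
        using su tP gP fP by (simp add: P.r_distr P.r_minus P.minus_eq P.m_assoc P.a_assoc P.l_neg)
      also have "s \<otimes>\<^bsub>P\<^esub> (u \<otimes>\<^bsub>P\<^esub> f \<ominus>\<^bsub>P\<^esub> t \<otimes>\<^bsub>P\<^esub> g) = q \<otimes>\<^bsub>P\<^esub> g \<oplus>\<^bsub>P\<^esub> h"
        using *(3) by (simp add: f'_def s_def u_def)
      also have "q \<otimes>\<^bsub>P\<^esub> g \<oplus>\<^bsub>P\<^esub> h \<oplus>\<^bsub>P\<^esub> (s \<otimes>\<^bsub>P\<^esub> t) \<otimes>\<^bsub>P\<^esub> g = (q \<oplus>\<^bsub>P\<^esub> s \<otimes>\<^bsub>P\<^esub> t) \<otimes>\<^bsub>P\<^esub> g \<oplus>\<^bsub>P\<^esub> h"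
        using su tP gP hP qP by (simp add: P.l_distr P.a_ac)
      finally show ?thesis
        using * su tP by (intro exI[of _ "Suc k"] exI[of _ "q \<oplus>\<^bsub>P\<^esub> s \<otimes>\<^bsub>P\<^esub> t"] exI[of _ h]) simp
    qed
  qed
  have "\<forall>i\<ge>Suc (deg R f). up_ring.coeff P f i \<in> p"
    using deg_aboveD[of f] f R.ideal_zero[OF p] by (auto simp: coeff_extension_def)
  from main[OF f this] show ?thesis using that unfolding c_def by (elim exE conjE)
qed

corollary pseudo_division_carrier:
  assumes p: "ideal p R" and g: "g \<in> carrier P" "\<forall>i>r. up_ring.coeff P g i \<in> p" and f: "f \<in> carrier P"
  obtains k q h where "q \<in> carrier P" "h \<in> carrier P"
    "const (up_ring.coeff P g r [^] (k::nat)) \<otimes>\<^bsub>P\<^esub> f = q \<otimes>\<^bsub>P\<^esub> g \<oplus>\<^bsub>P\<^esub> h" "\<forall>i\<ge>r. up_ring.coeff P h i \<in> p"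
proof -
  have "f \<in> coeff_extension (carrier R)" using f by (simp add: coeff_extension_def)
  then obtain q h and k :: nat where *: "q \<in> carrier P" "h \<in> coeff_extension (carrier R)"
    "const (up_ring.coeff P g r [^] k) \<otimes>\<^bsub>P\<^esub> f = q \<otimes>\<^bsub>P\<^esub> g \<oplus>\<^bsub>P\<^esub> h" "\<forall>i\<ge>r. up_ring.coeff P h i \<in> p"
    by (rule pseudo_division[OF p R.oneideal R.ideal_subset[OF p] g])
  moreover have "h \<in> carrier P" using *(2) by (simp add: coeff_extension_def)
  ultimately show ?thesis by (intro that)
qed

text \<open>Over the fraction field of \<open>R/p\<close>, with \<open>p\<close> the contraction of the prime \<open>Q\<close>, the ideal \<open>Q\<close>
  is generated by \<open>g\<close>; hence any strictly larger ideal contains a nonzero constant.\<close>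

lemma larger_ideal_contains_const:
  assumes Q: "primeideal Q P" and p: "p = contraction R const Q" and ne: "Q \<noteq> coeff_extension p"
    and U: "ideal U P" "Q \<subset> U"
  obtains e where "e \<in> carrier R" "const e \<in> U" "e \<notin> p"
proof -
  interpret const: ring_hom_cring R P const by (rule const_hom_cring)
  have pp: "primeideal p R" unfolding p by (rule const.contraction_prime[OF Q])
  note pid = R.prime_ideal[OF pp] and Qid = P.prime_ideal[OF Q]
  have pQ: "coeff_extension p \<subseteq> Q" unfolding p by (rule coeff_extension_subset[OF Qid])
  have constp: "const x \<notin> Q" if "x \<in> carrier R" "x \<notin> p" for x
    using that by (auto simp: p contraction_def)
  define r where "r = (LEAST r. \<exists>g\<in>Q. degree_mod p g r)"
  have "\<exists>r. \<exists>g\<in>Q. degree_mod p g r"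
    using exists_degree_mod[OF pid] pQ ne P.ideal_subset[OF Qid] by (metis subset_antisym subset_iff)
  then obtain g where g: "g \<in> Q" "degree_mod p g r" unfolding r_def by (rule LeastI_ex[THEN bexE])
  have rmin: "r \<le> r'" if "f \<in> Q" "degree_mod p f r'" for f r'
    unfolding r_def by (rule Least_le) (use that in blast)
  \<comment> \<open>Degrees are taken modulo \<open>p\<close>: \<open>g\<close> has least degree in
    \<open>Q\<close>, and \<open>e\<close> will have least degree in \<open>U\<close> outside
    \<open>Q\<close>. The aim is that \<open>e\<close> has degree zero.\<close>
  define b where "b = (LEAST b. \<exists>e\<in>U - Q. degree_mod p e b)"
  have degU: "\<exists>b. degree_mod p e b" if e: "e \<in> U - Q" for e
  proof -
    have "e \<in> carrier P" "e \<notin> coeff_extension p" using e pQ P.ideal_subset[OF U(1)] by auto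
    then show ?thesis by (rule exists_degree_mod[OF pid]) (rule exI)
  qed
  obtain x where "x \<in> U - Q" using U(2) by auto
  then have "\<exists>b. \<exists>e\<in>U - Q. degree_mod p e b" using degU[of x] by auto
  then obtain e where e: "e \<in> U - Q" "degree_mod p e b" unfolding b_def by (rule LeastI_ex[THEN bexE])
  have bmin: "b \<le> b'" if "f \<in> U - Q" "degree_mod p f b'" for f b'
    unfolding b_def by (rule Least_le) (use that in blast)
  have gP: "g \<in> carrier P" "\<forall>i>r. up_ring.coeff P g i \<in> p" "up_ring.coeff P g r \<notin> p"
    and eP: "e \<in> carrier P" "\<forall>i>b. up_ring.coeff P e i \<in> p" "up_ring.coeff P e b \<notin> p"
    using g e by (auto simp: degree_mod_def)
  have "b = 0"
  proof (rule ccontr)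
    assume "b \<noteq> 0"
    \<comment> \<open>The remainder of \<open>e\<close> modulo \<open>g\<close> is again in
      \<open>U\<close> outside \<open>Q\<close> and has degree below \<open>r\<close>, while
      \<open>b\<close> is the least such degree.\<close>
    have br: "b < r"
    proof -
      obtain k q h where *: "q \<in> carrier P" "h \<in> carrier P"
        "const (up_ring.coeff P g r [^] (k::nat)) \<otimes>\<^bsub>P\<^esub> e = q \<otimes>\<^bsub>P\<^esub> g \<oplus>\<^bsub>P\<^esub> h" "\<forall>i\<ge>r. up_ring.coeff P h i \<in> p"
        by (rule pseudo_division_carrier[OF pid gP(1,2) eP(1)])
      have kc: "up_ring.coeff P g r [^] k \<in> carrier R" "up_ring.coeff P g r [^] k \<notin> p"
        using gP R.prime_pow[OF pp] by auto
      have qgQ: "q \<otimes>\<^bsub>P\<^esub> g \<in> Q" using P.ideal_mult[OF Qid g(1) *(1)] .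
      have "const (up_ring.coeff P g r [^] k) \<otimes>\<^bsub>P\<^esub> e \<in> U" using e kc P.ideal_mult[OF U(1)] by simp
      then have "h \<in> U" using P.ideal_add_cancel[OF U(1), of "q \<otimes>\<^bsub>P\<^esub> g" h] qgQ U(2) * by auto
      moreover have "h \<notin> Q"
      proof
        assume "h \<in> Q"
        then have "const (up_ring.coeff P g r [^] k) \<otimes>\<^bsub>P\<^esub> e \<in> Q" using *(3) qgQ P.ideal_add[OF Qid] by simp
        then show False using P.prime_mult[OF Q _ const_closed[OF kc(1)] eP(1)] constp[OF kc] e by blast
      qed
      ultimately obtain b' where b': "degree_mod p h b'" "b \<le> b'" using degU bmin by blast
      then have "b' < r" using *(4) by (auto simp: degree_mod_def not_le[symmetric])
      then show ?thesis using b' by simp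
    qed
    \<comment> \<open>Now \<open>g\<close> is divided by \<open>e\<close>. Minimality of
      \<open>b\<close> puts the remainder into \<open>Q\<close>, and then \<open>q\<close> as well,
      so \<open>q\<close> has degree at least \<open>r\<close>. Its product with \<open>e\<close>
      has degree above \<open>r\<close>, which the degree of \<open>g\<close> forbids.\<close>
    obtain k q h where *: "q \<in> carrier P" "h \<in> carrier P"
      "const (up_ring.coeff P e b [^] (k::nat)) \<otimes>\<^bsub>P\<^esub> g = q \<otimes>\<^bsub>P\<^esub> e \<oplus>\<^bsub>P\<^esub> h" "\<forall>i\<ge>b. up_ring.coeff P h i \<in> p"
      by (rule pseudo_division_carrier[OF pid eP(1,2) gP(1)])
    have kc: "up_ring.coeff P e b [^] k \<in> carrier R" "up_ring.coeff P e b [^] k \<notin> p"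
      using eP R.prime_pow[OF pp] by auto
    have cg: "up_ring.coeff P (q \<otimes>\<^bsub>P\<^esub> e) i \<oplus> up_ring.coeff P h i = up_ring.coeff P e b [^] k \<otimes> up_ring.coeff P g i" for i
    proof -
      have "up_ring.coeff P (q \<otimes>\<^bsub>P\<^esub> e) i \<oplus> up_ring.coeff P h i = up_ring.coeff P (const (up_ring.coeff P e b [^] k) \<otimes>\<^bsub>P\<^esub> g) i"
        unfolding *(3) using *(1,2) eP(1) by (intro coeff_add[symmetric]) auto
      then show ?thesis using coeff_const_mult[OF kc(1) gP(1)] by simp
    qed
    have gQ: "const (up_ring.coeff P e b [^] k) \<otimes>\<^bsub>P\<^esub> g \<in> Q" using P.ideal_mult[OF Qid g(1)] kc by simp
    have "h \<in> U"
    proof (rule P.ideal_add_cancel[OF U(1)])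
      show "q \<otimes>\<^bsub>P\<^esub> e \<oplus>\<^bsub>P\<^esub> h \<in> U" using gQ *(3) U(2) by auto
      show "q \<otimes>\<^bsub>P\<^esub> e \<in> U" using P.ideal_mult[OF U(1) _ *(1)] e by auto
    qed (rule *(2))
    have hQ: "h \<in> Q"
    proof (rule ccontr)
      assume "h \<notin> Q"
      then obtain b' where "degree_mod p h b'" "b \<le> b'" using degU[of h] bmin[of h] \<open>h \<in> U\<close> by blast
      then show False using *(4) by (auto simp: degree_mod_def)
    qed
    have "h \<oplus>\<^bsub>P\<^esub> q \<otimes>\<^bsub>P\<^esub> e \<in> Q" using gQ *(1,2,3) eP(1) by (simp add: P.a_comm)
    then have "q \<otimes>\<^bsub>P\<^esub> e \<in> Q" using P.ideal_add_cancel[OF Qid _ hQ] *(1) eP(1) by auto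
    then have qQ: "q \<in> Q" using P.prime_mult[OF Q] *(1) eP(1) e by blast
    have "q \<notin> coeff_extension p"
    proof
      assume "q \<in> coeff_extension p"
      then have "q \<otimes>\<^bsub>P\<^esub> e \<in> coeff_extension p" using P.ideal_mult'[OF coeff_extension_ideal[OF pid]] eP by blast
      then have "up_ring.coeff P (q \<otimes>\<^bsub>P\<^esub> e) r \<in> p" by (simp add: coeff_extension_def)
      moreover have "up_ring.coeff P h r \<in> p" using *(4) br by simp
      ultimately have "up_ring.coeff P e b [^] k \<otimes> up_ring.coeff P g r \<in> p" using cg[of r] R.ideal_add[OF pid] by metis
      then show False
        using R.prime_mult[OF pp _ kc(1), of "up_ring.coeff P g r"] kc(2) gP(1,3) by auto
    qed
    then obtain a where a: "degree_mod p q a" by (rule exists_degree_mod[OF pid *(1)])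
    have "degree_mod p (q \<otimes>\<^bsub>P\<^esub> e) (a + b)" by (rule degree_mod_mult[OF pp a e(2)])
    then have nin: "up_ring.coeff P (q \<otimes>\<^bsub>P\<^esub> e) (a + b) \<notin> p" by (simp add: degree_mod_def)
    have "a \<ge> r" by (rule rmin[OF qQ a])
    then have "up_ring.coeff P g (a + b) \<in> p" "up_ring.coeff P h (a + b) \<in> p" using gP(2) *(4) \<open>b \<noteq> 0\<close> by auto
    then have "up_ring.coeff P (q \<otimes>\<^bsub>P\<^esub> e) (a + b) \<oplus> up_ring.coeff P h (a + b) \<in> p"
      unfolding cg using kc by (intro R.ideal_mult[OF pid])
    then have "up_ring.coeff P h (a + b) \<oplus> up_ring.coeff P (q \<otimes>\<^bsub>P\<^esub> e) (a + b) \<in> p"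
      using *(1,2) eP(1) by (subst R.a_comm) auto
    then have "up_ring.coeff P (q \<otimes>\<^bsub>P\<^esub> e) (a + b) \<in> p"
      using R.ideal_add_cancel[OF pid _ \<open>up_ring.coeff P h (a + b) \<in> p\<close>] *(1) eP(1) by auto
    then show False using nin by simp
  qed
  show ?thesis
  proof (rule that)
    let ?c = "up_ring.coeff P e 0"
    show c: "?c \<in> carrier R" using eP by simp
    show "?c \<notin> p" using eP(3) \<open>b = 0\<close> by simp
    \<comment> \<open>Being constant modulo \<open>p\<close>, \<open>e\<close> can be exchanged for
      its constant coefficient.\<close>
    have "e \<ominus>\<^bsub>P\<^esub> const ?c \<in> coeff_extension p"
    proof -
      have "up_ring.coeff P (e \<ominus>\<^bsub>P\<^esub> const ?c) i \<in> p" for i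
        using coeff_minus[OF eP(1) const_closed[OF c], of i] eP \<open>b = 0\<close> c R.ideal_zero[OF pid]
        by (cases "i = 0") (auto simp: coeff_const R.minus_eq R.r_neg)
      then show ?thesis using eP c by (simp add: coeff_extension_def)
    qed
    then have "e \<ominus>\<^bsub>P\<^esub> const ?c \<in> U" using pQ U(2) by blast
    then have "e \<ominus>\<^bsub>P\<^esub> (e \<ominus>\<^bsub>P\<^esub> const ?c) \<in> U" using e P.ideal_minus[OF U(1)] by blast
    moreover have "e \<ominus>\<^bsub>P\<^esub> (e \<ominus>\<^bsub>P\<^esub> const ?c) = const ?c"
      using eP const_closed[OF c] by (simp add: P.minus_eq P.minus_add P.a_assoc[symmetric] P.r_neg)
    ultimately show "const ?c \<in> U" by simp
  qed
qed

text \<open>If \<open>Q0\<close> is extended from \<open>p\<close>, a coefficient of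
  \<open>u\<close> outside \<open>p\<close> serves as \<open>d\<close>, and extended primes serve as
  lifts. Otherwise \<open>Q0\<close> is generically generated by one polynomial \<open>g\<close>,
  and \<open>d\<close> is the product of the leading coefficient of \<open>g\<close> modulo
  \<open>p\<close> and a constant outside \<open>p\<close> from the ideal generated by
  \<open>Q0\<close> and \<open>u\<close>.\<close>

theorem lifts_primes_const:
  assumes "noetherian_ring P"
  shows "lifts_primes R P const"
  unfolding lifts_primes_def
proof (intro allI impI, elim conjE)
  interpret P: noetherian_cring P
    by (intro noetherian_cring.intro assms P.is_cring)
  interpret const: ring_hom_cring R P const by (rule const_hom_cring)
  fix Q0 u assume Q0: "primeideal Q0 P" and u: "u \<in> carrier P" "u \<notin> Q0"
  define p where "p = contraction R const Q0"
  have pp: "primeideal p R" unfolding p_def by (rule const.contraction_prime[OF Q0])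
  note pid = R.prime_ideal[OF pp] and Qid = P.prime_ideal[OF Q0]
  have pQ: "coeff_extension p \<subseteq> Q0" unfolding p_def by (rule coeff_extension_subset[OF Qid])
  have constp: "const x \<notin> Q0" if "x \<in> carrier R" "x \<notin> p" for x
    using that by (auto simp: p_def contraction_def)
  show "\<exists>d\<in>carrier R. const d \<notin> Q0 \<and>
       (\<forall>P'. primeideal P' R \<and> contraction R const Q0 \<subseteq> P' \<and> d \<notin> P' \<longrightarrow>
         (\<exists>Q. primeideal Q P \<and> Q0 \<subseteq> Q \<and> u \<notin> Q \<and> contraction R const Q = P'))"
  proof (cases "Q0 = coeff_extension p")
    case True
    then obtain i where i: "up_ring.coeff P u i \<notin> p" using u by (auto simp: coeff_extension_def)
    show ?thesis
    proof (rule bexI[of _ "up_ring.coeff P u i"], intro conjI allI impI)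
      show c: "up_ring.coeff P u i \<in> carrier R" using u by simp
      show "const (up_ring.coeff P u i) \<notin> Q0" by (rule constp[OF c i])
      fix P' assume "primeideal P' R \<and> contraction R const Q0 \<subseteq> P' \<and> up_ring.coeff P u i \<notin> P'"
      then have P': "primeideal P' R" "contraction R const Q0 \<subseteq> P'" "up_ring.coeff P u i \<notin> P'" by auto
      show "\<exists>Q. primeideal Q P \<and> Q0 \<subseteq> Q \<and> u \<notin> Q \<and> contraction R const Q = P'"
      proof (intro exI[of _ "coeff_extension P'"] conjI)
        show "primeideal (coeff_extension P') P" by (rule coeff_extension_prime[OF P'(1)])
        show "Q0 \<subseteq> coeff_extension P'" unfolding True using P'(2) by (auto simp: coeff_extension_def p_def)
        show "u \<notin> coeff_extension P'" using P'(3) by (auto simp: coeff_extension_def)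
        show "contraction R const (coeff_extension P') = P'"
          by (rule coeff_extension_contraction[OF R.prime_ideal[OF P'(1)]])
      qed
    qed
  next
    case False
    define r where "r = (LEAST r. \<exists>g\<in>Q0. degree_mod p g r)"
    have exg: "\<exists>r. degree_mod p f r" if f: "f \<in> Q0" "f \<notin> coeff_extension p" for f
    proof -
      have "f \<in> carrier P" using f P.ideal_subset[OF Qid] by auto
      then show ?thesis using f(2) by (rule exists_degree_mod[OF pid]) (rule exI)
    qed
    obtain f where "f \<in> Q0" "f \<notin> coeff_extension p" using False pQ by auto
    then have "\<exists>r. \<exists>g\<in>Q0. degree_mod p g r" using exg[of f] by auto
    then obtain g where g: "g \<in> Q0" "degree_mod p g r" unfolding r_def by (rule LeastI_ex[THEN bexE])
    have rmin: "r \<le> r'" if "f \<in> Q0" "degree_mod p f r'" for f r'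
      unfolding r_def by (rule Least_le) (use that in blast)
    have gP: "g \<in> carrier P" "\<forall>i>r. up_ring.coeff P g i \<in> p" "up_ring.coeff P g r \<notin> p"
      using g by (auto simp: degree_mod_def)
    define c where "c = up_ring.coeff P g r"
    have c: "c \<in> carrier R" "c \<notin> p" using gP by (simp_all add: c_def)
    \<comment> \<open>In degree zero, \<open>g\<close> would yield the constant \<open>c\<close> in
      \<open>Q0\<close>, although \<open>c\<close> is outside the contraction
      \<open>p\<close>.\<close>
    have r: "r > 0"
    proof (rule ccontr)
      assume "\<not> r > 0"
      then have "r = 0" by simp
      have "g \<ominus>\<^bsub>P\<^esub> const c \<in> coeff_extension p"
      proof -
        have "up_ring.coeff P (g \<ominus>\<^bsub>P\<^esub> const c) i \<in> p" for i
          using coeff_minus[OF gP(1) const_closed[OF c(1)], of i] gP \<open>r = 0\<close> c R.ideal_zero[OF pid]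
          by (cases "i = 0") (auto simp: coeff_const R.minus_eq R.r_neg c_def)
        then show ?thesis using gP c by (simp add: coeff_extension_def)
      qed
      then have "g \<ominus>\<^bsub>P\<^esub> (g \<ominus>\<^bsub>P\<^esub> const c) \<in> Q0" using g pQ P.ideal_minus[OF Qid] by blast
      moreover have "g \<ominus>\<^bsub>P\<^esub> (g \<ominus>\<^bsub>P\<^esub> const c) = const c"
        using gP const_closed[OF c(1)] by (simp add: P.minus_eq P.minus_add P.a_assoc[symmetric] P.r_neg)
      ultimately show False using constp[OF c] by simp
    qed
    define U where "U = P.adjoin_element Q0 u"
    have U: "ideal U P" "Q0 \<subset> U"
      using P.adjoin_element_ideal[OF Qid u(1)] P.subset_adjoin_element[OF Qid u(1)]
        P.mem_adjoin_element[OF Qid u(1)] u(2) by (auto simp: U_def)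
    obtain e where e: "e \<in> carrier R" "const e \<in> U" "e \<notin> p"
      by (rule larger_ideal_contains_const[OF Q0 p_def False U])
    obtain q0 v where qv: "const e = q0 \<oplus>\<^bsub>P\<^esub> v \<otimes>\<^bsub>P\<^esub> u" "q0 \<in> Q0" "v \<in> carrier P"
      using e(2) by (auto simp: U_def P.adjoin_element_def)
    \<comment> \<open>Where \<open>c\<close> is invertible, division by \<open>g\<close> is
      possible; where \<open>e\<close> is invertible, \<open>u\<close> is a unit modulo
      \<open>Q0\<close>, with \<open>v\<close> as inverse up to \<open>e\<close>.\<close>
    show ?thesis
    proof (rule bexI[of _ "c \<otimes> e"], intro conjI allI impI)
      show "c \<otimes> e \<in> carrier R" using c e by simp
      have "c \<otimes> e \<notin> p" using R.prime_mult[OF pp _ c(1) e(1)] c e by blast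
      then show "const (c \<otimes> e) \<notin> Q0" using c e by (intro constp) simp_all
      fix P' assume "primeideal P' R \<and> contraction R const Q0 \<subseteq> P' \<and> c \<otimes> e \<notin> P'"
      then have P': "primeideal P' R" "contraction R const Q0 \<subseteq> P'" "c \<otimes> e \<notin> P'" by auto
      note P'id = R.prime_ideal[OF P'(1)]
      have pP': "p \<subseteq> P'" using P'(2) by (simp add: p_def)
      have cP': "c \<notin> P'" "e \<notin> P'"
        using P'(3) R.ideal_mult[OF P'id] R.ideal_mult'[OF P'id] c e by blast+
      define J where "J = coeff_extension P' <+>\<^bsub>P\<^esub> Q0"
      note P'e = coeff_extension_ideal[OF P'id]
      have Jid: "ideal J P" unfolding J_def by (rule P.add_ideals[OF P'e Qid])
      have J: "coeff_extension P' \<subseteq> J" "Q0 \<subseteq> J"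
      proof -
        show "coeff_extension P' \<subseteq> J"
        proof
          fix x assume x: "x \<in> coeff_extension P'"
          then have "x = x \<oplus>\<^bsub>P\<^esub> \<zero>\<^bsub>P\<^esub>" using P.ideal_subset[OF P'e] by auto
          then show "x \<in> J" using x P.ideal_zero[OF Qid] unfolding J_def set_add_def' by blast
        qed
        show "Q0 \<subseteq> J"
        proof
          fix x assume x: "x \<in> Q0"
          then have "x = \<zero>\<^bsub>P\<^esub> \<oplus>\<^bsub>P\<^esub> x" using P.ideal_subset[OF Qid] by auto
          then show "x \<in> J" using x P.ideal_zero[OF P'e] unfolding J_def set_add_def' by blast
        qed
      qed
      \<comment> \<open>\<open>J\<close> contracts to nothing outside \<open>P'\<close>. Division by
        \<open>g\<close> reduces the summand \<open>f\<close> to degree below \<open>r\<close>, and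
        an element of \<open>Q0\<close> of degree below \<open>r\<close> vanishes modulo
        \<open>p\<close>, so constant coefficients can be compared.\<close>
      have no_const: "s \<in> P'" if s: "s \<in> carrier R" "const s \<in> J" for s
      proof -
        obtain f q where fq: "const s = f \<oplus>\<^bsub>P\<^esub> q" "f \<in> coeff_extension P'" "q \<in> Q0"
          using s(2) unfolding J_def set_add_def' by blast
        have fP: "f \<in> carrier P" and qP: "q \<in> carrier P"
          using fq P.ideal_subset[OF Qid] P.ideal_subset[OF P'e] by auto
        obtain k :: nat and w h where *: "w \<in> carrier P" "h \<in> coeff_extension P'"
          "const (c [^] k) \<otimes>\<^bsub>P\<^esub> f = w \<otimes>\<^bsub>P\<^esub> g \<oplus>\<^bsub>P\<^esub> h" "\<forall>i\<ge>r. up_ring.coeff P h i \<in> p"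
          unfolding c_def by (rule pseudo_division[OF pid P'id pP' gP(1,2) fq(2)])
        have hP: "h \<in> carrier P" using * P.ideal_subset[OF P'e] by auto
        define t where "t = const (c [^] k)"
        have tP: "t \<in> carrier P" using c by (simp add: t_def)
        have ts: "t \<otimes>\<^bsub>P\<^esub> const s = const (c [^] k \<otimes> s)"
          using ring_hom_mult[OF const_hom] c s by (simp add: t_def)
        define z where "z = const (c [^] k \<otimes> s) \<ominus>\<^bsub>P\<^esub> h"
        have zP: "z \<in> carrier P" using c s hP by (simp add: z_def)
        have "z = w \<otimes>\<^bsub>P\<^esub> g \<oplus>\<^bsub>P\<^esub> t \<otimes>\<^bsub>P\<^esub> q"
        proof -
          have "t \<otimes>\<^bsub>P\<^esub> const s = (w \<otimes>\<^bsub>P\<^esub> g \<oplus>\<^bsub>P\<^esub> h) \<oplus>\<^bsub>P\<^esub> t \<otimes>\<^bsub>P\<^esub> q"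
            unfolding fq(1) *(3)[symmetric, folded t_def] using tP fP qP by (simp add: P.r_distr)
          then show ?thesis unfolding z_def ts[symmetric] using *(1) gP(1) hP tP qP
            by (simp add: P.minus_eq P.a_ac P.r_neg P.r_neg1 P.r_neg2)
        qed
        also have "\<dots> \<in> Q0" using g(1) fq(3) *(1) tP by (intro P.ideal_add[OF Qid] P.ideal_mult[OF Qid])
        finally have zQ: "z \<in> Q0" .
        have zi: "up_ring.coeff P z i = (if i = 0 then c [^] k \<otimes> s else \<zero>) \<ominus> up_ring.coeff P h i" for i
        proof -
          have cs: "c [^] k \<otimes> s \<in> carrier R" using c s by simp
          show ?thesis unfolding z_def coeff_minus[OF const_closed[OF cs] hP] coeff_const[OF cs] ..
        qed
        have "z \<in> coeff_extension p"
        proof (rule ccontr)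
          assume "z \<notin> coeff_extension p"
          then obtain b where b: "degree_mod p z b" using exg[OF zQ] by auto
          have "r \<le> b" by (rule rmin[OF zQ b])
          then have "up_ring.coeff P z b \<in> p"
            unfolding zi using *(4) r R.ideal_minus[OF pid R.ideal_zero[OF pid]] by auto
          then show False using b by (simp add: degree_mod_def)
        qed
        then have "up_ring.coeff P z 0 \<in> P'" using pP' by (auto simp: coeff_extension_def)
        then have "(c [^] k \<otimes> s) \<ominus> up_ring.coeff P h 0 \<in> P'" by (simp add: zi)
        moreover have "up_ring.coeff P h 0 \<in> P'" using *(2) by (simp add: coeff_extension_def)
        ultimately have "((c [^] k \<otimes> s) \<ominus> up_ring.coeff P h 0) \<oplus> up_ring.coeff P h 0 \<in> P'"
          by (rule R.ideal_add[OF P'id])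
        then have "c [^] k \<otimes> s \<in> P'" using c s hP by (simp add: R.minus_eq R.a_assoc R.l_neg)
        moreover have "c [^] k \<notin> P'" using R.prime_pow[OF P'(1)] c cP' by blast
        ultimately show ?thesis using R.prime_mult[OF P'(1)] c s by blast
      qed
      \<comment> \<open>Avoiding the constants outside \<open>P'\<close> fixes the contraction, and
        avoiding the powers of \<open>u\<close> keeps \<open>u\<close> out of the lift.\<close>
      define M where "M = {const s \<otimes>\<^bsub>P\<^esub> u [^]\<^bsub>P\<^esub> (k::nat) | s k. s \<in> carrier R - P'}"
      have MI: "x \<in> M" if "x = const s \<otimes>\<^bsub>P\<^esub> u [^]\<^bsub>P\<^esub> (k::nat)" "s \<in> carrier R" "s \<notin> P'" for x s k
        using that by (auto simp: M_def)
      have oneR: "\<one> \<notin> P'" by (rule R.prime_one[OF P'(1)])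
      have constone: "const \<one> = \<one>\<^bsub>P\<^esub>" by (simp add: const_def)
      have "M \<subseteq> carrier P" using u by (auto simp: M_def)
      moreover have "\<one>\<^bsub>P\<^esub> \<in> M" by (rule MI[of _ \<one> 0]) (use oneR constone in auto)
      moreover have "x \<otimes>\<^bsub>P\<^esub> y \<in> M" if xy: "x \<in> M" "y \<in> M" for x y
      proof -
        obtain s k t l where *: "x = const s \<otimes>\<^bsub>P\<^esub> u [^]\<^bsub>P\<^esub> (k::nat)" "s \<in> carrier R" "s \<notin> P'"
          "y = const t \<otimes>\<^bsub>P\<^esub> u [^]\<^bsub>P\<^esub> (l::nat)" "t \<in> carrier R" "t \<notin> P'"
          using xy by (auto simp: M_def)
        show ?thesis
        proof (rule MI)
          show "x \<otimes>\<^bsub>P\<^esub> y = const (s \<otimes> t) \<otimes>\<^bsub>P\<^esub> u [^]\<^bsub>P\<^esub> (k + l)"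
            using * u ring_hom_mult[OF const_hom] by (simp add: P.nat_pow_mult[symmetric] P.m_ac)
          show "s \<otimes> t \<notin> P'" using R.prime_mult[OF P'(1)] * by blast
        qed (use * in simp)
      qed
      moreover have "J \<inter> M = {}"
      proof (rule ccontr)
        assume "J \<inter> M \<noteq> {}"
        then obtain s k where s: "const s \<otimes>\<^bsub>P\<^esub> u [^]\<^bsub>P\<^esub> (k::nat) \<in> J" "s \<in> carrier R" "s \<notin> P'"
          by (auto simp: M_def)
        have q0P: "q0 \<in> carrier P" using qv P.ideal_subset[OF Qid] by auto
        \<comment> \<open>Modulo \<open>J\<close>, the constant \<open>e\<close> is the product of
          \<open>v\<close> and \<open>u\<close>. An element of \<open>M\<close> in \<open>J\<close>
          would therefore put the constant \<open>s \<otimes> e [^] k\<close> into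
          \<open>J\<close>.\<close>
        have "const e \<ominus>\<^bsub>P\<^esub> v \<otimes>\<^bsub>P\<^esub> u = q0"
          unfolding qv(1) using q0P qv u by (simp add: P.minus_eq P.a_assoc P.r_neg)
        then have "const e \<ominus>\<^bsub>P\<^esub> v \<otimes>\<^bsub>P\<^esub> u \<in> J" using J(2) qv by auto
        then have d: "const e [^]\<^bsub>P\<^esub> k \<ominus>\<^bsub>P\<^esub> (v \<otimes>\<^bsub>P\<^esub> u) [^]\<^bsub>P\<^esub> k \<in> J"
          by (rule P.ideal_cong_pow[OF Jid const_closed[OF e(1)] P.m_closed[OF qv(3) u(1)]])
        have "v [^]\<^bsub>P\<^esub> k \<otimes>\<^bsub>P\<^esub> (const s \<otimes>\<^bsub>P\<^esub> u [^]\<^bsub>P\<^esub> k) \<in> J"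
          using P.ideal_mult[OF Jid s(1)] qv by simp
        then have "const s \<otimes>\<^bsub>P\<^esub> (v \<otimes>\<^bsub>P\<^esub> u) [^]\<^bsub>P\<^esub> k \<in> J"
          using qv u s by (simp add: P.nat_pow_distrib P.m_ac)
        moreover have "const s \<otimes>\<^bsub>P\<^esub> (const e [^]\<^bsub>P\<^esub> k \<ominus>\<^bsub>P\<^esub> (v \<otimes>\<^bsub>P\<^esub> u) [^]\<^bsub>P\<^esub> k) \<in> J"
          using P.ideal_mult[OF Jid d] s by simp
        ultimately have "const s \<otimes>\<^bsub>P\<^esub> (const e [^]\<^bsub>P\<^esub> k \<ominus>\<^bsub>P\<^esub> (v \<otimes>\<^bsub>P\<^esub> u) [^]\<^bsub>P\<^esub> k) \<oplus>\<^bsub>P\<^esub> const s \<otimes>\<^bsub>P\<^esub> (v \<otimes>\<^bsub>P\<^esub> u) [^]\<^bsub>P\<^esub> k \<in> J"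
          by (intro P.ideal_add[OF Jid])
        then have "const s \<otimes>\<^bsub>P\<^esub> const e [^]\<^bsub>P\<^esub> k \<in> J"
        proof -
          have "a \<otimes>\<^bsub>P\<^esub> (b \<ominus>\<^bsub>P\<^esub> c) \<oplus>\<^bsub>P\<^esub> a \<otimes>\<^bsub>P\<^esub> c = a \<otimes>\<^bsub>P\<^esub> b"
            if "a \<in> carrier P" "b \<in> carrier P" "c \<in> carrier P" for a b c
            using that by (simp add: P.r_distr[symmetric] P.minus_eq P.a_assoc P.l_neg)
          note this[of "const s" "const e [^]\<^bsub>P\<^esub> k" "(v \<otimes>\<^bsub>P\<^esub> u) [^]\<^bsub>P\<^esub> k"]
          moreover assume "const s \<otimes>\<^bsub>P\<^esub> (const e [^]\<^bsub>P\<^esub> k \<ominus>\<^bsub>P\<^esub> (v \<otimes>\<^bsub>P\<^esub> u) [^]\<^bsub>P\<^esub> k)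
              \<oplus>\<^bsub>P\<^esub> const s \<otimes>\<^bsub>P\<^esub> (v \<otimes>\<^bsub>P\<^esub> u) [^]\<^bsub>P\<^esub> k \<in> J"
          ultimately show ?thesis using s(2) e(1) qv(3) u(1) by (metis P.m_closed P.nat_pow_closed const_closed)
        qed
        moreover have "const s \<otimes>\<^bsub>P\<^esub> const e [^]\<^bsub>P\<^esub> k = const (s \<otimes> e [^] k)"
          using s e ring_hom_mult[OF const_hom] const.hom_pow[of e k] by simp
        ultimately have "const (s \<otimes> e [^] k) \<in> J" by (simp only:)
        then have "s \<otimes> e [^] k \<in> P'" by (rule no_const[rotated]) (use s(2) e(1) in simp)
        then have "s \<in> P' \<or> e [^] k \<in> P'" using R.prime_mult[OF P'(1)] s e by blast
        then show False using s R.prime_pow[OF P'(1)] e cP' by blast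
      qed
      ultimately obtain Q where Q: "primeideal Q P" "J \<subseteq> Q" "Q \<inter> M = {}"
        by (metis P.exists_prime_disjoint[OF Jid])
      show "\<exists>Q. primeideal Q P \<and> Q0 \<subseteq> Q \<and> u \<notin> Q \<and> contraction R const Q = P'"
      proof (intro exI[of _ Q] conjI Q(1))
        show "Q0 \<subseteq> Q" using J Q by auto
        have "u \<in> M" by (rule MI[of _ \<one> 1]) (use oneR constone u in auto)
        then show "u \<notin> Q" using Q by auto
        show "contraction R const Q = P'"
        proof
          show "contraction R const Q \<subseteq> P'"
          proof
            fix s assume s: "s \<in> contraction R const Q"
            show "s \<in> P'"
            proof (rule ccontr)
              assume "s \<notin> P'"
              then have "const s \<in> M" using s by (intro MI[of _ s 0]) (auto simp: contraction_def)
              then show False using s Q(3) by (auto simp: contraction_def)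
            qed
          qed
          show "P' \<subseteq> contraction R const Q"
          proof
            fix s assume s: "s \<in> P'"
            then have "s \<in> contraction R const (coeff_extension P')"
              using coeff_extension_contraction[OF P'id] by simp
            then show "s \<in> contraction R const Q" using J(1) Q(2) by (auto simp: contraction_def)
          qed
        qed
      qed
    qed
  qed
qed

section \<open>Hilbert's basis theorem\<close>

definition leading_ideal :: "(nat \<Rightarrow> 'a) set \<Rightarrow> nat \<Rightarrow> 'a set" where
  "leading_ideal J n = {up_ring.coeff P f n | f. f \<in> J \<and> (\<forall>i>n. up_ring.coeff P f i = \<zero>)}"

lemma leading_ideal_ideal:
  assumes J: "ideal J P"
  shows "ideal (leading_ideal J n) R"
proof (rule R.idealI')
  note Jc = P.ideal_subset[OF J]
  show "leading_ideal J n \<subseteq> carrier R" using Jc by (auto simp: leading_ideal_def)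
  have "up_ring.coeff P \<zero>\<^bsub>P\<^esub> n \<in> leading_ideal J n"
    unfolding leading_ideal_def using P.ideal_zero[OF J]
    by (intro CollectI exI[of _ "\<zero>\<^bsub>P\<^esub>"]) simp
  then show "\<zero> \<in> leading_ideal J n" by simp
  show "x \<oplus> y \<in> leading_ideal J n" if xy: "x \<in> leading_ideal J n" "y \<in> leading_ideal J n" for x y
  proof -
    obtain f g where fg: "f \<in> J" "\<forall>i>n. up_ring.coeff P f i = \<zero>" "x = up_ring.coeff P f n"
      "g \<in> J" "\<forall>i>n. up_ring.coeff P g i = \<zero>" "y = up_ring.coeff P g n"
      using xy by (auto simp: leading_ideal_def)
    then have c: "f \<in> carrier P" "g \<in> carrier P" using Jc by auto
    have "x \<oplus> y = up_ring.coeff P (f \<oplus>\<^bsub>P\<^esub> g) n" using fg c by simp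
    moreover have "f \<oplus>\<^bsub>P\<^esub> g \<in> J" using P.ideal_add[OF J] fg by simp
    moreover have "\<forall>i>n. up_ring.coeff P (f \<oplus>\<^bsub>P\<^esub> g) i = \<zero>" using fg c by simp
    ultimately show ?thesis unfolding leading_ideal_def by blast
  qed
  show "r \<otimes> x \<in> leading_ideal J n" if xr: "x \<in> leading_ideal J n" "r \<in> carrier R" for x r
  proof -
    obtain f where f: "f \<in> J" "\<forall>i>n. up_ring.coeff P f i = \<zero>" "x = up_ring.coeff P f n"
      using xr by (auto simp: leading_ideal_def)
    then have c: "f \<in> carrier P" using Jc by auto
    have "r \<otimes> x = up_ring.coeff P (const r \<otimes>\<^bsub>P\<^esub> f) n" using f coeff_const_mult[OF xr(2) c] by simp
    moreover have "const r \<otimes>\<^bsub>P\<^esub> f \<in> J" using P.ideal_mult[OF J f(1)] xr by simp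
    moreover have "\<forall>i>n. up_ring.coeff P (const r \<otimes>\<^bsub>P\<^esub> f) i = \<zero>"
      using f coeff_const_mult[OF xr(2) c] xr by simp
    ultimately show ?thesis unfolding leading_ideal_def by blast
  qed
qed

lemma leading_ideal_mono: "J \<subseteq> J' \<Longrightarrow> leading_ideal J n \<subseteq> leading_ideal J' n"
  by (auto simp: leading_ideal_def)

lemma leading_ideal_Suc:
  assumes J: "ideal J P"
  shows "leading_ideal J n \<subseteq> leading_ideal J (Suc n)"
proof
  fix x assume "x \<in> leading_ideal J n"
  then obtain f where f: "f \<in> J" "\<forall>i>n. up_ring.coeff P f i = \<zero>" "x = up_ring.coeff P f n"
    by (auto simp: leading_ideal_def)
  then have c: "f \<in> carrier P" using P.ideal_subset[OF J] by auto
  let ?h = "up_ring.monom P \<one> 1 \<otimes>\<^bsub>P\<^esub> f"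
  have h: "up_ring.coeff P ?h i = up_ring.coeff P f (i - 1)" if "i \<ge> 1" for i
    using coeff_monom_mult_le[OF R.one_closed c that] c by simp
  have "?h \<in> J" using P.ideal_mult[OF J f(1)] by simp
  moreover have "\<forall>i>Suc n. up_ring.coeff P ?h i = \<zero>" using h f(2) by auto
  moreover have "x = up_ring.coeff P ?h (Suc n)" using h[of "Suc n"] f(3) by simp
  ultimately show "x \<in> leading_ideal J (Suc n)" unfolding leading_ideal_def by blast
qed

lemma leading_ideal_le:
  assumes "ideal J P" "m \<le> n"
  shows "leading_ideal J m \<subseteq> leading_ideal J n"
  using assms(2) leading_ideal_Suc[OF assms(1)] by (rule lift_Suc_mono_le[rotated])

text \<open>Subtracting an element of \<open>J\<close> with the same coefficient in the top degree
  lowers the degree of a given element of \<open>J'\<close>.\<close>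

lemma subset_of_leading_ideals:
  assumes J: "ideal J P" and J': "ideal J' P" "J \<subseteq> J'"
    and lead: "\<And>n. leading_ideal J' n \<subseteq> leading_ideal J n"
  shows "J' \<subseteq> J"
proof -
  have "f \<in> J" if "f \<in> J'" "\<forall>i\<ge>N. up_ring.coeff P f i = \<zero>" for f N
    using that
  proof (induction N arbitrary: f)
    case 0
    then have "f = \<zero>\<^bsub>P\<^esub>" using P.ideal_subset[OF J'(1)] by (intro up_eqI) auto
    then show ?case using P.ideal_zero[OF J] by simp
  next
    case (Suc N)
    then have "up_ring.coeff P f N \<in> leading_ideal J' N" unfolding leading_ideal_def by auto
    then obtain g where g: "g \<in> J" "\<forall>i>N. up_ring.coeff P g i = \<zero>" "up_ring.coeff P f N = up_ring.coeff P g N"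
      using lead unfolding leading_ideal_def by blast
    have c: "f \<in> carrier P" "g \<in> carrier P"
      using Suc.prems g P.ideal_subset[OF J] P.ideal_subset[OF J'(1)] by auto
    have "f \<ominus>\<^bsub>P\<^esub> g \<in> J"
    proof (rule Suc.IH)
      show "f \<ominus>\<^bsub>P\<^esub> g \<in> J'" using P.ideal_minus[OF J'(1)] Suc.prems g J'(2) by auto
      show "\<forall>i\<ge>N. up_ring.coeff P (f \<ominus>\<^bsub>P\<^esub> g) i = \<zero>"
      proof (intro allI impI)
        fix i assume "N \<le> i"
        then have "up_ring.coeff P f i = up_ring.coeff P g i"
          using Suc.prems(2) g by (cases "i = N") auto
        then show "up_ring.coeff P (f \<ominus>\<^bsub>P\<^esub> g) i = \<zero>" using c by (simp add: R.minus_eq R.r_neg)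
      qed
    qed
    then have "(f \<ominus>\<^bsub>P\<^esub> g) \<oplus>\<^bsub>P\<^esub> g \<in> J" using P.ideal_add[OF J] g by simp
    then show ?case using c by (simp add: P.minus_eq P.a_assoc P.l_neg)
  qed
  moreover have "\<forall>i\<ge>Suc (deg R f). up_ring.coeff P f i = \<zero>" if "f \<in> J'" for f
    using deg_aboveD[of f] that P.ideal_subset[OF J'(1)] by auto
  ultimately show ?thesis by blast
qed

text \<open>A leading ideal that is maximal over all members of the chain and all degrees controls
  every degree from \<open>N\<close> on. Each of the finitely many smaller degrees has its own
  member from which its leading ideal is stable. A member above all of these is the union of the
  chain.\<close>

theorem hilbert_basis:
  assumes "noetherian_ring R"
  shows "noetherian_ring P"
proof (rule P.trivial_ideal_chain_imp_noetherian)
  interpret N: noetherian_cring R by (intro noetherian_cring.intro assms R.is_cring)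
  fix C assume ne: "C \<noteq> {}" and C: "subset.chain {I. ideal I P} C"
  have id: "ideal J P" if "J \<in> C" for J using that C by (auto simp: pred_on.chain_def)
  have total: "J \<subseteq> J' \<or> J' \<subseteq> J" if "J \<in> C" "J' \<in> C" for J J'
    using that C by (auto simp: pred_on.chain_def)
  let ?F = "(\<lambda>(J, n). leading_ideal J n) ` (C \<times> UNIV)"
  have "?F \<noteq> {}" using ne by auto
  then obtain L where L: "L \<in> ?F" "\<And>I. \<lbrakk>I \<in> ?F; L \<subseteq> I\<rbrakk> \<Longrightarrow> I = L"
    by (rule N.ideal_family_has_maximal) (auto intro: leading_ideal_ideal id)
  then obtain J0 N where J0: "J0 \<in> C" "L = leading_ideal J0 N" by auto
  have "\<exists>J\<in>C. \<forall>J'\<in>C. J \<subseteq> J' \<longrightarrow> leading_ideal J' n = leading_ideal J n" for n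
  proof -
    let ?G = "(\<lambda>J. leading_ideal J n) ` C"
    have "?G \<noteq> {}" using ne by auto
    then obtain L where L: "L \<in> ?G" "\<And>I. \<lbrakk>I \<in> ?G; L \<subseteq> I\<rbrakk> \<Longrightarrow> I = L"
      by (rule N.ideal_family_has_maximal) (auto intro: leading_ideal_ideal id)
    then obtain J where "J \<in> C" "L = leading_ideal J n" by auto
    moreover have "leading_ideal J' n = L" if "J' \<in> C" "J \<subseteq> J'" for J'
    proof (rule L(2))
      show "leading_ideal J' n \<in> ?G" using that(1) by (rule imageI)
      show "L \<subseteq> leading_ideal J' n"
        unfolding \<open>L = leading_ideal J n\<close> by (rule leading_ideal_mono[OF that(2)])
    qed
    ultimately show ?thesis by blast
  qed
  then obtain Js where Js: "\<And>n. Js n \<in> C"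
    "\<And>n J'. \<lbrakk>J' \<in> C; Js n \<subseteq> J'\<rbrakk> \<Longrightarrow> leading_ideal J' n = leading_ideal (Js n) n"
    by metis
  define X' where "X' = insert J0 (Js ` {..<N})"
  have "finite X'" "X' \<noteq> {}" "X' \<subseteq> C" using J0 Js by (auto simp: X'_def)
  then have "\<exists>K\<in>C. \<forall>J\<in>X'. J \<subseteq> K"
  proof (induction X' rule: finite_ne_induct)
    case (insert J F)
    then obtain K where K: "K \<in> C" "\<forall>J\<in>F. J \<subseteq> K" by auto
    have JC: "J \<in> C" using insert.prems by simp
    show ?case
    proof (cases "J \<subseteq> K")
      case True
      then show ?thesis using K by (intro bexI[of _ K]) simp_all
    next
      case False
      then have "K \<subseteq> J" using total[OF JC K(1)] by simp
      then show ?thesis using K JC by (intro bexI[of _ J]) auto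
    qed
  qed auto
  then obtain K where K: "K \<in> C" "J0 \<subseteq> K" "\<And>n. n < N \<Longrightarrow> Js n \<subseteq> K" by (auto simp: X'_def)
  have "J \<subseteq> K" if J: "J \<in> C" for J
  proof (cases "J \<subseteq> K")
    case False
    then have KJ: "K \<subseteq> J" using total J K by auto
    show ?thesis
    proof (rule subset_of_leading_ideals[OF id[OF K(1)] id[OF J] KJ])
      fix n
      show "leading_ideal J n \<subseteq> leading_ideal K n"
      proof (cases "n < N")
        case True
        then show ?thesis using Js(2)[OF J, of n] Js(2)[OF K(1), of n] K(3) KJ by auto
      next
        case False
        have "leading_ideal J' n = L" if "J' \<in> C" "J0 \<subseteq> J'" for J'
        proof (rule L(2))
          show "leading_ideal J' n \<in> ?F" using that by auto
          have "L \<subseteq> leading_ideal J' N" unfolding J0(2) by (rule leading_ideal_mono[OF that(2)])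
          also have "\<dots> \<subseteq> leading_ideal J' n" using False by (intro leading_ideal_le id that) simp
          finally show "L \<subseteq> leading_ideal J' n" .
        qed
        then show ?thesis using J K KJ by auto
      qed
    qed
  qed simp
  then have "\<Union>C = K" using K(1) by auto
  then show "\<Union>C \<in> C" using K(1) by simp
qed

end

section \<open>The Jacobson property and its passage to polynomial rings\<close>

definition primes_separated :: "('a, 'm) ring_scheme \<Rightarrow> bool" where
  "primes_separated R \<longleftrightarrow> (\<forall>P u. primeideal P R \<and> u \<in> carrier R \<and> u \<notin> P \<longrightarrow>
     (\<exists>M. maximalideal M R \<and> P \<subseteq> M \<and> u \<notin> M))"

lemma primes_separatedE:
  assumes "primes_separated R" "primeideal P R" "u \<in> carrier R" "u \<notin> P"
  obtains M where "maximalideal M R" "P \<subseteq> M" "u \<notin> M"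
  using assms unfolding primes_separated_def by blast

lemma jacobson_ring_primes_separated: "jacobson_ring R \<Longrightarrow> primes_separated R"
  unfolding jacobson_ring_def primes_separated_def by blast

text \<open>A maximal ideal \<open>M\<close> of \<open>R\<close> missing \<open>d\<close> lifts to a
  prime \<open>Q\<close> over \<open>Q0\<close> that misses \<open>u\<close>. Either
  \<open>Q\<close> is already maximal, or it is the extension of \<open>M\<close>, and the question
  reduces to polynomials over the residue field of \<open>M\<close>.\<close>

theorem (in UP_cring) primes_separated_UP:
  assumes noeth: "noetherian_ring R" and sep: "primes_separated R"
  shows "primes_separated P"
  unfolding primes_separated_def
proof (intro allI impI, elim conjE)
  have noethP: "noetherian_ring P" by (rule hilbert_basis[OF noeth])
  interpret P: noetherian_cring P
    by (intro noetherian_cring.intro noethP P.is_cring)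
  interpret const: ring_hom_cring R P const by (rule const_hom_cring)
  fix Q0 u assume Q0: "primeideal Q0 P" and u: "u \<in> carrier P" "u \<notin> Q0"
  obtain d where d: "d \<in> carrier R" "const d \<notin> Q0"
    "\<And>P'. \<lbrakk>primeideal P' R; contraction R const Q0 \<subseteq> P'; d \<notin> P'\<rbrakk> \<Longrightarrow>
      \<exists>Q. primeideal Q P \<and> Q0 \<subseteq> Q \<and> u \<notin> Q \<and> contraction R const Q = P'"
    by (rule lifts_primesE[OF lifts_primes_const[OF noethP] Q0 u], rule that)
  have "d \<notin> contraction R const Q0" using d by (simp add: contraction_def)
  then obtain M where M: "maximalideal M R" "contraction R const Q0 \<subseteq> M" "d \<notin> M"
    using primes_separatedE[OF sep const.contraction_prime[OF Q0] d(1)] by blast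
  have Mp: "primeideal M R" by (rule R.maximalideal_prime[OF M(1)])
  note Mid = R.prime_ideal[OF Mp]
  obtain Q where Q: "primeideal Q P" "Q0 \<subseteq> Q" "u \<notin> Q" "contraction R const Q = M"
    using d(3)[OF Mp M(2,3)] by blast
  note Qid = P.prime_ideal[OF Q(1)]
  show "\<exists>N. maximalideal N P \<and> Q0 \<subseteq> N \<and> u \<notin> N"
  proof (cases "Q = coeff_extension M")
    case True
    obtain b where b: "degree_mod M u b" using exists_degree_mod[OF Mid u(1)] Q(3) True by blast
    let ?x = "up_ring.monom P \<one> 1"
    \<comment> \<open>Over the residue field, \<open>w\<close> has positive degree even if
      \<open>u\<close> is constant there, so it is no unit. A maximal ideal through \<open>w\<close>
      and \<open>Q\<close> excludes \<open>u\<close>, since otherwise it would contain one.\<close>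
    define w where "w = \<one>\<^bsub>P\<^esub> \<oplus>\<^bsub>P\<^esub> ?x \<otimes>\<^bsub>P\<^esub> u"
    have oneM: "\<one> \<notin> M" by (rule R.prime_one[OF Mp])
    have "degree_mod M ?x 1" using oneM R.ideal_zero[OF Mid] by (auto simp: degree_mod_def)
    then have xu: "degree_mod M (?x \<otimes>\<^bsub>P\<^esub> u) (1 + b)" by (rule degree_mod_mult[OF Mp _ b])
    have wP: "w \<in> carrier P" using u by (simp add: w_def)
    have wi: "up_ring.coeff P w i = up_ring.coeff P (?x \<otimes>\<^bsub>P\<^esub> u) i" if "i \<ge> 1" for i
    proof -
      have "up_ring.coeff P w i = up_ring.coeff P \<one>\<^bsub>P\<^esub> i \<oplus> up_ring.coeff P (?x \<otimes>\<^bsub>P\<^esub> u) i"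
        unfolding w_def using u by (intro coeff_add) auto
      also have "up_ring.coeff P \<one>\<^bsub>P\<^esub> i = \<zero>" using that by simp
      finally show ?thesis using u coeff_closed[of "?x \<otimes>\<^bsub>P\<^esub> u" i] by (simp del: coeff_mult)
    qed
    have w: "degree_mod M w (1 + b)"
      using xu wP wi unfolding degree_mod_def by (simp del: coeff_mult)
    have ad: "ideal (P.adjoin_element Q w) P" by (rule P.adjoin_element_ideal[OF Qid wP])
    have "\<one>\<^bsub>P\<^esub> \<notin> P.adjoin_element Q w"
    proof
      assume "\<one>\<^bsub>P\<^esub> \<in> P.adjoin_element Q w"
      then obtain f v where fv: "\<one>\<^bsub>P\<^esub> = f \<oplus>\<^bsub>P\<^esub> v \<otimes>\<^bsub>P\<^esub> w" "f \<in> Q" "v \<in> carrier P"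
        by (auto simp: P.adjoin_element_def)
      have fP: "f \<in> carrier P" using fv P.ideal_subset[OF Qid] by auto
      have "v \<notin> Q"
      proof
        assume "v \<in> Q"
        then have "\<one>\<^bsub>P\<^esub> \<in> Q" unfolding fv(1) using fv(2) wP
          by (intro P.ideal_add[OF Qid] P.ideal_mult'[OF Qid])
        then show False using P.prime_one[OF Q(1)] by simp
      qed
      then obtain a where a: "degree_mod M v a" using exists_degree_mod[OF Mid fv(3)] True by blast
      define k where "k = a + (1 + b)"
      have vw: "degree_mod M (v \<otimes>\<^bsub>P\<^esub> w) k" unfolding k_def by (rule degree_mod_mult[OF Mp a w])
      have vwP: "v \<otimes>\<^bsub>P\<^esub> w \<in> carrier P" using fv wP by simp
      have "up_ring.coeff P \<one>\<^bsub>P\<^esub> k = up_ring.coeff P f k \<oplus> up_ring.coeff P (v \<otimes>\<^bsub>P\<^esub> w) k"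
        unfolding fv(1) by (rule coeff_add[OF fP vwP])
      then have "up_ring.coeff P f k \<oplus> up_ring.coeff P (v \<otimes>\<^bsub>P\<^esub> w) k = \<zero>" by (simp add: k_def del: coeff_mult)
      then have "up_ring.coeff P f k \<oplus> up_ring.coeff P (v \<otimes>\<^bsub>P\<^esub> w) k \<in> M" using R.ideal_zero[OF Mid] by metis
      moreover have "up_ring.coeff P f k \<in> M" using fv(2) True by (simp add: coeff_extension_def)
      ultimately have "up_ring.coeff P (v \<otimes>\<^bsub>P\<^esub> w) k \<in> M"
        using R.ideal_add_cancel[OF Mid] coeff_closed[OF vwP] by blast
      then show False using vw by (simp add: degree_mod_def del: coeff_mult)
    qed
    then obtain N where N: "maximalideal N P" "P.adjoin_element Q w \<subseteq> N"
      using P.exists_maximal_over[OF ad] by blast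
    have Nid: "ideal N P" and N1: "\<one>\<^bsub>P\<^esub> \<notin> N"
      using P.prime_ideal[OF P.maximalideal_prime[OF N(1)]] P.prime_one[OF P.maximalideal_prime[OF N(1)]] by auto
    have sub: "Q \<subseteq> N" "w \<in> N"
      using N(2) P.subset_adjoin_element[OF Qid wP] P.mem_adjoin_element[OF Qid wP] by auto
    have "u \<notin> N"
    proof
      assume "u \<in> N"
      then have xuN: "?x \<otimes>\<^bsub>P\<^esub> u \<in> N" by (intro P.ideal_mult[OF Nid]) auto
      have "?x \<otimes>\<^bsub>P\<^esub> u \<oplus>\<^bsub>P\<^esub> \<one>\<^bsub>P\<^esub> \<in> N" using sub(2) u unfolding w_def by (simp add: P.a_comm)
      then have "\<one>\<^bsub>P\<^esub> \<in> N" by (rule P.ideal_add_cancel[OF Nid _ xuN]) simp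
      then show False using N1 by simp
    qed
    then show ?thesis using N(1) sub Q(2) by blast
  next
    case False
    \<comment> \<open>A larger ideal contains a constant outside \<open>M\<close>, and by maximality
      of \<open>M\<close> also one.\<close>
    have "maximalideal Q P"
    proof (rule maximalidealI[OF Qid])
      show "carrier P \<noteq> Q" using primeideal.I_notcarr[OF Q(1)] .
      fix J assume J: "ideal J P" "Q \<subseteq> J" "J \<subseteq> carrier P"
      show "J = Q \<or> J = carrier P"
      proof (cases "J = Q")
        case False2: False
        then have QJ: "Q \<subset> J" using J by auto
        have ne: "Q \<noteq> coeff_extension (contraction R const Q)" using False Q(4) by simp
        obtain e where e: "e \<in> carrier R" "const e \<in> J" "e \<notin> contraction R const Q"
          by (rule larger_ideal_contains_const[OF Q(1) refl ne J(1) QJ])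
        have eM: "e \<notin> M" using e Q(4) by simp
        have "R.adjoin_element M e = M \<or> R.adjoin_element M e = carrier R"
          by (rule maximalideal.I_maximal[OF M(1) R.adjoin_element_ideal[OF Mid e(1)]
                R.subset_adjoin_element[OF Mid e(1)] R.ideal_subset[OF R.adjoin_element_ideal[OF Mid e(1)]]])
        then have "\<one> \<in> R.adjoin_element M e" using R.mem_adjoin_element[OF Mid e(1)] eM by auto
        then obtain m r where mr: "\<one> = m \<oplus> r \<otimes> e" "m \<in> M" "r \<in> carrier R"
          by (auto simp: R.adjoin_element_def)
        have mc: "m \<in> carrier R" "const m \<in> Q" using mr(2) Q(4) by (auto simp: contraction_def)
        have "const \<one> = const m \<oplus>\<^bsub>P\<^esub> const r \<otimes>\<^bsub>P\<^esub> const e"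
          unfolding mr(1) using mc mr e by simp
        also have "\<dots> \<in> J" using mc(2) J(2) e mr by (intro P.ideal_add[OF J(1)] P.ideal_mult[OF J(1)]) auto
        finally have "\<one>\<^bsub>P\<^esub> \<in> J" by simp
        then show ?thesis using P.ideal_one[OF J(1)] by simp
      qed simp
    qed
    then show ?thesis using Q by blast
  qed
qed

lemma lifts_primes_cong:
  assumes "\<And>x. x \<in> carrier R \<Longrightarrow> h x = k x"
  shows "lifts_primes R S h \<longleftrightarrow> lifts_primes R S k"
proof -
  have "contraction R h Q = contraction R k Q" for Q using assms by (auto simp: contraction_def)
  moreover have "(\<exists>d\<in>carrier R. h d \<notin> Q \<and> A d) \<longleftrightarrow> (\<exists>d\<in>carrier R. k d \<notin> Q \<and> A d)" for Q and A :: "_ \<Rightarrow> bool"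
    using assms by auto
  ultimately show ?thesis unfolding lifts_primes_def by simp
qed

text \<open>The element found for \<open>k\<close> becomes the element to be avoided in lifting
  along \<open>h\<close>; this is why \<open>lifts_primes\<close> carries the parameter
  \<open>u\<close>.\<close>

lemma lifts_primes_comp:
  assumes R: "ring_hom_cring R S h" and S: "ring_hom_cring S T k"
    and lifts: "lifts_primes R S h" "lifts_primes S T k"
  shows "lifts_primes R T (k \<circ> h)"
  unfolding lifts_primes_def
proof (intro allI impI, elim conjE)
  interpret h: ring_hom_cring R S h by fact
  interpret k: ring_hom_cring S T k by fact
  have comp: "contraction R (k \<circ> h) Q = contraction R h (contraction S k Q)" for Q
    by (auto simp: contraction_def)
  fix Q0 u assume Q0: "primeideal Q0 T" and u: "u \<in> carrier T" "u \<notin> Q0"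
  obtain e where e: "e \<in> carrier S" "k e \<notin> Q0"
    "\<And>P. \<lbrakk>primeideal P S; contraction S k Q0 \<subseteq> P; e \<notin> P\<rbrakk> \<Longrightarrow>
      \<exists>Q. primeideal Q T \<and> Q0 \<subseteq> Q \<and> u \<notin> Q \<and> contraction S k Q = P"
    by (rule lifts_primesE[OF lifts(2) Q0 u], rule that)
  have "e \<notin> contraction S k Q0" using e by (simp add: contraction_def)
  obtain d where d: "d \<in> carrier R" "h d \<notin> contraction S k Q0"
    "\<And>P. \<lbrakk>primeideal P R; contraction R h (contraction S k Q0) \<subseteq> P; d \<notin> P\<rbrakk> \<Longrightarrow>
      \<exists>Q. primeideal Q S \<and> contraction S k Q0 \<subseteq> Q \<and> e \<notin> Q \<and> contraction R h Q = P"
    by (rule lifts_primesE[OF lifts(1) k.contraction_prime[OF Q0] e(1) \<open>e \<notin> contraction S k Q0\<close>], rule that)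
  show "\<exists>d\<in>carrier R. (k \<circ> h) d \<notin> Q0 \<and>
       (\<forall>P. primeideal P R \<and> contraction R (k \<circ> h) Q0 \<subseteq> P \<and> d \<notin> P \<longrightarrow>
         (\<exists>Q. primeideal Q T \<and> Q0 \<subseteq> Q \<and> u \<notin> Q \<and> contraction R (k \<circ> h) Q = P))"
  proof (rule bexI[of _ d], intro conjI allI impI)
    show "(k \<circ> h) d \<notin> Q0" using d(1,2) by (simp add: contraction_def)
    fix P assume P: "primeideal P R \<and> contraction R (k \<circ> h) Q0 \<subseteq> P \<and> d \<notin> P"
    then obtain Q1 where Q1: "primeideal Q1 S" "contraction S k Q0 \<subseteq> Q1" "e \<notin> Q1" "contraction R h Q1 = P"
      using d(3)[of P] unfolding comp by auto
    obtain Q where "primeideal Q T" "Q0 \<subseteq> Q" "u \<notin> Q" "contraction S k Q = Q1"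
      using e(3)[OF Q1(1-3)] by auto
    then show "\<exists>Q. primeideal Q T \<and> Q0 \<subseteq> Q \<and> u \<notin> Q \<and> contraction R (k \<circ> h) Q = P"
      using Q1(4) unfolding comp by auto
  qed (rule d(1))
qed

section \<open>Transfer along surjective homomorphisms\<close>

context ring_hom_cring
begin

context
  assumes surj: "h ` carrier R = carrier S"
begin

lemma image_ideal:
  assumes I: "ideal I R"
  shows "ideal (h ` I) S"
proof (rule S.idealI')
  note Ic = R.ideal_subset[OF I]
  show "h ` I \<subseteq> carrier S" using Ic by auto
  show "\<zero>\<^bsub>S\<^esub> \<in> h ` I" using R.ideal_zero[OF I] hom_zero by (metis imageI)
  show "x \<oplus>\<^bsub>S\<^esub> y \<in> h ` I" if xy: "x \<in> h ` I" "y \<in> h ` I" for x y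
  proof -
    obtain a b where ab: "a \<in> I" "b \<in> I" "x = h a" "y = h b" using xy by auto
    then have "a \<in> carrier R" "b \<in> carrier R" using Ic by auto
    then have "x \<oplus>\<^bsub>S\<^esub> y = h (a \<oplus>\<^bsub>R\<^esub> b)" using ab by simp
    then show ?thesis using R.ideal_add[OF I ab(1,2)] by blast
  qed
  show "r \<otimes>\<^bsub>S\<^esub> x \<in> h ` I" if xr: "x \<in> h ` I" "r \<in> carrier S" for x r
  proof -
    obtain a where a: "a \<in> I" "x = h a" using xr by auto
    have "r \<in> h ` carrier R" using xr surj by simp
    then obtain s where s: "s \<in> carrier R" "r = h s" by auto
    moreover have "a \<in> carrier R" using Ic a by auto
    ultimately have "r \<otimes>\<^bsub>S\<^esub> x = h (s \<otimes>\<^bsub>R\<^esub> a)" using a by simp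
    then show ?thesis using R.ideal_mult[OF I a(1) s(1)] by blast
  qed
qed

lemma image_contraction:
  assumes "Q \<subseteq> carrier S"
  shows "h ` contraction R h Q = Q"
proof
  show "Q \<subseteq> h ` contraction R h Q"
  proof
    fix y assume y: "y \<in> Q"
    then have "y \<in> h ` carrier R" using assms surj by auto
    then show "y \<in> h ` contraction R h Q" using y by (auto simp: contraction_def)
  qed
qed (auto simp: contraction_def)

text \<open>The assumption on \<open>Q0\<close> serves to put the kernel of \<open>h\<close> into
  \<open>I\<close>, in the form in which it is at hand when primes are lifted.\<close>

lemma contraction_image:
  assumes I: "ideal I R" and Q0: "ideal Q0 S" "contraction R h Q0 \<subseteq> I"
  shows "contraction R h (h ` I) = I"
proof
  note Ic = R.ideal_subset[OF I]
  show "I \<subseteq> contraction R h (h ` I)" using Ic by (auto simp: contraction_def)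
  show "contraction R h (h ` I) \<subseteq> I"
  proof
    fix x assume "x \<in> contraction R h (h ` I)"
    then obtain a where a: "x \<in> carrier R" "a \<in> I" "h x = h a" by (auto simp: contraction_def)
    then have ac: "a \<in> carrier R" using Ic by auto
    have "h (x \<ominus>\<^bsub>R\<^esub> a) = \<zero>\<^bsub>S\<^esub>" using a ac by (simp add: R.minus_eq S.r_neg)
    then have "h (x \<ominus>\<^bsub>R\<^esub> a) \<in> Q0" using S.ideal_zero[OF Q0(1)] by (simp only:)
    then have "x \<ominus>\<^bsub>R\<^esub> a \<in> contraction R h Q0"
      unfolding contraction_def using R.minus_closed[OF a(1) ac] by (intro CollectI conjI)
    then have "x \<ominus>\<^bsub>R\<^esub> a \<in> I" using Q0(2) by auto
    then have "(x \<ominus>\<^bsub>R\<^esub> a) \<oplus>\<^bsub>R\<^esub> a \<in> I" using R.ideal_add[OF I] a by simp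
    then show "x \<in> I" using a ac by (simp add: R.minus_eq R.a_assoc R.l_neg)
  qed
qed

lemma image_prime:
  assumes P: "primeideal P R" and Q0: "ideal Q0 S" "contraction R h Q0 \<subseteq> P"
  shows "primeideal (h ` P) S"
proof (rule primeidealI)
  note Pid = R.prime_ideal[OF P]
  note cP = contraction_image[OF Pid Q0]
  show "ideal (h ` P) S" by (rule image_ideal[OF Pid])
  have "\<one>\<^bsub>S\<^esub> \<notin> h ` P"
  proof
    assume "\<one>\<^bsub>S\<^esub> \<in> h ` P"
    then have "\<one>\<^bsub>R\<^esub> \<in> contraction R h (h ` P)" by (simp add: contraction_def)
    then show False using cP R.prime_one[OF P] by simp
  qed
  then show "carrier S \<noteq> h ` P" by auto
  fix a b assume ab: "a \<in> carrier S" "b \<in> carrier S" "a \<otimes>\<^bsub>S\<^esub> b \<in> h ` P"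
  have "a \<in> h ` carrier R" "b \<in> h ` carrier R" using ab surj by auto
  then obtain x y where xy: "x \<in> carrier R" "y \<in> carrier R" "a = h x" "b = h y" by auto
  then have "x \<otimes>\<^bsub>R\<^esub> y \<in> contraction R h (h ` P)" using ab by (simp add: contraction_def)
  then have "x \<in> P \<or> y \<in> P" unfolding cP by (rule R.prime_mult[OF P _ xy(1,2)])
  then show "a \<in> h ` P \<or> b \<in> h ` P" using xy(3,4) by auto
qed (rule S.is_cring)

lemma noetherian_image:
  assumes "noetherian_ring R"
  shows "noetherian_ring S"
proof (rule S.trivial_ideal_chain_imp_noetherian)
  interpret N: noetherian_ring R by fact
  fix C assume C: "C \<noteq> {}" "subset.chain {I. ideal I S} C"
  then have id: "ideal J S" if "J \<in> C" for J using that by (auto simp: pred_on.chain_def)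
  let ?D = "contraction R h ` C"
  have "\<Union>?D \<in> ?D"
  proof (rule N.ideal_chain_is_trivial)
    have mono: "contraction R h I \<subseteq> contraction R h J" if "I \<subseteq> J" for I J
      using that by (auto simp: contraction_def)
    have total: "I \<subseteq> J \<or> J \<subseteq> I" if "I \<in> C" "J \<in> C" for I J
      using that C by (auto simp: pred_on.chain_def)
    have "\<forall>x\<in>?D. \<forall>y\<in>?D. x \<subseteq> y \<or> y \<subseteq> x"
    proof (intro ballI)
      fix x y assume "x \<in> ?D" "y \<in> ?D"
      then obtain I J where "I \<in> C" "x = contraction R h I" "J \<in> C" "y = contraction R h J" by auto
      then show "x \<subseteq> y \<or> y \<subseteq> x" using total[of I J] mono[of I J] mono[of J I] by auto
    qed
    moreover have "?D \<subseteq> {I. ideal I R}" using contraction_ideal id by auto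
    ultimately show "subset.chain {I. ideal I R} ?D" by (auto simp: subset_chain_def)
  qed (use C in simp)
  then obtain J where J: "J \<in> C" "\<Union>?D = contraction R h J" by auto
  have "J' \<subseteq> J" if "J' \<in> C" for J'
  proof -
    have "contraction R h J' \<subseteq> contraction R h J" using J(2) that by auto
    then have "h ` contraction R h J' \<subseteq> h ` contraction R h J" by (rule image_mono)
    then show ?thesis using image_contraction S.ideal_subset[OF id] that J(1) by simp
  qed
  then have "\<Union>C = J" using J(1) by auto
  then show "\<Union>C \<in> C" using J(1) by simp
qed

lemma primes_separated_image:
  assumes "primes_separated R"
  shows "primes_separated S"
  unfolding primes_separated_def
proof (intro allI impI, elim conjE)
  fix Q u assume Q: "primeideal Q S" and u: "u \<in> carrier S" "u \<notin> Q"
  note Qid = S.prime_ideal[OF Q]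
  have "u \<in> h ` carrier R" using u surj by simp
  then obtain x where x: "x \<in> carrier R" "u = h x" by auto
  then have "x \<notin> contraction R h Q" using u by (simp add: contraction_def)
  then obtain M where M: "maximalideal M R" "contraction R h Q \<subseteq> M" "x \<notin> M"
    using primes_separatedE[OF assms contraction_prime[OF Q] x(1)] by blast
  have Mp: "primeideal M R" by (rule R.maximalideal_prime[OF M(1)])
  note Mid = R.prime_ideal[OF Mp]
  note cM = contraction_image[OF Mid Qid M(2)]
  have "maximalideal (h ` M) S"
  proof (rule maximalidealI)
    show "ideal (h ` M) S" by (rule image_ideal[OF Mid])
    show "carrier S \<noteq> h ` M" using primeideal.I_notcarr[OF image_prime[OF Mp Qid M(2)]] .
    fix J assume J: "ideal J S" "h ` M \<subseteq> J" "J \<subseteq> carrier S"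
    have "M \<subseteq> contraction R h J" using J(2) R.ideal_subset[OF Mid] by (auto simp: contraction_def)
    then have "contraction R h J = M \<or> contraction R h J = carrier R"
      by (intro maximalideal.I_maximal[OF M(1)] contraction_ideal J) (auto simp: contraction_def)
    then show "J = h ` M \<or> J = carrier S" using image_contraction[OF J(3)] surj by metis
  qed
  moreover have "Q \<subseteq> h ` M" using image_contraction[OF S.ideal_subset[OF Qid]] M(2) by blast
  moreover have "u \<notin> h ` M"
  proof
    assume "u \<in> h ` M"
    then have "x \<in> contraction R h (h ` M)" using x by (simp add: contraction_def)
    then show False using cM M(3) by simp
  qed
  ultimately show "\<exists>N. maximalideal N S \<and> Q \<subseteq> N \<and> u \<notin> N" by blast
qed

lemma lifts_primes_surj: "lifts_primes R S h"
  unfolding lifts_primes_def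
proof (intro allI impI, elim conjE)
  fix Q0 u assume Q: "primeideal Q0 S" and u: "u \<in> carrier S" "u \<notin> Q0"
  note Qid = S.prime_ideal[OF Q]
  have "u \<in> h ` carrier R" using u surj by simp
  then obtain x where x: "x \<in> carrier R" "u = h x" by auto
  show "\<exists>d\<in>carrier R. h d \<notin> Q0 \<and>
       (\<forall>P. primeideal P R \<and> contraction R h Q0 \<subseteq> P \<and> d \<notin> P \<longrightarrow>
         (\<exists>Q. primeideal Q S \<and> Q0 \<subseteq> Q \<and> u \<notin> Q \<and> contraction R h Q = P))"
  proof (rule bexI[of _ x], intro conjI allI impI)
    show "h x \<notin> Q0" using u x by simp
    fix P assume "primeideal P R \<and> contraction R h Q0 \<subseteq> P \<and> x \<notin> P"
    then have P: "primeideal P R" "contraction R h Q0 \<subseteq> P" "x \<notin> P" by auto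
    note cP = contraction_image[OF R.prime_ideal[OF P(1)] Qid P(2)]
    show "\<exists>Q. primeideal Q S \<and> Q0 \<subseteq> Q \<and> u \<notin> Q \<and> contraction R h Q = P"
    proof (intro exI[of _ "h ` P"] conjI cP)
      show "primeideal (h ` P) S" by (rule image_prime[OF P(1) Qid P(2)])
      show "Q0 \<subseteq> h ` P" using image_contraction[OF S.ideal_subset[OF Qid]] P(2) by blast
      show "u \<notin> h ` P"
      proof
        assume "u \<in> h ` P"
        then have "x \<in> contraction R h (h ` P)" using x by (simp add: contraction_def)
        then show False using cP P(3) by simp
      qed
    qed
  qed (rule x(1))
qed

end

end

section \<open>Finitely generated extensions inside a fixed ring\<close>

context cring
begin

lemma subring_cring: "subring D R \<Longrightarrow> cring (R\<lparr>carrier := D\<rparr>)"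
  using subcringI' subcring_iff subringE(1) by blast

lemma subring_inclusion:
  assumes "subring D R" "subring E R" "D \<subseteq> E"
  shows "ring_hom_cring (R\<lparr>carrier := D\<rparr>) (R\<lparr>carrier := E\<rparr>) id"
proof -
  interpret D: cring "R\<lparr>carrier := D\<rparr>" by (rule subring_cring[OF assms(1)])
  interpret E: cring "R\<lparr>carrier := E\<rparr>" by (rule subring_cring[OF assms(2)])
  have "id \<in> ring_hom (R\<lparr>carrier := D\<rparr>) (R\<lparr>carrier := E\<rparr>)"
    using assms(3) by (auto simp: ring_hom_def)
  then show ?thesis
    by (intro RingHom.ring_hom_cringI ring_hom_ringI2 D.ring_axioms E.ring_axioms D.is_cring E.is_cring)
qed

text \<open>Adjoining one element is a quotient of adjoining an indeterminate.\<close>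

lemma adjoin_to_subring:
  assumes D: "subring D R" and b: "b \<in> carrier R"
    and noeth: "noetherian_ring (R\<lparr>carrier := D\<rparr>)" and sep: "primes_separated (R\<lparr>carrier := D\<rparr>)"
  obtains E where "subring E R" "D \<subseteq> E" "b \<in> E" "noetherian_ring (R\<lparr>carrier := E\<rparr>)"
    "primes_separated (R\<lparr>carrier := E\<rparr>)" "lifts_primes (R\<lparr>carrier := D\<rparr>) (R\<lparr>carrier := E\<rparr>) id"
    "E \<subseteq> generate_ring R (insert b D)"
proof -
  let ?D = "R\<lparr>carrier := D\<rparr>"
  interpret D: cring ?D by (rule subring_cring[OF D])
  interpret U: UP_cring ?D "UP ?D" by unfold_locales simp
  have Dc: "D \<subseteq> carrier R" using subringE(1)[OF D] .
  have "id \<in> ring_hom ?D R" using Dc by (auto simp: ring_hom_def)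
  then interpret UU: UP_pre_univ_prop ?D R id "UP ?D"
    using UP_pre_univ_propI[OF D.is_cring is_cring] by simp
  define ev where "ev = UnivPoly.eval ?D R id b"
  have ev: "ev \<in> ring_hom (UP ?D) R" unfolding ev_def by (rule UU.eval_ring_hom[OF b])
  have ev_const: "ev (U.const d) = d" if "d \<in> D" for d
    unfolding ev_def U.const_def using UU.eval_const[OF b, of d] that by simp
  have ev_x: "ev (up_ring.monom (UP ?D) \<one> 1) = b"
    unfolding ev_def using UU.eval_monom1[OF b] by simp
  interpret ev: ring_hom_ring "UP ?D" R ev
    by (rule ring_hom_ringI2[OF U.P.ring_axioms ring_axioms ev])
  define E where "E = ev ` carrier (UP ?D)"
  have E: "subring E R" unfolding E_def by (rule ev.img_is_subring[OF U.P.carrier_is_subring])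
  let ?E = "R\<lparr>carrier := E\<rparr>"
  interpret E: cring ?E by (rule subring_cring[OF E])
  have evE: "ev \<in> ring_hom (UP ?D) ?E"
    using ev by (auto simp: ring_hom_def E_def)
  interpret evE: ring_hom_cring "UP ?D" ?E ev
    by (intro RingHom.ring_hom_cringI ring_hom_ringI2 U.P.ring_axioms E.ring_axioms U.P.is_cring E.is_cring evE)
  have surj: "ev ` carrier (UP ?D) = carrier ?E" by (simp add: E_def)
  have noethU: "noetherian_ring (UP ?D)" by (rule U.hilbert_basis[OF noeth])
  have DE: "D \<subseteq> E"
  proof
    fix d assume d: "d \<in> D"
    then have "ev (U.const d) \<in> E" unfolding E_def by (intro imageI U.const_closed) simp
    then show "d \<in> E" using ev_const[OF d] by simp
  qed
  have "lifts_primes ?D ?E (ev \<circ> U.const)"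
    by (rule lifts_primes_comp[OF U.const_hom_cring evE.ring_hom_cring_axioms U.lifts_primes_const[OF noethU]
          evE.lifts_primes_surj[OF surj]])
  then have lifts: "lifts_primes ?D ?E id"
    using lifts_primes_cong[of ?D "ev \<circ> U.const" id ?E] ev_const by simp
  have "b \<in> E" unfolding E_def ev_x[symmetric] by (intro imageI U.monom_closed) (simp add: subringE(3)[OF D])
  have gen: "subring (generate_ring R (insert b D)) R"
    using Dc b by (intro generate_ring_is_subring) auto
  have "E \<subseteq> generate_ring R (insert b D)"
  proof
    fix y assume "y \<in> E"
    then obtain f where f: "f \<in> carrier (UP ?D)" "y = ev f" by (auto simp: E_def)
    have "y = (\<Oplus>i\<in>{..deg ?D f}. id (up_ring.coeff (UP ?D) f i) \<otimes> b [^] i)"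
      unfolding f(2) ev_def by (rule U.eval_on_carrier[OF f(1)])
    moreover have "(\<Oplus>i\<in>A. id (up_ring.coeff (UP ?D) f i) \<otimes> b [^] i) \<in> generate_ring R (insert b D)"
      if "finite A" for A :: "nat set"
      using that
    proof (induction A rule: finite_induct)
      case empty
      then show ?case using subringE(2)[OF gen] by simp
    next
      case (insert i A)
      have cD: "up_ring.coeff (UP ?D) f j \<in> D" for j using U.coeff_closed[OF f(1), of j] by simp
      have bj: "b [^] j \<in> generate_ring R (insert b D)" for j :: nat
        by (induction j) (use subringE(3,6)[OF gen] in \<open>auto intro: generate_ring.incl\<close>)
      have cg: "up_ring.coeff (UP ?D) f i \<in> generate_ring R (insert b D)"
        using cD by (intro generate_ring.incl insertI2)
      have "id (up_ring.coeff (UP ?D) f i) \<otimes> b [^] i \<in> generate_ring R (insert b D)"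
        using subringE(6)[OF gen cg bj] by (simp only: id_apply)
      moreover have "id (up_ring.coeff (UP ?D) f j) \<otimes> b [^] j \<in> carrier R" for j
        using cD Dc b by auto
      ultimately show ?case using insert subringE(7)[OF gen] by simp
    qed
    ultimately show "y \<in> generate_ring R (insert b D)" by simp
  qed
  then show ?thesis
    using that[OF E DE \<open>b \<in> E\<close> evE.noetherian_image[OF surj noethU]
        evE.primes_separated_image[OF surj U.primes_separated_UP[OF noeth sep]] lifts] by blast
qed

text \<open>Generators are adjoined one at a time. All intermediate rings are subrings of
  \<open>R\<close>, so the induction stays in one type although each step passes through a
  polynomial ring.\<close>

theorem finitely_generated_extension:
  assumes D: "subring D R" and noeth: "noetherian_ring (R\<lparr>carrier := D\<rparr>)"
    and sep: "primes_separated (R\<lparr>carrier := D\<rparr>)" and S: "finite S" "S \<subseteq> carrier R"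
  shows "noetherian_ring (R\<lparr>carrier := generate_ring R (D \<union> S)\<rparr>)
    \<and> primes_separated (R\<lparr>carrier := generate_ring R (D \<union> S)\<rparr>)
    \<and> lifts_primes (R\<lparr>carrier := D\<rparr>) (R\<lparr>carrier := generate_ring R (D \<union> S)\<rparr>) id"
proof -
  note Dc = subringE(1)[OF D]
  have "\<exists>E. subring E R \<and> D \<union> S \<subseteq> E \<and> E \<subseteq> generate_ring R (D \<union> S) \<and> noetherian_ring (R\<lparr>carrier := E\<rparr>)
    \<and> primes_separated (R\<lparr>carrier := E\<rparr>) \<and> lifts_primes (R\<lparr>carrier := D\<rparr>) (R\<lparr>carrier := E\<rparr>) id"
    using S
  proof (induction S rule: finite_induct)
    case empty
    interpret id: ring_hom_cring "R\<lparr>carrier := D\<rparr>" "R\<lparr>carrier := D\<rparr>" id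
      by (rule subring_inclusion[OF D D order_refl])
    have "lifts_primes (R\<lparr>carrier := D\<rparr>) (R\<lparr>carrier := D\<rparr>) id" by (rule id.lifts_primes_surj) simp
    moreover have "D \<subseteq> generate_ring R D" by (auto intro: generate_ring.incl)
    ultimately show ?case unfolding Un_empty_right using D noeth sep by blast
  next
    case (insert b S)
    then obtain E where E: "subring E R" "D \<union> S \<subseteq> E" "E \<subseteq> generate_ring R (D \<union> S)" "noetherian_ring (R\<lparr>carrier := E\<rparr>)"
      "primes_separated (R\<lparr>carrier := E\<rparr>)" "lifts_primes (R\<lparr>carrier := D\<rparr>) (R\<lparr>carrier := E\<rparr>) id"
      by blast
    have b: "b \<in> carrier R" using insert by simp
    obtain F where F: "subring F R" "E \<subseteq> F" "b \<in> F" "noetherian_ring (R\<lparr>carrier := F\<rparr>)"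
      "primes_separated (R\<lparr>carrier := F\<rparr>)" "lifts_primes (R\<lparr>carrier := E\<rparr>) (R\<lparr>carrier := F\<rparr>) id"
      "F \<subseteq> generate_ring R (insert b E)"
      by (rule adjoin_to_subring[OF E(1) b E(4,5)])
    have "lifts_primes (R\<lparr>carrier := D\<rparr>) (R\<lparr>carrier := F\<rparr>) (id \<circ> id)"
      using E(2) by (intro lifts_primes_comp[OF subring_inclusion[OF D E(1)] subring_inclusion[OF E(1) F(1,2)] E(6) F(6)]) auto
    then have "lifts_primes (R\<lparr>carrier := D\<rparr>) (R\<lparr>carrier := F\<rparr>) id" by (simp only: id_comp)
    moreover have "D \<union> insert b S \<subseteq> F" using E(2) F(2,3) by auto
    moreover have "F \<subseteq> generate_ring R (D \<union> insert b S)"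
    proof -
      have sub: "D \<union> insert b S \<subseteq> carrier R" using Dc insert.prems by auto
      have "generate_ring R (D \<union> S) \<subseteq> generate_ring R (D \<union> insert b S)"
        using sub by (intro mono_generate_ring) auto
      then have "insert b E \<subseteq> generate_ring R (D \<union> insert b S)"
        using E(3) by (auto intro: generate_ring.incl)
      then have "generate_ring R (insert b E) \<subseteq> generate_ring R (D \<union> insert b S)"
        using subringE(1)[OF E(1)] b
        by (intro generate_ring_min_subring1[OF _ generate_ring_is_subring[OF sub]]) auto
      then show ?thesis using F(7) by blast
    qed
    ultimately show ?case using F(1,4,5) by blast
  qed
  then obtain E where E: "subring E R" "D \<union> S \<subseteq> E" "E \<subseteq> generate_ring R (D \<union> S)" "noetherian_ring (R\<lparr>carrier := E\<rparr>)"
      "primes_separated (R\<lparr>carrier := E\<rparr>)" "lifts_primes (R\<lparr>carrier := D\<rparr>) (R\<lparr>carrier := E\<rparr>) id"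
    by blast
  have "generate_ring R (D \<union> S) \<subseteq> E"
    using Dc S(2) by (intro generate_ring_min_subring1 E(1,2)) simp
  then have "E = generate_ring R (D \<union> S)" using E(3) by auto
  then show ?thesis using E(4-6) by blast
qed

end

section \<open>Transcendence degree and dimension\<close>

lemma power_product_hom:
  assumes "ring_hom_cring A B h" and "\<And>i. i < n \<Longrightarrow> a i \<in> carrier A" and "\<And>i. i < n \<Longrightarrow> b i = h (a i)"
  shows "h (cring.power_product A a n m) = cring.power_product B b n m"
proof -
  interpret ring_hom_cring A B h by fact
  show ?thesis using assms(2,3)
  proof (induction n)
    case 0
    then show ?case by (simp add: R.power_product_0 S.power_product_0)
  next
    case (Suc n)
    have "a n \<in> carrier A" "R.power_product a n m \<in> carrier A"
      using Suc.prems(1) by (auto intro: R.power_product_closed)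
    moreover have "b i \<in> carrier B" if "i < Suc n" for i using Suc.prems that by auto
    ultimately show ?case
      using Suc by (simp add: R.power_product_Suc S.power_product_Suc)
  qed
qed

lemma poly_value_hom:
  assumes h: "ring_hom_cring A B h" and K: "ring K" and \<phi>: "\<phi> \<in> ring_hom K A" and \<psi>: "\<psi> \<in> ring_hom K B"
    and comm: "\<And>k. k \<in> carrier K \<Longrightarrow> h (\<phi> k) = \<psi> k" and as: "set as \<subseteq> carrier A"
    and f: "f \<in> ring.indexed_pset K {..<length as} (carrier K)"
  shows "h (poly_value K A \<phi> f as) = poly_value K B \<psi> f (map h as)"
proof -
  interpret ring_hom_cring A B h by fact
  interpret K: ring K by fact
  note f' = K.indexed_pset_finite_support[OF f]
  let ?n = "length as"
  let ?S = "{m. f m \<noteq> \<zero>\<^bsub>K\<^esub>}"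
  have asc: "as ! i \<in> carrier A" if "i < ?n" for i using as that by auto
  have pp: "h (R.power_product ((!) as) ?n m) = S.power_product ((!) (map h as)) ?n m" for m
    by (rule power_product_hom[OF h asc]) simp_all
  have c: "\<phi> (f m) \<in> carrier A" "R.power_product ((!) as) ?n (count m) \<in> carrier A" for m
    using ring_hom_closed[OF \<phi> f'(2)] R.power_product_closed[OF asc] by auto
  have "poly_value K A \<phi> f as = (\<Oplus>\<^bsub>A\<^esub>m\<in>?S. \<phi> (f m) \<otimes>\<^bsub>A\<^esub> R.power_product ((!) as) ?n (count m))"
    using f' by (intro R.poly_value_eq_finsum[OF K \<phi> as refl f]) auto
  also have "h \<dots> = (\<Oplus>\<^bsub>B\<^esub>m\<in>?S. h (\<phi> (f m) \<otimes>\<^bsub>A\<^esub> R.power_product ((!) as) ?n (count m)))"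
    using c by (subst ring.hom_finsum) (auto simp: comp_def)
  also have "\<dots> = (\<Oplus>\<^bsub>B\<^esub>m\<in>?S. \<psi> (f m) \<otimes>\<^bsub>B\<^esub> S.power_product ((!) (map h as)) ?n (count m))"
  proof (rule S.finsum_cong')
    show "h (\<phi> (f m) \<otimes>\<^bsub>A\<^esub> R.power_product ((!) as) ?n (count m)) =
        \<psi> (f m) \<otimes>\<^bsub>B\<^esub> S.power_product ((!) (map h as)) ?n (count m)" for m
      using hom_mult[OF c] comm[OF f'(2)] pp by simp
    have "h (R.power_product ((!) as) ?n (count m)) \<in> carrier B" for m by (rule hom_closed[OF c(2)])
    then show "(\<lambda>m. \<psi> (f m) \<otimes>\<^bsub>B\<^esub> S.power_product ((!) (map h as)) ?n (count m)) \<in> ?S \<rightarrow> carrier B"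
      using ring_hom_closed[OF \<psi> f'(2)] pp by auto
  qed simp
  also have "\<dots> = poly_value K B \<psi> f (map h as)"
    using f' f as by (intro S.poly_value_eq_finsum[OF K \<psi>, symmetric]) auto
  finally show ?thesis .
qed

text \<open>Injectivity lets independence travel between \<open>A\<close>, the ambient algebra and
  its subrings over the same coefficients.\<close>

lemma algebraically_dependent_wrt_hom:
  assumes h: "ring_hom_cring A B h" and inj: "inj_on h (carrier A)"
    and K: "ring K" and \<phi>: "\<phi> \<in> ring_hom K A" and \<psi>: "\<psi> \<in> ring_hom K B"
    and comm: "\<And>k. k \<in> carrier K \<Longrightarrow> h (\<phi> k) = \<psi> k" and as: "set as \<subseteq> carrier A"
  shows "algebraically_dependent_wrt ord K A \<phi> as \<longleftrightarrow> algebraically_dependent_wrt ord K B \<psi> (map h as)"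
proof -
  interpret ring_hom_cring A B h by fact
  have "poly_value K A \<phi> f as = \<zero>\<^bsub>A\<^esub> \<longleftrightarrow> poly_value K B \<psi> f (map h as) = \<zero>\<^bsub>B\<^esub>"
    if f: "f \<in> ring.indexed_pset K {..<length as} (carrier K)" for f
  proof -
    interpret K: ring K by fact
    note f' = K.indexed_pset_finite_support[OF f]
    have "poly_value K A \<phi> f as \<in> carrier A"
    proof -
      have asc: "as ! i \<in> carrier A" if "i < length as" for i using as that by auto
      have "poly_value K A \<phi> f as =
          (\<Oplus>\<^bsub>A\<^esub>m\<in>{m. f m \<noteq> \<zero>\<^bsub>K\<^esub>}. \<phi> (f m) \<otimes>\<^bsub>A\<^esub> R.power_product ((!) as) (length as) (count m))"
        using f' by (intro R.poly_value_eq_finsum[OF K \<phi> as refl f]) auto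
      also have "\<dots> \<in> carrier A"
        using ring_hom_closed[OF \<phi> f'(2)] R.power_product_closed[OF asc] by (intro R.finsum_closed) auto
      finally show ?thesis .
    qed
    then have "poly_value K A \<phi> f as = \<zero>\<^bsub>A\<^esub> \<longleftrightarrow> h (poly_value K A \<phi> f as) = h \<zero>\<^bsub>A\<^esub>"
      using inj_on_eq_iff[OF inj _ R.zero_closed] by simp
    also have "h (poly_value K A \<phi> f as) = poly_value K B \<psi> f (map h as)"
      by (rule poly_value_hom[OF h K \<phi> \<psi> _ as f]) (rule comm)
    finally show ?thesis unfolding hom_zero .
  qed
  then show ?thesis unfolding algebraically_dependent_wrt_def by auto
qed

text \<open>The first prime of the chain is moved off the element \<open>d\<close> provided by \<open>lifts\<close>, inside the
  second prime if there is one and by means of maximal ideals otherwise.\<close>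

lemma chain_lifting:
  assumes C: "noetherian_ring C" "primes_separated C" and h: "ring_hom_cring C B h"
    and lifts: "lifts_primes C B h"
    and \<iota>: "ring_hom_cring A B \<iota>" and sub: "h ` carrier C \<subseteq> \<iota> ` carrier A"
    and Q0: "primeideal Q0 B" and chain: "ascending_chain C (contraction C h Q0) n"
  shows "ascending_chain A (contraction A \<iota> Q0) n"
  using Q0 chain
proof (induction n arbitrary: Q0)
  case 0
  then show ?case using ring_hom_cring.contraction_prime[OF \<iota>] by simp
next
  case (Suc n)
  interpret h: ring_hom_cring C B h by fact
  interpret \<iota>: ring_hom_cring A B \<iota> by fact
  interpret C: noetherian_cring C by (intro noetherian_cring.intro C h.R.is_cring)
  define p where "p = contraction C h Q0"
  have p: "primeideal p C" unfolding p_def by (rule h.contraction_prime[OF Suc.prems(1)])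
  obtain P1 where P1: "p \<subset> P1" "ascending_chain C P1 n" using Suc.prems(2) unfolding p_def by auto
  have P1p: "primeideal P1 C" by (rule ascending_chain_prime[OF P1(2)])
  \<comment> \<open>The element to be avoided is taken to be one, so the mere existence of a lift is
    asked for.\<close>
  obtain d where d: "d \<in> carrier C" "h d \<notin> Q0"
    "\<And>P. \<lbrakk>primeideal P C; contraction C h Q0 \<subseteq> P; d \<notin> P\<rbrakk> \<Longrightarrow>
      \<exists>Q. primeideal Q B \<and> Q0 \<subseteq> Q \<and> \<one>\<^bsub>B\<^esub> \<notin> Q \<and> contraction C h Q = P"
    by (rule lifts_primesE[OF lifts Suc.prems(1) h.S.one_closed h.S.prime_one[OF Suc.prems(1)]], rule that)
  have dp: "d \<notin> p" using d by (simp add: p_def contraction_def)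
  obtain P where P: "p \<subset> P" "d \<notin> P" "ascending_chain C P n"
  proof (cases n)
    case 0
    obtain M where M: "maximalideal M C" "p \<subseteq> M" "d \<notin> M" by (rule primes_separatedE[OF C(2) p d(1) dp])
    \<comment> \<open>\<open>p\<close> is strictly below the prime \<open>P1\<close>, hence not
      maximal, and the step to \<open>M\<close> is strict.\<close>
    have "p \<noteq> M"
    proof
      assume "p = M"
      then have "P1 = M \<or> P1 = carrier C"
        using P1(1) by (intro maximalideal.I_maximal[OF M(1)] h.R.prime_ideal[OF P1p] h.R.ideal_subset) auto
      then show False using P1(1) \<open>p = M\<close> primeideal.I_notcarr[OF P1p] by auto
    qed
    then have "p \<subset> M" using M(2) by auto
    then show ?thesis using that M(3) h.R.maximalideal_prime[OF M(1)] 0 by simp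
  next
    case (Suc m)
    then obtain P2 where P2: "P1 \<subset> P2" "ascending_chain C P2 m" using P1(2) by auto
    obtain P where P: "primeideal P C" "p \<subset> P" "P \<subset> P2" "d \<notin> P"
      by (rule C.avoid_element_between[OF p P1p ascending_chain_prime[OF P2(2)] P1(1) P2(1) d(1) dp])
    have "ascending_chain C P n" unfolding Suc ascending_chain.simps using P(1,3) P2(2) by blast
    then show ?thesis using that P(2,4) by simp
  qed
  have Pp: "primeideal P C" by (rule ascending_chain_prime[OF P(3)])
  obtain Q where Q: "primeideal Q B" "Q0 \<subseteq> Q" "contraction C h Q = P"
    using d(3)[OF Pp _ P(2)] P(1) unfolding p_def by auto
  have "ascending_chain A (contraction A \<iota> Q) n" using Suc.IH[OF Q(1)] Q(3) P(3) by simp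
  \<comment> \<open>The primes of \<open>B\<close> already differ on the image of \<open>C\<close>,
    which lies in the image of \<open>A\<close>.\<close>
  moreover have "contraction A \<iota> Q0 \<subset> contraction A \<iota> Q"
  proof -
    obtain c where c: "c \<in> P" "c \<notin> p" using P(1) by auto
    then have c': "c \<in> carrier C" "h c \<in> Q" "h c \<notin> Q0" using Q(3) by (auto simp: contraction_def p_def)
    then obtain a where "a \<in> carrier A" "\<iota> a = h c" using sub by (metis image_iff image_subset_iff)
    then have "a \<in> contraction A \<iota> Q" "a \<notin> contraction A \<iota> Q0" using c' by (auto simp: contraction_def)
    moreover have "contraction A \<iota> Q0 \<subseteq> contraction A \<iota> Q" using Q(2) by (auto simp: contraction_def)
    ultimately show ?thesis by auto
  qed
  moreover have "primeideal (contraction A \<iota> Q0) A" by (rule \<iota>.contraction_prime[OF Suc.prems(1)])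
  ultimately show ?case unfolding ascending_chain.simps by blast
qed

lemma subfinite_chain_of_lex_independent:
  assumes R: "cring R" "noetherian_ring R" "jacobson_ring R"
    and sub: "subfinite_algebra TYPE('b) R A \<phi>"
    and as: "set as \<subseteq> carrier A" and indep: "\<not> algebraically_dependent_wrt lex_ordering R A \<phi> as"
  obtains P where "ascending_chain A P (length as)"
proof -
  have \<phi>: "ring_hom_cring R A \<phi>" using sub by (simp add: subfinite_algebra_def)
  obtain B :: "'b ring" and \<psi> \<iota> where B: "finitely_generated_algebra R B \<psi>" "\<iota> \<in> ring_hom A B"
    "inj_on \<iota> (carrier A)" "\<And>r. r \<in> carrier R \<Longrightarrow> \<iota> (\<phi> r) = \<psi> r"
    using sub unfolding subfinite_algebra_def by auto
  have \<psi>: "ring_hom_cring R B \<psi>" using B(1) by (simp add: finitely_generated_algebra_def)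
  obtain S where S: "S \<subseteq> carrier B" "finite S" "generate_ring B (\<psi> ` carrier R \<union> S) = carrier B"
    using B(1) unfolding finitely_generated_algebra_def by auto
  interpret \<phi>: ring_hom_cring R A \<phi> by fact
  interpret \<psi>: ring_hom_cring R B \<psi> by fact
  interpret \<iota>: ring_hom_cring A B \<iota>
    by (intro RingHom.ring_hom_cringI ring_hom_ringI2 \<phi>.S.ring_axioms \<psi>.S.ring_axioms \<phi>.S.is_cring \<psi>.S.is_cring B(2))
  let ?bs = "map \<iota> as"
  have bs: "set ?bs \<subseteq> carrier B" using as by auto
  \<comment> \<open>The structure map may have a kernel, so the base subring of \<open>B\<close> is
    the image of \<open>R\<close>, which inherits both properties as a quotient.\<close>
  define D where "D = \<psi> ` carrier R"
  have D: "subring D B" unfolding D_def by (rule \<psi>.ring.img_is_subring[OF \<phi>.R.carrier_is_subring])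
  interpret D: cring "B\<lparr>carrier := D\<rparr>" by (rule \<psi>.S.subring_cring[OF D])
  have "\<psi> \<in> ring_hom R (B\<lparr>carrier := D\<rparr>)" by (auto simp: ring_hom_def D_def)
  then interpret RD: ring_hom_cring R "B\<lparr>carrier := D\<rparr>" \<psi>
    by (intro RingHom.ring_hom_cringI ring_hom_ringI2 \<phi>.R.ring_axioms D.ring_axioms \<phi>.R.is_cring D.is_cring)
  have surj: "\<psi> ` carrier R = carrier (B\<lparr>carrier := D\<rparr>)" by (simp add: D_def)
  have Dn: "noetherian_ring (B\<lparr>carrier := D\<rparr>)" "primes_separated (B\<lparr>carrier := D\<rparr>)"
    using RD.noetherian_image[OF surj R(2)]
      RD.primes_separated_image[OF surj jacobson_ring_primes_separated[OF R(3)]] by auto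
  define C where "C = generate_ring B (D \<union> set ?bs)"
  let ?C = "B\<lparr>carrier := C\<rparr>"
  have Dbs: "D \<union> set ?bs \<subseteq> carrier B" using bs subringE(1)[OF D] by simp
  have C: "subring C B" unfolding C_def by (rule \<psi>.S.generate_ring_is_subring[OF Dbs])
  have DC: "D \<union> set ?bs \<subseteq> C" unfolding C_def by (auto intro: generate_ring.incl)
  have Cn: "noetherian_ring ?C" "primes_separated ?C"
    using \<psi>.S.finitely_generated_extension[OF D Dn _ bs] unfolding C_def by auto
  interpret C: noetherian_cring ?C
    by (intro noetherian_cring.intro Cn \<psi>.S.subring_cring[OF C])
  have gen: "generate_ring B (C \<union> S) = carrier B"
  proof
    have "C \<union> S \<subseteq> carrier B" using subringE(1)[OF C] S(1) by simp
    then show "generate_ring B (C \<union> S) \<subseteq> carrier B" by (rule \<psi>.S.generate_ring_incl)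
    have "generate_ring B (D \<union> S) \<subseteq> generate_ring B (C \<union> S)"
      using DC \<open>C \<union> S \<subseteq> carrier B\<close> by (intro \<psi>.S.mono_generate_ring) auto
    then show "carrier B \<subseteq> generate_ring B (C \<union> S)" using S(3) by (simp add: D_def)
  qed
  \<comment> \<open>\<open>B\<close> arises from \<open>C\<close> by adjoining the finite set
    \<open>S\<close>, so primes lift generically along the inclusion of \<open>C\<close>.\<close>
  have "noetherian_ring (B\<lparr>carrier := carrier B\<rparr>) \<and> lifts_primes ?C (B\<lparr>carrier := carrier B\<rparr>) id"
    using \<psi>.S.finitely_generated_extension[OF C Cn S(2,1)] unfolding gen by blast
  then have Bn: "noetherian_ring B" and lifts: "lifts_primes ?C B id" by simp_all
  interpret B: noetherian_cring B by (intro noetherian_cring.intro Bn \<psi>.S.is_cring)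
  have CB: "ring_hom_cring ?C B id"
    using \<psi>.S.subring_inclusion[OF C \<psi>.S.carrier_is_subring] subringE(1)[OF C] by simp
  have \<psi>C: "\<psi> \<in> ring_hom R ?C" using DC by (auto simp: ring_hom_def D_def)
  have "\<not> algebraically_dependent_wrt lex_ordering R B \<psi> ?bs"
    using algebraically_dependent_wrt_hom[OF \<iota>.ring_hom_cring_axioms B(3) \<phi>.R.ring_axioms \<phi>.homh \<psi>.homh B(4) as] indep by blast
  moreover have "algebraically_dependent_wrt lex_ordering R ?C \<psi> ?bs \<longleftrightarrow>
      algebraically_dependent_wrt lex_ordering R B \<psi> (map id ?bs)"
    using DC by (intro algebraically_dependent_wrt_hom[OF CB _ \<phi>.R.ring_axioms \<psi>C \<psi>.homh]) auto
  ultimately have indepC: "\<not> algebraically_dependent_wrt lex_ordering R ?C \<psi> ?bs" by simp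
  have genC: "carrier ?C \<subseteq> generate_ring ?C (\<psi> ` carrier R \<union> set ?bs)"
    using \<psi>.S.subring_gen_equality[OF C DC] by (simp add: C_def D_def)
  have bsC: "set ?bs \<subseteq> carrier ?C" using DC by simp
  obtain P where P: "ascending_chain ?C P (length ?bs)"
    by (rule C.chain_of_lex_independent[OF R(1) \<psi>C bsC genC indepC])
  have Pp: "primeideal P ?C" by (rule ascending_chain_prime[OF P])
  have PC: "P \<subseteq> C" using C.ideal_subset[OF C.prime_ideal[OF Pp]] by simp
  \<comment> \<open>\<open>P\<close> itself need not lift to \<open>B\<close>. A prime of
    \<open>B\<close> missing \<open>C - P\<close> contracts to a prime inside \<open>P\<close>, from
    which the chain can start equally well.\<close>
  obtain Q0 where Q0: "primeideal Q0 B" "Q0 \<inter> (C - P) = {}"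
  proof (rule B.exists_prime_disjoint[OF \<psi>.S.zeroideal, of "C - P"])
    show "C - P \<subseteq> carrier B" using subringE(1)[OF C] by auto
    show "\<one>\<^bsub>B\<^esub> \<in> C - P" using C.prime_one[OF Pp] subringE(3)[OF C] by simp
    show "x \<otimes>\<^bsub>B\<^esub> y \<in> C - P" if "x \<in> C - P" "y \<in> C - P" for x y
      using that C.prime_mult[OF Pp, of x y] subringE(6)[OF C] by auto
    have "\<zero>\<^bsub>B\<^esub> \<in> P" using C.ideal_zero[OF C.prime_ideal[OF Pp]] by simp
    then show "{\<zero>\<^bsub>B\<^esub>} \<inter> (C - P) = {}" by simp
  qed (rule that)
  have "contraction ?C id Q0 \<subseteq> P" using Q0(2) by (auto simp: contraction_def)
  then have "ascending_chain ?C (contraction ?C id Q0) (length ?bs)"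
    by (rule ascending_chain_mono[OF P _ ring_hom_cring.contraction_prime[OF CB Q0(1)]])
  moreover have "id ` carrier ?C \<subseteq> \<iota> ` carrier A"
  proof -
    have "D \<union> set ?bs \<subseteq> \<iota> ` carrier A"
    proof
      fix x assume "x \<in> D \<union> set ?bs"
      then show "x \<in> \<iota> ` carrier A"
      proof
        assume "x \<in> D"
        then obtain r where "r \<in> carrier R" "x = \<iota> (\<phi> r)" using B(4) by (auto simp: D_def)
        then show ?thesis by auto
      qed (use as in auto)
    qed
    then have "C \<subseteq> \<iota> ` carrier A" unfolding C_def
      using Dbs \<iota>.ring.img_is_subring[OF \<phi>.S.carrier_is_subring]
      by (intro \<psi>.S.generate_ring_min_subring1) auto
    then show ?thesis by simp
  qed
  ultimately have "ascending_chain A (contraction A \<iota> Q0) (length ?bs)"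
    by (intro chain_lifting[OF Cn CB lifts \<iota>.ring_hom_cring_axioms _ Q0(1)])
  then show ?thesis using that by simp
qed

text \<open>In a nonzero algebra the empty list is lexicographically independent, because a submonic
  constant is one. Its chain of length zero is a prime.\<close>

lemma subfinite_exists_prime:
  assumes R: "cring R" "noetherian_ring R" "jacobson_ring R"
    and sub: "subfinite_algebra TYPE('b) R A \<phi>" and A: "carrier A \<noteq> {\<zero>\<^bsub>A\<^esub>}"
  obtains P where "primeideal P A"
proof -
  have "\<not> algebraically_dependent_wrt lex_ordering R A \<phi> []"
  proof
    interpret \<phi>: ring_hom_cring R A \<phi> using sub by (simp add: subfinite_algebra_def)
    assume "algebraically_dependent_wrt lex_ordering R A \<phi> []"
    then obtain f where f: "f \<in> \<phi>.R.indexed_pset {} (carrier R)" "submonic_wrt lex_ordering R f"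
      "poly_value R A \<phi> f [] = \<zero>\<^bsub>A\<^esub>"
      unfolding algebraically_dependent_wrt_def by auto
    note f' = \<phi>.R.indexed_pset_finite_support[OF f(1)]
    have one: "\<one>\<^bsub>A\<^esub> \<noteq> \<zero>\<^bsub>A\<^esub>" using A \<phi>.S.carrier_one_zero by blast
    have "\<one>\<^bsub>R\<^esub> \<noteq> \<zero>\<^bsub>R\<^esub>" using one \<phi>.hom_one \<phi>.hom_zero by metis
    then have "carrier R \<noteq> {\<zero>\<^bsub>R\<^esub>}" using \<phi>.R.carrier_one_zero by blast
    then obtain m where m: "f m \<noteq> \<zero>\<^bsub>R\<^esub>" "f m = \<one>\<^bsub>R\<^esub>" using f(2) unfolding submonic_wrt_def by blast
    have emp: "t = {#}" if "f t \<noteq> \<zero>\<^bsub>R\<^esub>" for t using f'(3)[OF that] by simp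
    then have supp: "{t. f t \<noteq> \<zero>\<^bsub>R\<^esub>} = {{#}}" using m(1) by blast
    have "f {#} = \<one>\<^bsub>R\<^esub>" using m(2) emp[OF m(1)] by simp
    then have "poly_value R A \<phi> f [] = \<one>\<^bsub>A\<^esub>" unfolding poly_value_def supp by simp
    then show False using f(3) one by simp
  qed
  then obtain P where "ascending_chain A P 0"
    using subfinite_chain_of_lex_independent[OF R sub, of "[]"] by auto
  then show ?thesis using that by simp
qed

lemma krull_dim_ascending_chain:
  "krull_dim A = (if carrier A = {\<zero>\<^bsub>A\<^esub>} then -1 else Sup {ereal (real n) | n. \<exists>P. ascending_chain A P n})"
proof -
  have "(\<exists>P :: nat \<Rightarrow> 'a set. (\<forall>i\<le>n. primeideal (P i) A) \<and> (\<forall>i<n. P i \<subset> P (Suc i)))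
      \<longleftrightarrow> (\<exists>P. ascending_chain A P n)" for n
    using ascending_chain_function[of n _ A] ascending_chain_imp_function[of A _ n] by metis
  then show ?thesis by (simp only: krull_dim_def)
qed

text \<open>Independent lists and chains have the same positive lengths. Length zero occurs only
  among the chains, where a prime supplies it, and matches the default value \<open>0\<close> of the
  transcendence degree.\<close>

lemma trdeg_eq_krull_dim:
  assumes A: "cring A" and prime: "carrier A \<noteq> {\<zero>\<^bsub>A\<^esub>} \<Longrightarrow> \<exists>P. primeideal P A"
    and indep: "\<And>as. \<lbrakk>set as \<subseteq> carrier A; \<not> dep as; as \<noteq> []\<rbrakk> \<Longrightarrow> \<exists>P. ascending_chain A P (length as)"
    and chain: "\<And>P n. \<lbrakk>ascending_chain A P n; n > 0\<rbrakk> \<Longrightarrow>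
      \<exists>as. length as = n \<and> set as \<subseteq> carrier A \<and> \<not> dep as"
  shows "trdeg_of_dependence dep A = krull_dim A"
proof -
  interpret A: cring A by fact
  define X' where "X' = {ereal (real n) | n. n > 0 \<and> (\<exists>as. length as = n \<and> set as \<subseteq> carrier A \<and> \<not> dep as)}"
  define Y where "Y = {ereal (real n) | n. \<exists>P. ascending_chain A P n}"
  have iff: "(\<exists>as. length as = n \<and> set as \<subseteq> carrier A \<and> \<not> dep as) \<longleftrightarrow> (\<exists>P. ascending_chain A P n)"
    if "n > 0" for n
    using indep chain that by (metis length_greater_0_conv)
  have one: "(\<forall>a\<in>carrier A. dep [a]) \<longleftrightarrow> \<not> (\<exists>P. ascending_chain A P 1)"
  proof -
    have "(\<exists>as. length as = 1 \<and> set as \<subseteq> carrier A \<and> \<not> dep as) \<longleftrightarrow> \<not> (\<forall>a\<in>carrier A. dep [a])"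
      by (auto simp: length_Suc_conv)
    then show ?thesis using iff[of 1] by (simp only: zero_less_one simp_thms)
  qed
  show ?thesis
  proof (cases "carrier A = {\<zero>\<^bsub>A\<^esub>}")
    case True
    have "\<not> primeideal P A" for P
      using True A.ideal_subset[OF A.prime_ideal] A.ideal_zero[OF A.prime_ideal] primeideal.I_notcarr
      by (metis empty_iff subset_singletonD)
    then have "\<not> (\<exists>P. ascending_chain A P 1)" using ascending_chain_prime by blast
    then show ?thesis using True one by (simp add: trdeg_of_dependence_def krull_dim_def)
  next
    case False
    obtain P0 where "ascending_chain A P0 0" using prime[OF False] by auto
    then have zero: "0 \<in> Y" unfolding Y_def by (intro CollectI exI[of _ 0]) (auto simp: zero_ereal_def)
    have Y: "Y = insert 0 X'"
    proof -
      have "y \<in> insert 0 X'" if y: "y \<in> Y" for y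
      proof -
        obtain n P where n: "y = ereal (real n)" "ascending_chain A P n" using y by (auto simp: Y_def)
        then show ?thesis using iff[of n] by (cases "n = 0") (auto simp: X'_def zero_ereal_def)
      qed
      moreover have "y \<in> Y" if "y \<in> X'" for y using that iff by (auto simp: X'_def Y_def)
      ultimately show ?thesis using zero by blast
    qed
    have krull: "krull_dim A = Sup Y" using False by (simp add: krull_dim_ascending_chain Y_def)
    show ?thesis
    proof (cases "\<forall>a\<in>carrier A. dep [a]")
      case True
      \<comment> \<open>A longer chain would contain one of length one.\<close>
      then have no: "\<not> (\<exists>P. ascending_chain A P n)" if "n > 0" for n
        using one ascending_chain_le[of A _ n 1] that by (metis One_nat_def Suc_leI True)
      have "X' = {}" unfolding X'_def using iff no by auto
      then have "Sup Y = 0" using Y by simp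
      then show ?thesis using True False krull by (simp add: trdeg_of_dependence_def)
    next
      case False2: False
      \<comment> \<open>Once a positive length is present, the additional \<open>0\<close> in
        \<open>Y\<close> does not affect the supremum.\<close>
      then have "1 \<in> X'" using one iff[of 1] unfolding X'_def by (intro CollectI exI[of _ 1]) (auto simp: one_ereal_def)
      then have "0 \<le> Sup X'" using order_trans[of "0 :: ereal" 1 "Sup X'"] Sup_upper[of 1 X'] by simp
      then have "Sup Y = Sup X'" unfolding Y by (simp add: sup_absorb2)
      moreover have "trdeg_of_dependence dep A = Sup X'"
        unfolding trdeg_of_dependence_def X'_def by (rule if_not_P[OF False2])
      ultimately show ?thesis using krull by simp
    qed
  qed
qed

lemma trdeg_ring_eq_krull_dim:
  assumes R: "cring R" "noetherian_ring R"
  shows "trdeg_ring R = krull_dim R"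
proof -
  interpret noetherian_cring R by (intro noetherian_cring.intro R)
  have id: "(\<lambda>r. r) \<in> ring_hom R R" by (auto simp: ring_hom_def)
  show ?thesis unfolding trdeg_ring_def trdeg_def
  proof (rule trdeg_eq_krull_dim[OF R(1)])
    assume "carrier R \<noteq> {\<zero>\<^bsub>R\<^esub>}"
    then have "{\<zero>\<^bsub>R\<^esub>} \<noteq> carrier R" by auto
    then show "\<exists>P. primeideal P R" using exists_prime_over[OF zeroideal] by metis
  next
    fix as assume as: "set as \<subseteq> carrier R" "\<not> algebraically_dependent R R (\<lambda>r. r) as"
    \<comment> \<open>As an algebra over itself, \<open>R\<close> is exhausted by its
      coefficients.\<close>
    have gen: "carrier R \<subseteq> generate_ring R ((\<lambda>r. r) ` carrier R \<union> set as)"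
      by (auto intro: generate_ring.incl)
    \<comment> \<open>Independence with respect to all orderings specializes to the lexicographic
      one.\<close>
    have "\<not> algebraically_dependent_wrt lex_ordering R R (\<lambda>r. r) as"
      using as(2) algebraically_dependent_wrt_imp_dependent[OF monomial_ordering_lex_ordering] by blast
    then show "\<exists>P. ascending_chain R P (length as)"
      using chain_of_lex_independent[OF R(1) id as(1) gen] by metis
  next
    fix P n assume "ascending_chain R P n" "n > 0"
    then show "\<exists>as. length as = n \<and> set as \<subseteq> carrier R \<and> \<not> algebraically_dependent R R (\<lambda>r. r) as"
      using exists_independent_of_chain[OF R(1) id] by metis
  qed
qed

lemma trdeg_lex_eq_krull_dim:
  assumes R: "cring R" "noetherian_ring R" "jacobson_ring R" and sub: "subfinite_algebra TYPE('b) R A \<phi>"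
  shows "trdeg_wrt lex_ordering R A \<phi> = krull_dim A"
proof -
  interpret \<phi>: ring_hom_cring R A \<phi> using sub by (simp add: subfinite_algebra_def)
  show ?thesis unfolding trdeg_wrt_def
  proof (rule trdeg_eq_krull_dim[OF \<phi>.S.is_cring])
    show "\<exists>P. primeideal P A" if "carrier A \<noteq> {\<zero>\<^bsub>A\<^esub>}"
      by (rule subfinite_exists_prime[OF R sub that]) (rule exI)
    show "\<exists>P. ascending_chain A P (length as)"
      if "set as \<subseteq> carrier A" "\<not> algebraically_dependent_wrt lex_ordering R A \<phi> as" for as
      by (rule subfinite_chain_of_lex_independent[OF R sub that(1,2)]) (rule exI)
    show "\<exists>as. length as = n \<and> set as \<subseteq> carrier A \<and> \<not> algebraically_dependent_wrt lex_ordering R A \<phi> as"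
      if "ascending_chain A P n" for P n
      using \<phi>.S.exists_lex_independent_of_chain[OF R(1) \<phi>.homh that] by metis
  qed
qed

lemma trdeg_noetherian_eq_krull_dim:
  assumes R: "cring R" "noetherian_ring R" "jacobson_ring R" and sub: "subfinite_algebra TYPE('b) R A \<phi>"
    and A: "noetherian_ring A"
  shows "trdeg R A \<phi> = krull_dim A"
proof -
  interpret \<phi>: ring_hom_cring R A \<phi> using sub by (simp add: subfinite_algebra_def)
  interpret A: noetherian_cring A by (intro noetherian_cring.intro A \<phi>.S.is_cring)
  show ?thesis unfolding trdeg_def
  proof (rule trdeg_eq_krull_dim[OF \<phi>.S.is_cring])
    show "\<exists>P. primeideal P A" if "carrier A \<noteq> {\<zero>\<^bsub>A\<^esub>}"
      by (rule subfinite_exists_prime[OF R sub that]) (rule exI)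
    show "\<exists>P. ascending_chain A P (length as)"
      if as: "set as \<subseteq> carrier A" "\<not> algebraically_dependent R A \<phi> as" for as
    proof -
      have "\<not> algebraically_dependent_wrt lex_ordering R A \<phi> as"
        using as(2) algebraically_dependent_wrt_imp_dependent[OF monomial_ordering_lex_ordering] by blast
      then show ?thesis by (rule subfinite_chain_of_lex_independent[OF R sub as(1)]) (rule exI)
    qed
    show "\<exists>as. length as = n \<and> set as \<subseteq> carrier A \<and> \<not> algebraically_dependent R A \<phi> as"
      if "ascending_chain A P n" "n > 0" for P n
      using A.exists_independent_of_chain[OF R(1) \<phi>.homh that] by metis
  qed
qed

theorem theorem1p4:
  fixes R :: "('r, 'm) ring_scheme"
  shows "(cring R \<and> noetherian_ring R \<longrightarrow> trdeg_ring R = krull_dim R)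
    \<and> (\<forall>(A :: ('a, 'n) ring_scheme) \<phi>.
         cring R \<and> noetherian_ring R \<and> jacobson_ring R \<and> subfinite_algebra TYPE('b) R A \<phi>
         \<longrightarrow> trdeg_wrt lex_ordering R A \<phi> = krull_dim A)
    \<and> (\<forall>(A :: ('a, 'n) ring_scheme) \<phi>.
         cring R \<and> noetherian_ring R \<and> jacobson_ring R \<and> subfinite_algebra TYPE('b) R A \<phi>
           \<and> noetherian_ring A
         \<longrightarrow> trdeg R A \<phi> = krull_dim A)"
proof (intro conjI allI impI; elim conjE)
  show "trdeg_ring R = krull_dim R" if "cring R" "noetherian_ring R"
    using that by (rule trdeg_ring_eq_krull_dim)
  show "trdeg_wrt lex_ordering R A \<phi> = krull_dim A"
    if "cring R" "noetherian_ring R" "jacobson_ring R" "subfinite_algebra TYPE('b) R A \<phi>"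
    for A :: "('a, 'n) ring_scheme" and \<phi>
    using that by (rule trdeg_lex_eq_krull_dim)
  show "trdeg R A \<phi> = krull_dim A"
    if "cring R" "noetherian_ring R" "jacobson_ring R" "subfinite_algebra TYPE('b) R A \<phi>" "noetherian_ring A"
    for A :: "('a, 'n) ring_scheme" and \<phi>
    using that by (rule trdeg_noetherian_eq_krull_dim)
qed

end
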